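(* Let $\mathscr T$ be a T-mesh with $c$ cross-cuts, $t$ T $l$-edges and $n_v$ interior vertices, whose completely non-diagonalizable component (CNDC) has $s$ T $l$-edges and $n_{\textit{CNDC}}$ vertices, and set $$B_0(\mathscr T)=(d+1)^2+(c-t)(d+1)+n_v .$$ Let $h_d(\mathscr T)$ be Mourrain's homological correction term, and let $D_\iota^{\mathrm M}(\mathscr T)$, $D_\pi^{\mathrm{CNDC}}$, $L_K(\mathscr T)$, $U_K(\mathscr T)$ be as defined in the context. Then: (1) (Mourrain's dimension formula and bounds) $$B_0(\mathscr T)\le \dim S_d(\mathscr T)=B_0(\mathscr T)+h_d(\mathscr T)\le B_0(\mathscr T)+\min_{\iota}D_{\iota}^{\mathrm M}(\mathscr T).$$ (2) The upper bound in (1) coincides exactly with the upper bound $U_K(\mathscr T)$: $$U_K(\mathscr T)=B_0(\mathscr T)+\min_{\pi}D_{\pi}^{\mathrm{CNDC}}=B_0(\mathscr T)+\min_{\iota}D_{\iota}^{\mathrm M}(\mathscr T).$$ (3) The lower bound $B_0(\mathscr T)$ is in general smaller than the lower bound $L_K(\mathscr T)\le\dim S_d(\mathscr T)$; precisely, $$L_K(\mathscr T)=B_0(\mathscr T)+[s(d+1)-n_{\textit{CNDC}}]_+ .$$ Here $[\cdot]_+=\max\{\cdot,0\}$.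
   Context: Let $d\ge 1$ be an integer. A T-mesh $\mathscr T$ is a partition of a simply connected planar domain $\Phi$ into finitely many axis-aligned rectangles (cells), with T-junctions allowed. Vertices are the grid points of the mesh; a T-junction is an interior vertex of valence 3. An edge is a segment joining two adjacent vertices along a horizontal or vertical grid line; edges are boundary or interior. An $l$-edge is a maximal straight segment composed of collinear contiguous edges whose endpoints are T-junctions or boundary vertices. An interior $l$-edge is a cross-cut if both endpoints lie on the domain boundary, a T $l$-edge if both endpoints are T-junctions, and a ray otherwise. The T-connected component $T(\mathscr T)$ is the set of all T $l$-edges (with the vertices on them). For a T $l$-edge $l$, $n(l)$ is the number of vertices on $l$, endpoints included. $S_d(\mathscr T)$ is the space of functions $s$ on $\Phi$ that are $d-1$ times continuously differentiable in $x$ and $d-1$ times continuously differentiable in $y$ and whose restriction to every cell is a polynomial of bi-degree at most $(d,d)$. Standing assumptions: $T(\mathscr T)$ is connected (assumed without loss of generality), and no T $l$-edge is vanishable, i.e. $n(l)\ge d+2$ for every T $l$-edge $l$. CNDC. A sub-component of $T(\mathscr T)$ is a set of T $l$-edges with the vertices on them. A reasonable order is an ordering $l_1\succ l_2\succ\cdots$ such that for each $i$ the number of vertices remaining on $l_i$ after deleting its intersections with the preceding edges $l_j$, $j<i$, is at least $d+1$. $\mathscr T$ is diagonalizable if $T(\mathscr T)$ has a reasonable order. Let $\mathscr T$ be non-diagonalizable. A partition $\{T_1,T_2\}$ of the T $l$-edges, with $T_2=T(\mathscr T)\setminus T_1$ (vertices lying on edges of $T_1$ are deleted from the edges of $T_2$),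 is regular if $T_1$ has no reasonable order and $T_2$ has one ($T_2$ may be empty). A regular partition is complete if there is no other regular partition $\{T_1',T_2'\}$ with $T_1'$ a proper subset of $T_1$. The complete partition is unique; $T_1=\{l_1,\dots,l_s\}$ is called the CNDC. Let $n_{\textit{CNDC}}$ be the number of vertices lying on edges of $T_1$. A multi-vertex of the CNDC is a vertex that is the intersection of two T $l$-edges of $T_1$; $m(l)$ is the number of multi-vertices of the CNDC on $l\in T_1$. Ordering corrections. For an ordering $\iota$ of all $t$ T $l$-edges, let $\omega_\iota(l)$ be the number of vertices of $l$ that do not lie on a T $l$-edge of larger order than $l$, and $D_{\iota}^{\mathrm M}(\mathscr T)=\sum_{l\in T(\mathscr T)}[d+1-\omega_{\iota}(l)]_+$. For a permutation (ordering) $\pi$ of the $s$ CNDC edges, let $u_\pi^-(l_i)$ be the number of multi-vertices on $l_i$ shared with CNDC edges preceding $l_i$ in $\pi$, and $D_{\pi}^{\mathrm{CNDC}}=\sum_{i=1}^{s}[m(l_i)-n(l_i)+d+1-u_{\pi}^{-}(l_i)]_+$. Bounds. $L_K(\mathscr{T}) = (d+1)^2 + (c-t)(d+1) + n_v + (s(d+1) - n_{\textit{CNDC}})_+$ and $U_K(\mathscr{T})=(d+1)^2 + (c-t)(d+1) + n_v + \min_{\pi} \sum_{i=1}^s [ m(l_i) - n(l_i) + d + 1 - u_\pi^-(l_i) ]_+$. Homological correction term. Let $R$ be the space of real polynomials in $x,y$ of degree at most $d$ in each variable. For an interior edge $\tau$ on the line $\ell_\tau=0$ ($\ell_\tau=x-a$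 or $\ell_\tau=y-b$) let $J(\tau)=\{p\in R:\ \ell_\tau^{\,d}\mid p\}$. For an interior vertex $\gamma=(a,b)$ let $J(\gamma)=\{p\in R:(x-a)^d\mid p\}+\{p\in R:(y-b)^d\mid p\}$. Orient every interior edge and let $\partial:\bigoplus_{\tau}J(\tau)[\tau]\to\bigoplus_{\gamma}J(\gamma)[\gamma]$ (sums over interior edges and interior vertices) be the map $p[\tau]\mapsto p[\gamma_1]-p[\gamma_0]$, where $\gamma_0,\gamma_1$ are the initial and final endpoints of $\tau$ and terms for boundary vertices are set to $0$. Then $h_d(\mathscr T)=\dim\operatorname{coker}\partial$. *)

theory Defs
  imports
    "HOL-Analysis.Analysis"
    "HOL-Computational_Algebra.Polynomial"
    "HOL-Combinatorics.Multiset_Permutations"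
    "HOL-Library.Function_Algebras"
begin

section \<open>Linear algebra\<close>

text \<open>
  Dimension of the quotient space \<open>V / U\<close> for \<open>U \<subseteq> V\<close>: the number of elements of a finite set \<open>B \<subseteq> V\<close>
  whose classes form a basis of \<open>V / U\<close>, i.e. every class is a linear combination of the classes of
  \<open>B\<close> in exactly one way.
\<close>

definition (in vector_space) quot_dim :: "'b set \<Rightarrow> 'b set \<Rightarrow> nat" where
  "quot_dim V U =
    (THE k. \<exists>B. finite B \<and> B \<subseteq> V \<and> card B = k \<and>
       (\<forall>v\<in>V. \<exists>!c. (\<forall>b. b \<notin> B \<longrightarrow> c b = 0) \<and> v - (\<Sum>b\<in>B. scale (c b) b) \<in> U))"

interpretation fun_vs: vector_space "\<lambda>(c::real) (f :: 'a \<Rightarrow> real) z. c * f z"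
  by unfold_locales (auto simp: fun_eq_iff algebra_simps)

interpretation chain_vs: vector_space "\<lambda>(c::real) (f :: 'a \<Rightarrow> real poly poly) z. smult [:c:] (f z)"
  by unfold_locales (auto simp: fun_eq_iff smult_add_right smult_add_left[symmetric] pCons_one mult.commute)

definition pos_part :: "int \<Rightarrow> int" where
  "pos_part z = max 0 z"

section \<open>T-meshes\<close>

text \<open>
  A mesh is its set of cells. Besides simple connectedness of the closed domain \<open>\<Union>M\<close>, its interior
  is required to be connected, so that the domain has no pinch points.
\<close>

definition T_mesh :: "(real \<times> real) set set \<Rightarrow> bool" where
  "T_mesh M \<longleftrightarrow>
     M \<noteq> {} \<and> M division_of (\<Union>M) \<and> (\<forall>C\<in>M. interior C \<noteq> {}) \<and>
     simply_connected (\<Union>M) \<and> connected (interior (\<Union>M))"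

definition vertices :: "(real \<times> real) set set \<Rightarrow> (real \<times> real) set" where
  "vertices M = {v. \<exists>a b. cbox a b \<in> M \<and> v \<in> {fst a, fst b} \<times> {snd a, snd b}}"

definition interior_vertices :: "(real \<times> real) set set \<Rightarrow> (real \<times> real) set" where
  "interior_vertices M = vertices M \<inter> interior (\<Union>M)"

text \<open>
  Axis-parallel segments are pairs of endpoints, listed from left to right or from bottom to top;
  this also fixes the orientation of the edges.
\<close>

type_synonym seg = "(real \<times> real) \<times> (real \<times> real)"

definition horizontal :: "seg \<Rightarrow> bool" where
  "horizontal e \<longleftrightarrow> fst (fst e) < fst (snd e) \<and> snd (fst e) = snd (snd e)"

definition vertical :: "seg \<Rightarrow> bool" where
  "vertical e \<longleftrightarrow> fst (fst e) = fst (snd e) \<and> snd (fst e) < snd (snd e)"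

definition pts :: "seg \<Rightarrow> (real \<times> real) set" where
  "pts e = closed_segment (fst e) (snd e)"

definition edges :: "(real \<times> real) set set \<Rightarrow> seg set" where
  "edges M = {e. (horizontal e \<or> vertical e) \<and> fst e \<in> vertices M \<and> snd e \<in> vertices M \<and>
                 pts e \<subseteq> (\<Union>C\<in>M. frontier C) \<and> pts e \<inter> vertices M = {fst e, snd e}}"

definition interior_edges :: "(real \<times> real) set set \<Rightarrow> seg set" where
  "interior_edges M = {e \<in> edges M. open_segment (fst e) (snd e) \<subseteq> interior (\<Union>M)}"

definition valence :: "(real \<times> real) set set \<Rightarrow> real \<times> real \<Rightarrow> nat" where
  "valence M v = card {e \<in> edges M. fst e = v \<or> snd e = v}"

definition T_junction :: "(real \<times> real) set set \<Rightarrow> real \<times> real \<Rightarrow> bool" where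
  "T_junction M v \<longleftrightarrow> v \<in> interior_vertices M \<and> valence M v = 3"

definition boundary_vertex :: "(real \<times> real) set set \<Rightarrow> real \<times> real \<Rightarrow> bool" where
  "boundary_vertex M v \<longleftrightarrow> v \<in> vertices M \<and> v \<in> frontier (\<Union>M)"

text \<open>
  Interior l-edges are maximal among the segments composed of interior edges only: at a reentrant
  corner of the domain an interior l-edge ends, even if a boundary edge continues it.
\<close>

definition composed_of_interior_edges :: "(real \<times> real) set set \<Rightarrow> seg \<Rightarrow> bool" where
  "composed_of_interior_edges M l \<longleftrightarrow>
     (horizontal l \<or> vertical l) \<and> pts l = \<Union>{pts e | e. e \<in> interior_edges M \<and> pts e \<subseteq> pts l}"

definition interior_l_edges :: "(real \<times> real) set set \<Rightarrow> seg set" where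
  "interior_l_edges M =
     {l. composed_of_interior_edges M l \<and>
         (\<forall>l'. composed_of_interior_edges M l' \<and> pts l \<subseteq> pts l' \<longrightarrow> l' = l) \<and>
         (\<forall>v\<in>{fst l, snd l}. T_junction M v \<or> boundary_vertex M v)}"

definition cross_cuts :: "(real \<times> real) set set \<Rightarrow> seg set" where
  "cross_cuts M = {l \<in> interior_l_edges M. boundary_vertex M (fst l) \<and> boundary_vertex M (snd l)}"

definition T_l_edges :: "(real \<times> real) set set \<Rightarrow> seg set" where
  "T_l_edges M = {l \<in> interior_l_edges M. T_junction M (fst l) \<and> T_junction M (snd l)}"

definition n_on :: "(real \<times> real) set set \<Rightarrow> seg \<Rightarrow> nat" where
  "n_on M l = card (vertices M \<inter> pts l)"

section \<open>The spline space\<close>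

text \<open>Polynomials in \<open>x\<close> and \<open>y\<close> are polynomials in \<open>y\<close> with coefficients polynomials in \<open>x\<close>.\<close>

definition bipolys :: "nat \<Rightarrow> real poly poly set" where
  "bipolys d = {p. degree p \<le> d \<and> (\<forall>i. degree (coeff p i) \<le> d)}"

definition eval2 :: "real poly poly \<Rightarrow> real \<times> real \<Rightarrow> real" where
  "eval2 p z = poly (poly p [:snd z:]) (fst z)"

text \<open>
  \<open>k\<close> times continuously differentiable in one variable: the iterated partial derivatives \<open>D 0, \<dots>, D k\<close>
  exist and are continuous on \<open>\<Phi>\<close>, one-sided derivatives being taken at boundary points.
\<close>

definition cont_diff_x :: "nat \<Rightarrow> (real \<times> real) set \<Rightarrow> (real \<times> real \<Rightarrow> real) \<Rightarrow> bool" where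
  "cont_diff_x k \<Phi> s \<longleftrightarrow>
     (\<exists>D. D 0 = s \<and> (\<forall>j\<le>k. continuous_on \<Phi> (D j)) \<and>
       (\<forall>j<k. \<forall>(x, y)\<in>\<Phi>.
          ((\<lambda>u. D j (u, y)) has_real_derivative D (Suc j) (x, y)) (at x within {u. (u, y) \<in> \<Phi>})))"

definition cont_diff_y :: "nat \<Rightarrow> (real \<times> real) set \<Rightarrow> (real \<times> real \<Rightarrow> real) \<Rightarrow> bool" where
  "cont_diff_y k \<Phi> s \<longleftrightarrow>
     (\<exists>D. D 0 = s \<and> (\<forall>j\<le>k. continuous_on \<Phi> (D j)) \<and>
       (\<forall>j<k. \<forall>(x, y)\<in>\<Phi>.
          ((\<lambda>u. D j (x, u)) has_real_derivative D (Suc j) (x, y)) (at y within {u. (x, u) \<in> \<Phi>})))"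

text \<open>Functions on the domain are represented by functions on the plane vanishing outside it.\<close>

definition splines :: "(real \<times> real) set set \<Rightarrow> nat \<Rightarrow> (real \<times> real \<Rightarrow> real) set" where
  "splines M d = {s. (\<forall>z. z \<notin> \<Union>M \<longrightarrow> s z = 0) \<and>
                     cont_diff_x (d - 1) (\<Union>M) s \<and> cont_diff_y (d - 1) (\<Union>M) s \<and>
                     (\<forall>C\<in>M. \<exists>p\<in>bipolys d. \<forall>z\<in>C. s z = eval2 p z)}"

definition dim_splines :: "(real \<times> real) set set \<Rightarrow> nat \<Rightarrow> nat" where
  "dim_splines M d = fun_vs.dim (splines M d)"

section \<open>The homological correction term\<close>

text \<open>The linear forms \<open>x - a\<close> and \<open>y - b\<close>.\<close>

definition lin_x :: "real \<Rightarrow> real poly poly" where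
  "lin_x a = [:[:- a, 1:]:]"

definition lin_y :: "real \<Rightarrow> real poly poly" where
  "lin_y b = [:[:- b:], 1:]"

definition J_edge :: "nat \<Rightarrow> seg \<Rightarrow> real poly poly set" where
  "J_edge d e = {p \<in> bipolys d.
     (if vertical e then lin_x (fst (fst e)) else lin_y (snd (fst e))) ^ d dvd p}"

definition J_vertex :: "nat \<Rightarrow> real \<times> real \<Rightarrow> real poly poly set" where
  "J_vertex d v = {p + q | p q. p \<in> bipolys d \<and> lin_x (fst v) ^ d dvd p \<and>
                                q \<in> bipolys d \<and> lin_y (snd v) ^ d dvd q}"

definition edge_chains :: "(real \<times> real) set set \<Rightarrow> nat \<Rightarrow> (seg \<Rightarrow> real poly poly) set" where
  "edge_chains M d = {f. (\<forall>e\<in>interior_edges M. f e \<in> J_edge d e) \<and>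
                         (\<forall>e. e \<notin> interior_edges M \<longrightarrow> f e = 0)}"

definition vertex_chains :: "(real \<times> real) set set \<Rightarrow> nat \<Rightarrow> (real \<times> real \<Rightarrow> real poly poly) set" where
  "vertex_chains M d = {g. (\<forall>v\<in>interior_vertices M. g v \<in> J_vertex d v) \<and>
                           (\<forall>v. v \<notin> interior_vertices M \<longrightarrow> g v = 0)}"

definition bdry :: "(real \<times> real) set set \<Rightarrow> (seg \<Rightarrow> real poly poly) \<Rightarrow> real \<times> real \<Rightarrow> real poly poly" where
  "bdry M f v =
     (if v \<in> interior_vertices M
      then (\<Sum>e\<in>{e \<in> interior_edges M. snd e = v}. f e) - (\<Sum>e\<in>{e \<in> interior_edges M. fst e = v}. f e)
      else 0)"

definition hom_corr :: "(real \<times> real) set set \<Rightarrow> nat \<Rightarrow> nat" where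
  "hom_corr M d = chain_vs.quot_dim (vertex_chains M d) (bdry M ` edge_chains M d)"

section \<open>The completely non-diagonalizable component\<close>

text \<open>
  \<open>W\<close> is the set of vertices that have not been deleted from the sub-component. Orders are lists with
  the largest element first.
\<close>

definition reasonable_order :: "nat \<Rightarrow> (real \<times> real) set \<Rightarrow> seg list \<Rightarrow> bool" where
  "reasonable_order d W ls \<longleftrightarrow>
     (\<forall>i<length ls. card {v \<in> W. v \<in> pts (ls ! i) \<and> (\<forall>j<i. v \<notin> pts (ls ! j))} \<ge> d + 1)"

definition has_reasonable_order :: "nat \<Rightarrow> (real \<times> real) set \<Rightarrow> seg set \<Rightarrow> bool" where
  "has_reasonable_order d W A \<longleftrightarrow> (\<exists>ls\<in>permutations_of_set A. reasonable_order d W ls)"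

definition diagonalizable :: "(real \<times> real) set set \<Rightarrow> nat \<Rightarrow> bool" where
  "diagonalizable M d \<longleftrightarrow> has_reasonable_order d (vertices M) (T_l_edges M)"

definition regular_partition :: "(real \<times> real) set set \<Rightarrow> nat \<Rightarrow> seg set \<Rightarrow> seg set \<Rightarrow> bool" where
  "regular_partition M d T1 T2 \<longleftrightarrow>
     T1 \<subseteq> T_l_edges M \<and> T2 = T_l_edges M - T1 \<and>
     \<not> has_reasonable_order d (vertices M) T1 \<and>
     has_reasonable_order d (vertices M - (\<Union>l\<in>T1. pts l)) T2"

definition complete_partition :: "(real \<times> real) set set \<Rightarrow> nat \<Rightarrow> seg set \<Rightarrow> seg set \<Rightarrow> bool" where
  "complete_partition M d T1 T2 \<longleftrightarrow>
     regular_partition M d T1 T2 \<and>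
     \<not> (\<exists>T1' T2'. regular_partition M d T1' T2' \<and> T1' \<subset> T1)"

text \<open>By convention the CNDC of a diagonalizable mesh is empty.\<close>

definition is_CNDC :: "(real \<times> real) set set \<Rightarrow> nat \<Rightarrow> seg set \<Rightarrow> bool" where
  "is_CNDC M d K \<longleftrightarrow>
     (if diagonalizable M d then K = {} else \<exists>T2. complete_partition M d K T2)"

definition n_CNDC :: "(real \<times> real) set set \<Rightarrow> seg set \<Rightarrow> nat" where
  "n_CNDC M K = card {v \<in> vertices M. \<exists>l\<in>K. v \<in> pts l}"

definition multi_vertices :: "(real \<times> real) set set \<Rightarrow> seg set \<Rightarrow> (real \<times> real) set" where
  "multi_vertices M K = {v \<in> vertices M. \<exists>l\<in>K. \<exists>l'\<in>K. l \<noteq> l' \<and> v \<in> pts l \<and> v \<in> pts l'}"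

definition m_on :: "(real \<times> real) set set \<Rightarrow> seg set \<Rightarrow> seg \<Rightarrow> nat" where
  "m_on M K l = card (multi_vertices M K \<inter> pts l)"

section \<open>Ordering corrections and bounds\<close>

text \<open>
  In \<open>\<omega>\<close> and \<open>D_M\<close> the order of an edge is its position in the list \<open>\<iota>\<close>, so that edges of larger order
  come later.
\<close>

definition \<omega> :: "(real \<times> real) set set \<Rightarrow> seg list \<Rightarrow> nat \<Rightarrow> nat" where
  "\<omega> M \<iota> i = card {v \<in> vertices M. v \<in> pts (\<iota> ! i) \<and>
                     \<not> (\<exists>j. i < j \<and> j < length \<iota> \<and> v \<in> pts (\<iota> ! j))}"

definition D_M :: "(real \<times> real) set set \<Rightarrow> nat \<Rightarrow> seg list \<Rightarrow> int" where
  "D_M M d \<iota> = (\<Sum>i<length \<iota>. pos_part (int d + 1 - int (\<omega> M \<iota> i)))"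

definition u_minus :: "(real \<times> real) set set \<Rightarrow> seg set \<Rightarrow> seg list \<Rightarrow> nat \<Rightarrow> nat" where
  "u_minus M K \<pi> i = card {v \<in> multi_vertices M K. v \<in> pts (\<pi> ! i) \<and> (\<exists>j<i. v \<in> pts (\<pi> ! j))}"

definition D_CNDC :: "(real \<times> real) set set \<Rightarrow> nat \<Rightarrow> seg set \<Rightarrow> seg list \<Rightarrow> int" where
  "D_CNDC M d K \<pi> =
     (\<Sum>i<length \<pi>. pos_part (int (m_on M K (\<pi> ! i)) - int (n_on M (\<pi> ! i)) + int d + 1
                              - int (u_minus M K \<pi> i)))"

definition B0 :: "(real \<times> real) set set \<Rightarrow> nat \<Rightarrow> int" where
  "B0 M d = (int d + 1)^2 + (int (card (cross_cuts M)) - int (card (T_l_edges M))) * (int d + 1)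
            + int (card (interior_vertices M))"

definition L_K :: "(real \<times> real) set set \<Rightarrow> nat \<Rightarrow> seg set \<Rightarrow> int" where
  "L_K M d K = (int d + 1)^2 + (int (card (cross_cuts M)) - int (card (T_l_edges M))) * (int d + 1)
               + int (card (interior_vertices M))
               + pos_part (int (card K) * (int d + 1) - int (n_CNDC M K))"

definition U_K :: "(real \<times> real) set set \<Rightarrow> nat \<Rightarrow> seg set \<Rightarrow> int" where
  "U_K M d K = (int d + 1)^2 + (int (card (cross_cuts M)) - int (card (T_l_edges M))) * (int d + 1)
               + int (card (interior_vertices M))
               + (MIN \<pi>\<in>permutations_of_set K.
                    \<Sum>i<card K. pos_part (int (m_on M K (\<pi> ! i)) - int (n_on M (\<pi> ! i)) + int d + 1
                                         - int (u_minus M K \<pi> i)))"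

end

(*
  A spline is a family of polynomial pieces whose jumps across interior edges are divisible by the
  d-th power of the linear form of the edge. Up to a global polynomial such a family is determined
  by its jumps, and a family of jumps comes from pieces iff it is a cycle, since the domain is simply
  connected. Hence dim S = (d+1)^2 + dim ker(bdry), and Mourrain's formula follows by rank-nullity
  from E = 2 V + c - t, which is obtained by following the interior l-edges.

  Modulo boundaries, a chain at a vertex can be moved along the l-edge through it, and it vanishes if
  this l-edge reaches the boundary of the domain. So the cokernel is the sum of the spaces of univariate
  polynomials of degree d, one for each T l-edge, modulo one relation per vertex, which identifies the
  d-th powers of the linear forms of the two l-edges through it. Discarding the T l-edges outside the
  CNDC and counting relations yields the lower bound. For the upper bound, add the T l-edges in the
  given order and use that any d+1 powers (x - g)^d with distinct g span the polynomials of degree d.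
  The two minima agree because an ordering of the CNDC extends by the reversed reasonable order of the
  remaining edges, at no cost.
*)

theory Submission
  imports Defs "HOL-Complex_Analysis.Complex_Analysis"
begin

section \<open>Dimension of subspaces and quotients\<close>

text \<open>Three obstacles shape the development. Smoothness is demanded at every point of the
  domain, while the algebra controls only jumps across edges; two cells that meet in a single
  boundary corner must therefore be linked by edges through that corner. This is
  \<open>no_pinch\<close>, which rests on simple connectedness together with the connected interior.
  Next, the exactness of jumps is a combinatorial statement over the reals but is derived from
  complex logarithms, so the mesh is placed in the complex plane and simple connectedness is passed
  on to the interior. Finally, cells, edges and vertices are mere point sets, so incidence has to be
  recovered locally: each of the four quadrants at a point is filled by at most one cell, and edges
  run along the rays between quadrants that are filled differently. The coefficient 1 of the vertex
  count and the single relation per vertex have the same source: the two spaces of dimension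
  \<open>d + 1\<close> at a vertex (a, b) meet in the line spanned by (x - a)^d (y - b)^d.\<close>

lemma ex1_implies_unique: "\<exists>!x. P x \<Longrightarrow> P a \<Longrightarrow> P b \<Longrightarrow> a = b"
  by blast

locale dim_space = vector_space scale
  for scale :: "'a::field \<Rightarrow> 'b::ab_group_add \<Rightarrow> 'b"
begin

text \<open>Unlike \<open>dim\<close>, this also certifies that \<open>V\<close> is a subspace and
  that it is finite-dimensional.\<close>

definition has_dim :: "'b set \<Rightarrow> nat \<Rightarrow> bool" where
  "has_dim V n \<longleftrightarrow> (\<exists>B. finite B \<and> independent B \<and> span B = V \<and> card B = n)"

lemma has_dimI: "finite B \<Longrightarrow> independent B \<Longrightarrow> span B = V \<Longrightarrow> card B = n \<Longrightarrow> has_dim V n"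
  unfolding has_dim_def by blast

lemma has_dimE:
  assumes "has_dim V n"
  obtains B where "finite B" "independent B" "span B = V" "card B = n"
  using assms unfolding has_dim_def by blast

lemma has_dim_subspace: "has_dim V n \<Longrightarrow> subspace V"
  unfolding has_dim_def by auto

lemma has_dim_dim: "has_dim V n \<Longrightarrow> dim V = n"
  unfolding has_dim_def by (metis dim_span_eq_card_independent)

lemma has_dim_unique: "has_dim V n \<Longrightarrow> has_dim V m \<Longrightarrow> n = m"
  using has_dim_dim by metis

lemma has_dim_spanning:
  assumes "subspace V" "V \<subseteq> span B" "finite B"
  obtains m where "m \<le> card B" "has_dim V m"
proof -
  obtain A where A: "A \<subseteq> V" "independent A" "V \<subseteq> span A"
    using maximal_independent_subset[of V] by metis
  have "finite A \<and> card A \<le> card B"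
    using independent_span_bound[OF assms(3) A(2)] A(1) assms(2) by blast
  moreover have "span A = V"
    using A assms(1) span_minimal by blast
  ultimately show ?thesis using A that[of "card A"] unfolding has_dim_def by blast
qed

lemma has_dim_sub:
  assumes "has_dim V n" "subspace W" "W \<subseteq> V"
  obtains m where "m \<le> n" "has_dim W m"
  using assms has_dim_spanning unfolding has_dim_def by metis

lemma has_dim_card_independent_le:
  assumes "independent A" "A \<subseteq> span B" "finite B"
  shows "card A \<le> card B"
  using independent_span_bound[OF assms(3,1,2)] by blast

lemma has_dim_extend:
  assumes "has_dim U m" "has_dim V n" "U \<subseteq> V"
  obtains A B where "finite A" "finite B" "A \<inter> B = {}" "independent (A \<union> B)"
    "span A = U" "span (A \<union> B) = V" "card A = m" "card B = n - m" "m \<le> n"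
proof -
  obtain A where A: "finite A" "independent A" "span A = U" "card A = m"
    using assms(1) by (rule has_dimE)
  obtain D where D: "finite D" "independent D" "span D = V" "card D = n"
    using assms(2) by (rule has_dimE)
  have "A \<subseteq> V" using A(3) span_superset assms(3) by blast
  then obtain C where C: "A \<subseteq> C" "C \<subseteq> V" "independent C" "V \<subseteq> span C"
    using maximal_independent_subset_extend[OF _ A(2)] by metis
  have fC: "finite C" using independent_span_bound[OF D(1) C(3)] C(2) D(3) by blast
  have sC: "span C = V" using C(2,4) D(3) span_minimal subspace_span by blast
  have "card C = n" using has_dim_unique[of V "card C" n] fC C(3) sC assms(2) unfolding has_dim_def by blast
  moreover have "card (C - A) = card C - card A" using card_Diff_subset[OF A(1) C(1)] .
  moreover have "card A \<le> card C" using card_mono fC C(1) by blast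
  moreover have "A \<union> (C - A) = C" using C(1) by blast
  ultimately show ?thesis
    using that[of A "C - A"] A C(3) sC fC by auto
qed

lemma has_dim_eq:
  assumes "has_dim U n" "has_dim V n" "U \<subseteq> V"
  shows "U = V"
proof -
  obtain A B where AB: "finite B" "span A = U" "span (A \<union> B) = V" "card B = n - n"
    using has_dim_extend[OF assms] by metis
  then have "B = {}" by simp
  then show ?thesis using AB by simp
qed

text \<open>Representatives of a basis of the quotient, joined to a basis of \<open>U\<close>, form
  a basis of \<open>V\<close>: existence of the coefficients gives spanning, uniqueness gives
  independence.\<close>

lemma quot_dim_basis:
  assumes U: "has_dim U m" and V: "has_dim V n" and UV: "U \<subseteq> V"
    and B: "finite B" "B \<subseteq> V"
    and ex1: "\<forall>v\<in>V. \<exists>!c. (\<forall>b. b \<notin> B \<longrightarrow> c b = 0) \<and> v - (\<Sum>b\<in>B. scale (c b) b) \<in> U"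
  shows "card B + m = n"
proof -
  obtain A where A: "finite A" "independent A" "span A = U" "card A = m"
    using U by (rule has_dimE)
  have sU: "subspace U" and sV: "subspace V" using U V has_dim_subspace by auto
  \<comment> \<open>The zero vector is also represented by zero coefficients, so uniqueness applied
    to it makes \<open>B\<close> independent modulo \<open>U\<close>.\<close>
  have z: "c b = 0" if "(\<Sum>b\<in>B. scale (c b) b) \<in> U" "b \<in> B" for c b
  proof -
    let ?c = "\<lambda>b. if b \<in> B then - c b else 0"
    have "(\<Sum>b\<in>B. scale (?c b) b) = - (\<Sum>b\<in>B. scale (c b) b)"
      by (simp add: sum_negf[symmetric])
    then have "0 - (\<Sum>b\<in>B. scale (?c b) b) \<in> U" using that(1) by simp
    moreover have "0 - (\<Sum>b\<in>B. scale ((\<lambda>b. 0) b) b) \<in> U" using subspace_0[OF sU] by simp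
    ultimately have "?c = (\<lambda>b. 0)"
      using ex1[rule_format, OF subspace_0[OF sV], THEN ex1_implies_unique, of ?c "\<lambda>b. 0"]
      by simp
    then show ?thesis using that(2) by (metis neg_equal_0_iff_equal)
  qed
  have disj: "A \<inter> B = {}"
  proof (rule ccontr)
    assume "A \<inter> B \<noteq> {}"
    then obtain b where b: "b \<in> A" "b \<in> B" by blast
    have "(\<Sum>x\<in>B. scale ((\<lambda>x. if x = b then 1 else 0) x) x) = b"
      using b B(1) by (simp add: if_distrib[of "\<lambda>r. scale r _"] cong: if_cong)
    moreover have "b \<in> U" using b A(3) span_base by blast
    ultimately show False using z[of "\<lambda>x. if x = b then 1 else 0" b] b by auto
  qed
  have ind: "independent (A \<union> B)"
  proof (rule independent_if_scalars_zero)
    show "finite (A \<union> B)" using A B by auto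
    fix f x assume s: "(\<Sum>x\<in>A \<union> B. scale (f x) x) = 0" and x: "x \<in> A \<union> B"
    have split: "(\<Sum>x\<in>A. scale (f x) x) + (\<Sum>x\<in>B. scale (f x) x) = 0"
      using s sum.union_disjoint[OF A(1) B(1) disj] by metis
    have "(\<Sum>x\<in>A. scale (f x) x) \<in> U"
      unfolding A(3)[symmetric] by (intro span_sum span_scale span_base)
    moreover have "(\<Sum>x\<in>B. scale (f x) x) = - (\<Sum>x\<in>A. scale (f x) x)"
      using split by (simp add: add_eq_0_iff)
    ultimately have "(\<Sum>x\<in>B. scale (f x) x) \<in> U" using subspace_neg[OF sU] by simp
    then have fB: "\<forall>b\<in>B. f b = 0" using z by blast
    then have "(\<Sum>x\<in>A. scale (f x) x) = 0" using split by simp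
    then have "\<forall>a\<in>A. f a = 0"
      using A(1,2) independent_explicit_finite_subsets[of A] by blast
    then show "f x = 0" using fB x by blast
  qed
  have "V \<subseteq> span (A \<union> B)"
  proof
    fix v assume "v \<in> V"
    then obtain c where "v - (\<Sum>b\<in>B. scale (c b) b) \<in> U" using ex1 by blast
    then have "v - (\<Sum>b\<in>B. scale (c b) b) \<in> span (A \<union> B)"
      using A(3) span_mono[of A "A \<union> B"] by blast
    moreover have "(\<Sum>b\<in>B. scale (c b) b) \<in> span (A \<union> B)"
      by (intro span_sum span_scale span_base) auto
    ultimately have "(v - (\<Sum>b\<in>B. scale (c b) b)) + (\<Sum>b\<in>B. scale (c b) b) \<in> span (A \<union> B)"
      by (rule span_add)
    then show "v \<in> span (A \<union> B)" by simp
  qed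
  moreover have "A \<union> B \<subseteq> V" using A(3) span_superset UV B by blast
  ultimately have "span (A \<union> B) = V" using span_minimal[OF _ sV] by blast
  then have "has_dim V (card (A \<union> B))"
    using has_dimI[OF finite_UnI[OF A(1) B(1)] ind] by blast
  then have "n = card (A \<union> B)" using V has_dim_unique by blast
  then show ?thesis using card_Un_disjoint[OF A(1) B(1) disj] A(4) by simp
qed

text \<open>The definite description in \<open>quot_dim\<close> denotes: a basis of \<open>U\<close>
  extended to \<open>V\<close> provides one witness, and \<open>quot_dim_basis\<close> fixes the
  cardinality of every other.\<close>

lemma quot_dim_has_dim:
  assumes U: "has_dim U m" and V: "has_dim V n" and UV: "U \<subseteq> V"
  shows "quot_dim V U + m = n"
proof -
  obtain A B where AB: "finite A" "finite B" "A \<inter> B = {}" "independent (A \<union> B)"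
    "span A = U" "span (A \<union> B) = V" "card A = m" "card B = n - m" "m \<le> n"
    using has_dim_extend[OF U V UV] by metis
  have sU: "subspace U" using U has_dim_subspace by auto
  have ex: "\<exists>!c. (\<forall>b. b \<notin> B \<longrightarrow> c b = 0) \<and> v - (\<Sum>b\<in>B. scale (c b) b) \<in> U" if "v \<in> V" for v
  proof -
    obtain x y where xy: "v = x + y" "x \<in> span A" "y \<in> span B"
      using \<open>v \<in> V\<close> unfolding AB(6)[symmetric] span_Un by blast
    obtain c where c: "y = (\<Sum>b\<in>B. scale (c b) b)"
      using xy(3) span_finite[OF AB(2)] by auto
    let ?c = "\<lambda>b. if b \<in> B then c b else 0"
    have "(\<Sum>b\<in>B. scale (?c b) b) = y" using c by (auto intro: sum.cong)
    then have 1: "(\<forall>b. b \<notin> B \<longrightarrow> ?c b = 0) \<and> v - (\<Sum>b\<in>B. scale (?c b) b) \<in> U"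
      using xy AB(5) by auto
    have 2: "c1 = c2" if c1: "(\<forall>b. b \<notin> B \<longrightarrow> c1 b = 0) \<and> v - (\<Sum>b\<in>B. scale (c1 b) b) \<in> U"
      and c2: "(\<forall>b. b \<notin> B \<longrightarrow> c2 b = 0) \<and> v - (\<Sum>b\<in>B. scale (c2 b) b) \<in> U" for c1 c2
    proof -
      have "(v - (\<Sum>b\<in>B. scale (c2 b) b)) - (v - (\<Sum>b\<in>B. scale (c1 b) b)) \<in> U"
        using c1 c2 subspace_diff[OF sU] by blast
      then have "(\<Sum>b\<in>B. scale (c1 b - c2 b) b) \<in> U"
        by (simp add: scale_left_diff_distrib sum_subtractf)
      then have "\<exists>a. (\<Sum>b\<in>B. scale (c1 b - c2 b) b) = (\<Sum>x\<in>A. scale (a x) x)"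
        using AB(5) span_finite[OF AB(1)] by auto
      then obtain a where a: "(\<Sum>b\<in>B. scale (c1 b - c2 b) b) = (\<Sum>x\<in>A. scale (a x) x)" ..
      \<comment> \<open>Two representations of \<open>v\<close> differ by an element of the span of
        \<open>A\<close>; moving it to the other side yields a relation on the independent set
        \<open>A \<union> B\<close>.\<close>
      let ?g = "\<lambda>x. if x \<in> A then a x else c2 x - c1 x"
      have "(\<Sum>x\<in>A. scale (?g x) x) = (\<Sum>x\<in>A. scale (a x) x)" by (auto intro: sum.cong)
      moreover have "(\<Sum>x\<in>B. scale (?g x) x) = - (\<Sum>b\<in>B. scale (c1 b - c2 b) b)"
        using AB(3) unfolding sum_negf[symmetric] scale_minus_left[symmetric]
        by (intro sum.cong) auto
      ultimately have "(\<Sum>x\<in>A \<union> B. scale (?g x) x) = 0"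
        using sum.union_disjoint[OF AB(1,2,3), of "\<lambda>x. scale (?g x) x"] a by simp
      then have "\<forall>x\<in>A \<union> B. ?g x = 0"
        using independent_explicit_finite_subsets[THEN iffD1, OF AB(4), rule_format, of "A \<union> B" ?g]
          finite_UnI[OF AB(1,2)] by blast
      then have *: "c1 b = c2 b" if "b \<in> B" for b
        using that AB(3) by (metis UnI2 disjoint_iff right_minus_eq)
      show "c1 = c2"
      proof
        fix b show "c1 b = c2 b" using * c1 c2 by (cases "b \<in> B") auto
      qed
    qed
    show ?thesis by (rule ex1I[where a="?c"], rule 1, rule 2[OF _ 1])
  qed
  have BV: "B \<subseteq> V" using AB(6) span_superset by blast
  have "quot_dim V U = n - m"
    unfolding quot_dim_def
  proof (rule the_equality)
    show "\<exists>B. finite B \<and> B \<subseteq> V \<and> card B = n - m \<and>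
       (\<forall>v\<in>V. \<exists>!c. (\<forall>b. b \<notin> B \<longrightarrow> c b = 0) \<and> v - (\<Sum>b\<in>B. scale (c b) b) \<in> U)"
      by (intro exI[where x=B] conjI ballI ex AB(2,8) BV)
  next
    fix k assume "\<exists>B. finite B \<and> B \<subseteq> V \<and> card B = k \<and>
       (\<forall>v\<in>V. \<exists>!c. (\<forall>b. b \<notin> B \<longrightarrow> c b = 0) \<and> v - (\<Sum>b\<in>B. scale (c b) b) \<in> U)"
    then obtain B' where B': "finite B'" "B' \<subseteq> V" "card B' = k" and ex1:
      "\<forall>v\<in>V. \<exists>!c. (\<forall>b. b \<notin> B' \<longrightarrow> c b = 0) \<and> v - (\<Sum>b\<in>B'. scale (c b) b) \<in> U"
      by (elim exE conjE)
    show "k = n - m" using quot_dim_basis[OF U V UV B'(1,2) ex1] B'(3) by simp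
  qed
  then show ?thesis using AB(9) by simp
qed

lemma quot_dim_le_card:
  assumes U: "has_dim U m" and V: "has_dim V n" and UV: "U \<subseteq> V"
    and B: "finite B" "V \<subseteq> span (U \<union> B)"
  shows "quot_dim V U \<le> card B"
proof -
  obtain A where A: "finite A" "independent A" "span A = U" "card A = m"
    using U by (rule has_dimE)
  have "span (U \<union> B) = span (A \<union> B)"
    unfolding A(3)[symmetric] span_Un span_span ..
  then have "V \<subseteq> span (A \<union> B)" using B by simp
  moreover obtain C where C: "finite C" "independent C" "span C = V" "card C = n"
    using V by (rule has_dimE)
  ultimately have "card C \<le> card (A \<union> B)"
    using has_dim_card_independent_le[OF C(2), of "A \<union> B"] A(1) B(1) span_superset[of C] by auto
  also have "\<dots> \<le> card A + card B" by (rule card_Un_le)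
  finally show ?thesis using quot_dim_has_dim[OF U V UV] A C by simp
qed

lemma quot_dim_complement:
  assumes U: "has_dim U m" and V: "has_dim V n" and UV: "U \<subseteq> V"
  obtains B where "finite B" "B \<subseteq> V" "card B = quot_dim V U" "V = span (U \<union> B)"
proof -
  obtain A B where AB: "finite A" "finite B" "A \<inter> B = {}" "independent (A \<union> B)"
    "span A = U" "span (A \<union> B) = V" "card A = m" "card B = n - m" "m \<le> n"
    using has_dim_extend[OF U V UV] by metis
  have "span (U \<union> B) = span (A \<union> B)"
    unfolding AB(5)[symmetric] span_Un span_span ..
  moreover have "card B = quot_dim V U" using quot_dim_has_dim[OF U V UV] AB by simp
  moreover have "B \<subseteq> V" using AB(6) span_superset by blast
  ultimately show ?thesis using that AB by simp
qed

end

locale dim_space_pair = vs1: dim_space s1 + vs2: dim_space s2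
  for s1 :: "'a::field \<Rightarrow> 'b::ab_group_add \<Rightarrow> 'b"
  and s2 :: "'a::field \<Rightarrow> 'c::ab_group_add \<Rightarrow> 'c"
begin

sublocale vector_space_pair s1 s2 ..

text \<open>Finite dimension of \<open>V\<close> is a conclusion: lifts of a basis of the image
  complete a basis of the kernel. This form serves for chain spaces, \<open>J_vertex\<close> and
  \<open>piece_families\<close>.\<close>

lemma has_dim_kernel_image:
  assumes f: "Vector_Spaces.linear s1 s2 f" and V: "vs1.subspace V"
    and K: "vs1.has_dim {x\<in>V. f x = 0} m" and I: "vs2.has_dim (f ` V) n"
  shows "vs1.has_dim V (m + n)"
proof -
  interpret f: Vector_Spaces.linear s1 s2 f by (rule f)
  obtain A where A: "finite A" "vs1.independent A" "vs1.span A = {x\<in>V. f x = 0}" "card A = m"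
    using K by (rule vs1.has_dimE)
  obtain C where C: "finite C" "vs2.independent C" "vs2.span C = f ` V" "card C = n"
    using I by (rule vs2.has_dimE)
  have "\<forall>c\<in>C. \<exists>x\<in>V. f x = c" using C(3) vs2.span_superset[of C] by (metis imageE subsetD)
  then obtain g where g: "\<And>c. c \<in> C \<Longrightarrow> g c \<in> V \<and> f (g c) = c" by metis
  define B where "B = g ` C"
  have inj: "inj_on g C" using g by (metis inj_onI)
  have fB: "finite B" "card B = n" using C card_image[OF inj] by (auto simp: B_def)
  have AV: "A \<subseteq> {x\<in>V. f x = 0}" using A(3) vs1.span_superset[of A] by simp
  have disj: "A \<inter> B = {}"
  proof (rule ccontr)
    assume "A \<inter> B \<noteq> {}"
    then obtain c where "c \<in> C" "g c \<in> A" unfolding B_def by blast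
    then have "c = 0" using AV g[of c] by auto
    then show False using C(2) \<open>c \<in> C\<close> vs2.dependent_zero by blast
  qed
  have sumB: "(\<Sum>b\<in>B. s1 (u b) b) = (\<Sum>c\<in>C. s1 (u (g c)) (g c))" for u
    unfolding B_def by (simp add: sum.reindex[OF inj])
  have fsumB: "f (\<Sum>b\<in>B. s1 (u b) b) = (\<Sum>c\<in>C. s2 (u (g c)) c)" for u
    unfolding sumB f.sum f.scale using g by (auto intro: sum.cong)
  have ind: "vs1.independent (A \<union> B)"
  proof (rule vs1.independent_if_scalars_zero)
    show "finite (A \<union> B)" using A fB by auto
    fix u x assume s: "(\<Sum>x\<in>A \<union> B. s1 (u x) x) = 0" and x: "x \<in> A \<union> B"
    have split: "(\<Sum>x\<in>A. s1 (u x) x) + (\<Sum>x\<in>B. s1 (u x) x) = 0"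
      using s sum.union_disjoint[OF A(1) fB(1) disj] by metis
    have "f (\<Sum>x\<in>A. s1 (u x) x) = 0" unfolding f.sum f.scale
      using AV by (intro sum.neutral) auto
    then have "f (\<Sum>x\<in>B. s1 (u x) x) = 0" using split f.add f.zero by (metis add_0)
    then have "\<forall>c\<in>C. u (g c) = 0"
      using fsumB C(1,2) vs2.independent_explicit_finite_subsets[of C] by force
    then have uB: "\<forall>b\<in>B. u b = 0" unfolding B_def by blast
    then have "(\<Sum>x\<in>A. s1 (u x) x) = 0" using split by simp
    then have "\<forall>a\<in>A. u a = 0"
      using A(1,2) vs1.independent_explicit_finite_subsets[of A] by blast
    then show "u x = 0" using uB x by blast
  qed
  have "V \<subseteq> vs1.span (A \<union> B)"
  proof
    fix v assume v: "v \<in> V"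
    then have "f v \<in> vs2.span C" using C(3) by blast
    then obtain c where c: "f v = (\<Sum>x\<in>C. s2 (c x) x)" using vs2.span_finite[OF C(1)] by auto
    let ?w = "\<Sum>x\<in>C. s1 (c x) (g x)"
    have "?w \<in> V" using g V by (intro vs1.subspace_sum vs1.subspace_scale) auto
    moreover have "f ?w = f v" unfolding c f.sum f.scale using g by (auto intro: sum.cong)
    ultimately have "v - ?w \<in> vs1.span A"
      unfolding A(3) using v V by (auto simp: f.diff vs1.subspace_diff)
    then have "v - ?w \<in> vs1.span (A \<union> B)" using vs1.span_mono[of A "A \<union> B"] by blast
    moreover have "?w \<in> vs1.span (A \<union> B)"
      by (intro vs1.span_sum vs1.span_scale vs1.span_base) (auto simp: B_def)
    ultimately have "(v - ?w) + ?w \<in> vs1.span (A \<union> B)" by (rule vs1.span_add)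
    then show "v \<in> vs1.span (A \<union> B)" by simp
  qed
  moreover have "A \<union> B \<subseteq> V" using AV g unfolding B_def by blast
  ultimately have "vs1.span (A \<union> B) = V" using vs1.span_minimal[OF _ V] by blast
  then show ?thesis
    using vs1.has_dimI[OF _ ind] A fB card_Un_disjoint[OF A(1) fB(1) disj] by auto
qed

lemma has_dim_image:
  assumes f: "Vector_Spaces.linear s1 s2 f" and V: "vs1.has_dim V n"
  obtains k where "vs2.has_dim (f ` V) k"
proof -
  interpret f: Vector_Spaces.linear s1 s2 f by (rule f)
  obtain B where B: "finite B" "vs1.span B = V" using V by (metis vs1.has_dimE)
  have "f ` V = vs2.span (f ` B)" using f.span_image B(2) by metis
  then show ?thesis
    using vs2.has_dim_spanning[of "f ` V" "f ` B"] that B(1) vs2.subspace_span by (metis finite_imageI subset_refl)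
qed

lemma rank_nullity:
  assumes f: "Vector_Spaces.linear s1 s2 f" and V: "vs1.has_dim V n"
  obtains m k where "vs1.has_dim {x\<in>V. f x = 0} m" "vs2.has_dim (f ` V) k" "n = m + k"
proof -
  interpret f: Vector_Spaces.linear s1 s2 f by (rule f)
  have sV: "vs1.subspace V" using V vs1.has_dim_subspace by auto
  have "vs1.subspace {x\<in>V. f x = 0}"
    using sV unfolding vs1.subspace_def by (auto simp: f.add f.scale)
  then obtain m where m: "vs1.has_dim {x\<in>V. f x = 0} m"
    using vs1.has_dim_sub[OF V] by (metis (no_types, lifting) mem_Collect_eq subsetI)
  obtain k where k: "vs2.has_dim (f ` V) k" using has_dim_image[OF f V] by metis
  show ?thesis
    using that[OF m k] has_dim_kernel_image[OF f sV m k] V vs1.has_dim_unique by blast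
qed

lemma has_dim_inj_image:
  assumes f: "Vector_Spaces.linear s1 s2 f" and V: "vs1.has_dim V n" and inj: "\<And>x. x \<in> V \<Longrightarrow> f x = 0 \<Longrightarrow> x = 0"
  shows "vs2.has_dim (f ` V) n"
proof -
  obtain m k where mk: "vs1.has_dim {x\<in>V. f x = 0} m" "vs2.has_dim (f ` V) k" "n = m + k"
    using rank_nullity[OF f V] by metis
  have "{x\<in>V. f x = 0} = {0}"
    using inj V linear_0[OF f] vs1.has_dim_subspace[OF V] vs1.subspace_0 by auto
  moreover have "vs1.has_dim {0} 0"
    by (rule vs1.has_dimI[of "{}"]) (auto simp: vs1.independent_empty)
  ultimately have "m = 0" using mk(1) vs1.has_dim_unique by metis
  then show ?thesis using mk by simp
qed

end

section \<open>Bivariate polynomials\<close>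

text \<open>Coordinates and directions are indexed by booleans, \<open>True\<close> standing for \<open>x\<close> and horizontal, so that the horizontal
  and the vertical case of every argument are treated at once.\<close>

definition co :: "bool \<Rightarrow> real \<times> real \<Rightarrow> real" where
  "co k z = (if k then fst z else snd z)"

definition upd :: "bool \<Rightarrow> real \<times> real \<Rightarrow> real \<Rightarrow> real \<times> real" where
  "upd k z u = (if k then (u, snd z) else (fst z, u))"

lemma co_upd [simp]: "co k (upd k z u) = u" "co (\<not> k) (upd k z u) = co (\<not> k) z"
  "co k (upd (\<not> k) z u) = co k z"
  by (auto simp: co_def upd_def)

lemma upd_same [simp]: "upd k z (co k z) = z" "upd k (upd k z u) v = upd k z v"
  by (auto simp: co_def upd_def)

lemma prod_eq_co2: "z = w \<longleftrightarrow> co k z = co k w \<and> co (\<not> k) z = co (\<not> k) w"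
  unfolding co_def by (auto simp: prod_eq_iff)

text \<open>In R[x][y], \<open>emb True p\<close> is p(x) and \<open>emb False p\<close> is p(y);
  the products \<open>emb k p * emb (\<not> k) q\<close> are the pure tensors.\<close>

definition emb :: "bool \<Rightarrow> real poly \<Rightarrow> real poly poly" where
  "emb k p = (if k then [:p:] else map_poly (\<lambda>c. [:c:]) p)"

lemma coeff_emb: "coeff (coeff (emb k p) j) i =
  (if k then (if j = 0 then coeff p i else 0) else (if i = 0 then coeff p j else 0))"
  by (auto simp: emb_def coeff_map_poly coeff_pCons split: nat.splits)

lemma poly_poly_eqI: "(\<And>i j. coeff (coeff p j) i = coeff (coeff q j) i) \<Longrightarrow> p = q"
  by (intro poly_eqI)

lemma emb_add: "emb k (p + q) = emb k p + emb k q"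
  by (rule poly_poly_eqI) (auto simp: coeff_emb)

lemma emb_smult: "emb k (smult c p) = smult [:c:] (emb k p)"
  by (rule poly_poly_eqI) (auto simp: coeff_emb)

lemma emb_minus: "emb k (- p) = - emb k p"
  by (rule poly_poly_eqI) (auto simp: coeff_emb)

lemma emb_diff: "emb k (p - q) = emb k p - emb k q"
  by (rule poly_poly_eqI) (auto simp: coeff_emb)

lemma emb_0 [simp]: "emb k 0 = 0"
  by (rule poly_poly_eqI) (auto simp: coeff_emb)

lemma emb_1 [simp]: "emb k 1 = 1"
  by (auto simp: emb_def pCons_one[symmetric] map_poly_pCons)

lemma emb_mult: "emb k (p * q) = emb k p * emb k q"
proof (cases k)
  case False
  have "map_poly (\<lambda>c. [:c:]) (p * q) = map_poly (\<lambda>c. [:c:]) p * map_poly (\<lambda>c. [:c:]) q"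
    by (induction p) (auto simp: map_poly_pCons emb_add[of False, unfolded emb_def, simplified]
        emb_smult[of False, unfolded emb_def, simplified])
  then show ?thesis using False by (simp add: emb_def)
qed (simp add: emb_def)

lemma emb_power: "emb k (p ^ n) = emb k p ^ n"
  by (induction n) (auto simp: emb_mult)

lemma coeff_emb_mult: "coeff (emb True p * emb False q) j = smult (coeff q j) p"
  by (auto simp: emb_def coeff_map_poly mult.commute)

lemma coeff_coeff_emb_mult:
  "coeff (coeff (emb k p * emb (\<not> k) q) j) i = (if k then coeff p i * coeff q j else coeff p j * coeff q i)"
  by (cases k) (auto simp: coeff_emb_mult mult.commute[of "emb False _"])

lemma eval2_simps [simp]:
  "eval2 0 z = 0" "eval2 (p + q) z = eval2 p z + eval2 q z" "eval2 (p - q) z = eval2 p z - eval2 q z"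
  "eval2 (smult [:c:] p) z = c * eval2 p z" "eval2 (p * q) z = eval2 p z * eval2 q z"
  "eval2 (- p) z = - eval2 p z"
  by (auto simp: eval2_def)

text \<open>The polynomial in the coordinate \<open>k\<close> obtained by freezing the other coordinate at \<open>u\<close>.\<close>

definition slice :: "bool \<Rightarrow> real poly poly \<Rightarrow> real \<Rightarrow> real poly" where
  "slice k p u = (if k then poly p [:u:] else map_poly (\<lambda>c. poly c u) p)"

lemma eval2_slice: "eval2 p z = poly (slice k p (co (\<not> k) z)) (co k z)"
proof (cases k)
  case False
  have "poly (poly p [:y:]) x = poly (map_poly (\<lambda>c. poly c x) p) y" for x y
    by (induction p) (auto simp: map_poly_pCons)
  then show ?thesis using False by (simp add: eval2_def slice_def co_def)
qed (simp add: eval2_def slice_def co_def)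

lemma slice_emb_mult: "slice k (emb k p * emb (\<not> k) q) u = smult (poly q u) p"
proof (cases k)
  case True
  have "poly (map_poly (\<lambda>c. [:c:]) q) [:u:] = [:poly q u:]"
    by (induction q) (auto simp: map_poly_pCons)
  then show ?thesis using True by (simp add: slice_def emb_def mult.commute)
next
  case False
  show ?thesis
  proof (rule poly_eqI)
    fix n show "coeff (slice k (emb k p * emb (\<not> k) q) u) n = coeff (smult (poly q u) p) n"
    proof -
      have "coeff (emb False p * emb True q) n = smult (coeff p n) q"
        using coeff_emb_mult[of q p n] by (simp only: mult.commute[of "emb False p"])
      then show ?thesis using False by (simp add: slice_def coeff_map_poly)
    qed
  qed
qed

text \<open>Over the polynomials in x, the constants \<open>[:u:]\<close> are infinitely many roots
  of \<open>p - q\<close>; for slices in the other direction each coefficient of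
  \<open>p - q\<close> has infinitely many roots.\<close>

lemma slice_eqI:
  assumes "infinite U" "\<And>u. u \<in> U \<Longrightarrow> slice k p u = slice k q u"
  shows "p = q"
proof (cases k)
  case True
  show ?thesis
  proof (rule ccontr)
    assume "p \<noteq> q"
    then have "finite {x. poly (p - q) x = 0}" by (intro poly_roots_finite) simp
    moreover have "(\<lambda>u. [:u:]) ` U \<subseteq> {x. poly (p - q) x = 0}" using assms(2) True by (auto simp: slice_def)
    ultimately have "finite ((\<lambda>u. [:u:]) ` U)" using finite_subset by blast
    moreover have "inj_on (\<lambda>u. [:u:]) U" by (auto simp: inj_on_def)
    ultimately show False using assms(1) finite_imageD by blast
  qed
next
  case False
  show ?thesis
  proof (rule poly_eqI, rule ccontr)
    fix n assume "coeff p n \<noteq> coeff q n"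
    then have "finite {x. poly (coeff p n - coeff q n) x = 0}" by (intro poly_roots_finite) simp
    moreover have "U \<subseteq> {x. poly (coeff p n - coeff q n) x = 0}"
    proof
      fix u assume "u \<in> U"
      then have "coeff (slice k p u) n = coeff (slice k q u) n" using assms(2) by simp
      then show "u \<in> {x. poly (coeff p n - coeff q n) x = 0}" using False by (simp add: slice_def coeff_map_poly)
    qed
    ultimately show False using assms(1) finite_subset by blast
  qed
qed

lemma poly_eqI_infinite:
  fixes p q :: "real poly"
  assumes "infinite U" "\<And>u. u \<in> U \<Longrightarrow> poly p u = poly q u"
  shows "p = q"
proof (rule ccontr)
  assume "p \<noteq> q"
  then have "finite {x. poly (p - q) x = 0}" by (intro poly_roots_finite) simp
  moreover have "U \<subseteq> {x. poly (p - q) x = 0}" using assms(2) by auto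
  ultimately show False using assms(1) finite_subset by blast
qed

lemma eval2_eqI:
  assumes "infinite U" "infinite W"
    and "\<And>z. fst z \<in> U \<Longrightarrow> snd z \<in> W \<Longrightarrow> eval2 p z = eval2 q z"
  shows "p = q"
proof (rule slice_eqI[OF assms(2), of True])
  fix w assume "w \<in> W"
  show "slice True p w = slice True q w"
  proof (rule poly_eqI_infinite[OF assms(1)])
    fix u assume "u \<in> U"
    then show "poly (slice True p w) u = poly (slice True q w) u"
      using assms(3)[of "(u, w)"] \<open>w \<in> W\<close> by (simp add: eval2_slice[where k=True] co_def)
  qed
qed

definition pd :: "bool \<Rightarrow> real poly poly \<Rightarrow> real poly poly" where
  "pd k p = (if k then map_poly pderiv p else pderiv p)"

lemma slice_pd: "slice k (pd k p) u = pderiv (slice k p u)"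
proof (cases k)
  case True
  have "poly (map_poly pderiv p) [:u:] = pderiv (poly p [:u:])"
    by (induction p) (auto simp: map_poly_pCons pderiv_add pderiv_smult)
  then show ?thesis using True by (simp add: slice_def pd_def)
next
  case False
  then show ?thesis
    by (auto simp: slice_def pd_def intro!: poly_eqI simp: coeff_map_poly coeff_pderiv)
qed

lemma slice_pd_funpow: "slice k ((pd k ^^ j) p) u = (pderiv ^^ j) (slice k p u)"
  by (induction j) (auto simp: slice_pd)

lemma pd_diff: "pd k (p - q) = pd k p - pd k q"
  by (cases k) (auto simp: pd_def pderiv_diff intro!: poly_eqI simp: coeff_map_poly)

lemma pd_funpow_diff: "(pd k ^^ j) (p - q) = (pd k ^^ j) p - (pd k ^^ j) q"
  by (induction j) (auto simp: pd_diff)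

lemma has_real_derivative_eval2:
  "((\<lambda>u. eval2 p (upd k z u)) has_real_derivative eval2 (pd k p) z) (at (co k z) within A)"
  unfolding eval2_slice[where k=k] co_upd slice_pd
  by (rule DERIV_subset[OF poly_DERIV]) simp

lemma continuous_on_eval2: "continuous_on A (eval2 p)"
proof (induction p)
  case (pCons a p)
  have "eval2 (pCons a p) = (\<lambda>z. poly a (fst z) + snd z * eval2 p z)"
    by (auto simp: eval2_def fun_eq_iff)
  then show ?case using pCons by (auto intro!: continuous_intros)
qed (simp add: eval2_def)

text \<open>The coefficient of the \<open>d\<close>-th power of the other coordinate, a polynomial in the coordinate \<open>k\<close>.\<close>

definition lc :: "nat \<Rightarrow> bool \<Rightarrow> real poly poly \<Rightarrow> real poly" where
  "lc d k p = (if k then coeff p d else map_poly (\<lambda>c. coeff c d) p)"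

lemma coeff_lc: "coeff (lc d k p) i = (if k then coeff (coeff p d) i else coeff (coeff p i) d)"
  by (simp add: lc_def coeff_map_poly)

lemma lc_add: "lc d k (p + q) = lc d k p + lc d k q"
  and lc_smult: "lc d k (smult [:c:] p) = smult c (lc d k p)"
  by (auto intro!: poly_eqI simp: coeff_lc)

lemma lc_emb_mult: "lc d k (emb (\<not> k) p * emb k q) = smult (coeff p d) q"
proof (rule poly_eqI)
  fix n show "coeff (lc d k (emb (\<not> k) p * emb k q)) n = coeff (smult (coeff p d) q) n"
    using coeff_coeff_emb_mult[of "\<not> k" p q] by (cases k) (simp_all add: coeff_lc)
qed

lemma lc_emb_mult': "lc d k (emb k p * emb (\<not> k) q) = smult (coeff q d) p"
proof (rule poly_eqI)
  fix n show "coeff (lc d k (emb k p * emb (\<not> k) q)) n = coeff (smult (coeff q d) p) n"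
    using coeff_coeff_emb_mult[of k p q] by (cases k) (simp_all add: coeff_lc)
qed

lemma poly_lc: "poly (lc d k p) u = coeff (slice (\<not> k) p u) d"
proof (cases k)
  case False
  have "poly (map_poly (\<lambda>c. coeff c d) p) u = coeff (poly p [:u:]) d"
    by (induction p) (auto simp: map_poly_pCons)
  then show ?thesis using False by (simp add: lc_def slice_def)
qed (simp add: lc_def slice_def coeff_map_poly)

lemma bipolys_coeff: "p \<in> bipolys d \<longleftrightarrow> (\<forall>i j. i > d \<or> j > d \<longrightarrow> coeff (coeff p j) i = 0)"
proof
  assume "p \<in> bipolys d"
  then show "\<forall>i j. i > d \<or> j > d \<longrightarrow> coeff (coeff p j) i = 0"
    unfolding bipolys_def by (auto simp: coeff_eq_0 le_degree) (metis coeff_eq_0 le_less_trans coeff_0)+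
next
  assume *: "\<forall>i j. i > d \<or> j > d \<longrightarrow> coeff (coeff p j) i = 0"
  have "degree p \<le> d" using * by (intro degree_le) (auto intro!: poly_eqI)
  moreover have "degree (coeff p i) \<le> d" for i using * by (intro degree_le) auto
  ultimately show "p \<in> bipolys d" unfolding bipolys_def by simp
qed

lemma bipolys_add: "p \<in> bipolys d \<Longrightarrow> q \<in> bipolys d \<Longrightarrow> p + q \<in> bipolys d"
  and bipolys_diff: "p \<in> bipolys d \<Longrightarrow> q \<in> bipolys d \<Longrightarrow> p - q \<in> bipolys d"
  and bipolys_smult: "p \<in> bipolys d \<Longrightarrow> smult [:c:] p \<in> bipolys d"
  and bipolys_0: "0 \<in> bipolys d"
  by (auto simp: bipolys_coeff)

lemma bipolys_emb: "degree p \<le> d \<Longrightarrow> degree q \<le> d \<Longrightarrow> emb k p * emb (\<not> k) q \<in> bipolys d"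
  by (auto simp: bipolys_coeff coeff_coeff_emb_mult coeff_eq_0)

lemma bipolys_degree_slice: "p \<in> bipolys d \<Longrightarrow> degree (slice k p u) \<le> d"
proof (cases k)
  case True
  assume p: "p \<in> bipolys d"
  have "degree (poly q [:u:]) \<le> d" if "\<forall>i. degree (coeff q i) \<le> d" for q
    using that
  proof (induction q)
    case (pCons a q)
    have "\<forall>i. degree (coeff q i) \<le> d" "degree a \<le> d"
      using pCons(3) by (metis coeff_pCons_Suc, metis coeff_pCons_0)
    then show ?case using pCons by (auto intro!: degree_add_le order.trans[OF degree_smult_le])
  qed simp
  then show ?thesis using p True by (auto simp: slice_def bipolys_def)
next
  case False
  assume p: "p \<in> bipolys d"
  show ?thesis using False p
    by (intro degree_le) (auto simp: slice_def bipolys_def coeff_map_poly coeff_eq_0)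
qed

lemma degree_lc: "p \<in> bipolys d \<Longrightarrow> degree (lc d k p) \<le> d"
  by (rule degree_le) (auto simp: coeff_lc bipolys_coeff)

section \<open>Pure powers of linear forms and the spaces attached to edges\<close>

definition lpow :: "nat \<Rightarrow> real \<Rightarrow> real poly" where
  "lpow d c = [:- c, 1:] ^ d"

lemma degree_lpow [simp]: "degree (lpow d c) = d"
  by (simp add: lpow_def degree_linear_power)

lemma coeff_lpow [simp]: "coeff (lpow d c) d = 1"
  by (simp add: lpow_def coeff_linear_power)

lemma poly_lpow: "poly (lpow d c) x = (x - c) ^ d"
  by (simp add: lpow_def)

lemma lpow_dvd_imp:
  assumes "degree p \<le> d" "lpow d c dvd p"
  shows "p = smult (coeff p d) (lpow d c)"
proof (cases "p = 0")
  case False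
  obtain r where r: "p = lpow d c * r" using assms(2) by (rule dvdE)
  have "lpow d c \<noteq> 0" "r \<noteq> 0" using r False by auto
  then have "degree p = d + degree r" using r by (simp add: degree_mult_eq)
  then have "degree r = 0" using assms(1) by simp
  then obtain a where "r = [:a:]" by (metis degree_eq_zeroE)
  then show ?thesis using r by (simp add: mult.commute)
qed simp

text \<open>Induction on \<open>d\<close>: in characteristic 0 differentiation lowers the order of
  the root \<open>c\<close> by exactly one, so divisibility lifts from \<open>pderiv p\<close> to
  \<open>p\<close>.\<close>

lemma lpow_dvdI:
  assumes "\<And>j. j < d \<Longrightarrow> poly ((pderiv ^^ j) p) c = 0"
  shows "lpow d c dvd p"
  using assms
proof (induction d arbitrary: p)
  case 0
  then show ?case by (simp add: lpow_def)
next
  case (Suc d)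
  have "lpow d c dvd pderiv p"
    using Suc(2)[of "Suc j" for j] by (intro Suc(1)) (simp add: funpow_swap1)
  moreover have "poly p c = 0" using Suc(2)[of 0] by simp
  moreover have "order c p = Suc (order c (pderiv p))" if "p \<noteq> 0"
    using order_pderiv[OF that] \<open>poly p c = 0\<close> by simp
  moreover have "pderiv p \<noteq> 0" if "p \<noteq> 0"
  proof
    assume "pderiv p = 0"
    then obtain a where "p = [:a:]" by (metis degree_eq_zeroE pderiv_eq_0_iff)
    then show False using that \<open>poly p c = 0\<close> by simp
  qed
  ultimately show ?case unfolding lpow_def order_divides by (cases "p = 0") auto
qed

lemma poly_pderiv_lpow: "j < d \<Longrightarrow> poly ((pderiv ^^ j) (lpow d c)) c = 0"
proof -
  have "\<exists>a. (pderiv ^^ j) (lpow d c) = smult a (lpow (d - j) c)" if "j \<le> d" for j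
    using that
  proof (induction j)
    case (Suc j)
    then obtain a where a: "(pderiv ^^ j) (lpow d c) = smult a (lpow (d - j) c)" by auto
    obtain m where m: "d - j = Suc m" "d - Suc j = m" using Suc(2) by (metis Suc_diff_le diff_Suc_Suc)
    have "pderiv (lpow (Suc m) c) = smult (of_nat (Suc m)) (lpow m c)"
      unfolding lpow_def pderiv_power_Suc by (simp add: pderiv_pCons)
    then show ?case using a m by (simp add: pderiv_smult) blast
  qed (auto intro: exI[of _ 1])
  then show "j < d \<Longrightarrow> ?thesis" by (metis less_imp_le poly_smult poly_lpow diff_self mult_zero_right power_0_left zero_less_diff less_numeral_extra(3))
qed

text \<open>The space of an edge of direction \<open>k\<close> whose other coordinate is
  \<open>c\<close>: the degree bound leaves the d-th power of the linear form times a univariate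
  polynomial along the edge. Agreement with the divisibility condition is
  \<open>Jspace_dvd\<close>.\<close>

definition Jspace :: "nat \<Rightarrow> bool \<Rightarrow> real \<Rightarrow> real poly poly set" where
  "Jspace d k c = {emb (\<not> k) (lpow d c) * emb k q | q. degree q \<le> d}"

text \<open>The univariate factor can be read off because \<open>lpow d c\<close> is monic of degree
  \<open>d\<close>.\<close>

lemma Jspace_lc: "p \<in> Jspace d k c \<Longrightarrow> p = emb (\<not> k) (lpow d c) * emb k (lc d k p)"
  unfolding Jspace_def by (auto simp: lc_emb_mult)

lemma Jspace_bipolys: "p \<in> Jspace d k c \<Longrightarrow> p \<in> bipolys d"
  unfolding Jspace_def using bipolys_emb[of "lpow d c" d _ "\<not> k"] by auto

lemma lin_emb: "lin_x a = emb True [:- a, 1:]" "lin_y a = emb False [:- a, 1:]"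
  by (auto simp: lin_x_def lin_y_def emb_def map_poly_pCons one_pCons)

text \<open>Iterated polynomials treat x and y differently: a power of a form in x is a constant and
  divides coefficientwise, whereas for a power of a form in y the degree in y forces the cofactor to
  be constant.\<close>

lemma Jspace_dvd:
  "p \<in> Jspace d k c \<longleftrightarrow> p \<in> bipolys d \<and> (if k then lin_y c else lin_x c) ^ d dvd p"
proof
  assume "p \<in> Jspace d k c"
  then show "p \<in> bipolys d \<and> (if k then lin_y c else lin_x c) ^ d dvd p"
    using Jspace_bipolys[of p d k c] Jspace_lc[of p d k c]
    by (auto simp: lin_emb emb_power[symmetric] lpow_def) (metis dvd_triv_left)+
next
  assume p: "p \<in> bipolys d \<and> (if k then lin_y c else lin_x c) ^ d dvd p"
  have "p = emb (\<not> k) (lpow d c) * emb k (lc d k p)"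
  proof (cases k)
    case False
    then have "emb True (lpow d c) dvd p" using p by (auto simp: lin_emb emb_power[symmetric] lpow_def)
    then have "[:lpow d c:] dvd p" by (simp add: emb_def)
    then have "\<forall>n. lpow d c dvd coeff p n" by (simp add: const_poly_dvd_iff)
    moreover have "\<forall>n. degree (coeff p n) \<le> d" using p by (simp add: bipolys_def)
    ultimately have "\<forall>n. coeff p n = smult (coeff (coeff p n) d) (lpow d c)" using lpow_dvd_imp by blast
    then show ?thesis using False by (intro poly_eqI) (simp add: coeff_emb_mult coeff_lc)
  next
    case True
    then have dv: "emb False (lpow d c) dvd p" using p by (auto simp: lin_emb emb_power[symmetric] lpow_def)
    have dg: "degree (emb False (lpow d c)) = d"
      by (simp add: emb_def degree_map_poly)
    obtain r where r: "p = emb False (lpow d c) * r" using dv by (rule dvdE)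
    have "degree r = 0"
    proof (cases "r = 0")
      case False
      have "degree p = d + degree r" using r False dg by (subst r, subst degree_mult_eq) (auto simp: emb_def map_poly_eq_0_iff lpow_def)
      then show ?thesis using p by (simp add: bipolys_def)
    qed simp
    then obtain a where "r = [:a:]" by (metis degree_eq_zeroE)
    then have "p = emb (\<not> k) (lpow d c) * emb k a" using r True by (simp add: emb_def)
    then show ?thesis by (simp add: lc_emb_mult)
  qed
  then show "p \<in> Jspace d k c" unfolding Jspace_def using degree_lc p by blast
qed

text \<open>A polynomial vanishes to order \<open>d\<close> along a line once it does so at infinitely many points:
  on each perpendicular line it is a multiple of a pure power, whose coefficient is read off as
  the leading coefficient.\<close>

lemma Jspace_vanishing:
  assumes p: "p \<in> bipolys d" and U: "infinite U"
    and van: "\<And>u j. u \<in> U \<Longrightarrow> j < d \<Longrightarrow> poly ((pderiv ^^ j) (slice (\<not> k) p u)) c = 0"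
  shows "p \<in> Jspace d k c"
proof -
  have "p = emb (\<not> k) (lpow d c) * emb k (lc d k p)"
  proof (rule slice_eqI[OF U, of "\<not> k"])
    fix u assume u: "u \<in> U"
    have "slice (\<not> k) p u = smult (coeff (slice (\<not> k) p u) d) (lpow d c)"
      by (rule lpow_dvd_imp[OF bipolys_degree_slice[OF p] lpow_dvdI]) (use van u in auto)
    also have "\<dots> = slice (\<not> k) (emb (\<not> k) (lpow d c) * emb k (lc d k p)) u"
      using slice_emb_mult[of "\<not> k" "lpow d c" "lc d k p" u] by (simp add: poly_lc)
    finally show "slice (\<not> k) p u = slice (\<not> k) (emb (\<not> k) (lpow d c) * emb k (lc d k p)) u" .
  qed
  then show ?thesis unfolding Jspace_def using degree_lc[OF p] by blast
qed

lemma pderiv_funpow_smult: "(pderiv ^^ j) (smult c p) = smult c ((pderiv ^^ j) p)"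
  by (induction j) (auto simp: pderiv_smult)

text \<open>Across the line the derivatives vanish by the multiplicity \<open>d\<close>; along the
  line they vanish because the polynomial itself is zero there.\<close>

lemma Jspace_pd_vanish:
  assumes p: "p \<in> Jspace d k (co (\<not> k) z)" and "j < d"
  shows "eval2 ((pd k' ^^ j) p) z = 0"
proof -
  obtain q where q: "p = emb (\<not> k) (lpow d (co (\<not> k) z)) * emb k q" using p unfolding Jspace_def by auto
  have "k' = (\<not> k) \<or> k' = k" by auto
  then show ?thesis
  proof
    assume k': "k' = (\<not> k)"
    have "slice k' p (co k z) = smult (poly q (co k z)) (lpow d (co (\<not> k) z))"
      using slice_emb_mult[of "\<not> k" "lpow d (co (\<not> k) z)" q] q k' by simp
    then show ?thesis using k' assms(2)
      by (simp add: eval2_slice[where k=k'] slice_pd_funpow pderiv_funpow_smult poly_pderiv_lpow)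
  next
    assume k': "k' = k"
    have "slice k p (co (\<not> k) z) = smult (poly (lpow d (co (\<not> k) z)) (co (\<not> k) z)) q"
      using slice_emb_mult[of k q "lpow d (co (\<not> k) z)"] q by (simp add: mult.commute)
    then show ?thesis using k' assms(2)
      by (simp add: eval2_slice[where k=k'] slice_pd_funpow poly_lpow power_0_left)
  qed
qed

section \<open>Dimensions of polynomial spaces\<close>

interpretation rp: dim_space "smult :: real \<Rightarrow> real poly \<Rightarrow> real poly"
  by unfold_locales (auto simp: smult_add_right smult_add_left)

interpretation pp: dim_space "\<lambda>(c::real) (p :: real poly poly). smult [:c:] p"
  by unfold_locales (auto simp: smult_add_right smult_add_left[symmetric] pCons_one mult.commute)

interpretation ch: dim_space "\<lambda>(c::real) (f :: 'a \<Rightarrow> real poly poly) z. smult [:c:] (f z)" ..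

interpretation fn: dim_space "\<lambda>(c::real) (f :: 'a \<Rightarrow> real) z. c * f z" ..

interpretation rp_pp: dim_space_pair "smult :: real \<Rightarrow> real poly \<Rightarrow> real poly"
  "\<lambda>(c::real) (p :: real poly poly). smult [:c:] p" ..

interpretation pp_rp: dim_space_pair "\<lambda>(c::real) (p :: real poly poly). smult [:c:] p"
  "smult :: real \<Rightarrow> real poly \<Rightarrow> real poly" ..

interpretation ch_pp: dim_space_pair "\<lambda>(c::real) (f :: 'a \<Rightarrow> real poly poly) z. smult [:c:] (f z)"
  "\<lambda>(c::real) (p :: real poly poly). smult [:c:] p" ..

interpretation ch_ch: dim_space_pair "\<lambda>(c::real) (f :: 'a \<Rightarrow> real poly poly) z. smult [:c:] (f z)"
  "\<lambda>(c::real) (f :: 'b \<Rightarrow> real poly poly) z. smult [:c:] (f z)" ..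

interpretation ch_fn: dim_space_pair "\<lambda>(c::real) (f :: 'a \<Rightarrow> real poly poly) z. smult [:c:] (f z)"
  "\<lambda>(c::real) (f :: 'b \<Rightarrow> real) z. c * f z" ..

text \<open>Vanishing coefficients replace a degree bound so that \<open>n = 0\<close> describes the
  zero space.\<close>

lemma rp_has_dim: "rp.has_dim {p :: real poly. \<forall>i\<ge>n. coeff p i = 0} n"
proof (rule rp.has_dimI)
  let ?B = "(\<lambda>i. monom 1 i :: real poly) ` {..<n}"
  have inj: "inj_on (\<lambda>i. monom 1 i :: real poly) {..<n}" by (auto simp: inj_on_def monom_eq_iff')
  show "finite ?B" by simp
  show "card ?B = n" using card_image[OF inj] by simp
  have co: "coeff (\<Sum>i<n. smult (c i) (monom 1 i)) j = (if j < n then c j else 0)" for j and c :: "nat \<Rightarrow> real"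
    by (simp add: coeff_sum if_distrib[of "\<lambda>x. _ * x"] cong: if_cong)
  show "rp.independent ?B"
  proof (rule rp.independent_if_scalars_zero)
    fix f x assume s: "(\<Sum>x\<in>?B. smult (f x) x) = 0" and "x \<in> ?B"
    then obtain i where i: "i < n" "x = monom 1 i" by auto
    have "(\<Sum>i<n. smult (f (monom 1 i)) (monom 1 i)) = 0"
      using s by (simp add: sum.reindex[OF inj])
    then show "f x = 0" using co[of "\<lambda>i. f (monom 1 i)" i] i by simp
  qed simp
  show "rp.span ?B = {p. \<forall>i\<ge>n. coeff p i = 0}"
  proof
    show "rp.span ?B \<subseteq> {p. \<forall>i\<ge>n. coeff p i = 0}"
      by (rule rp.span_minimal) (auto simp: rp.subspace_def)
    show "{p. \<forall>i\<ge>n. coeff p i = 0} \<subseteq> rp.span ?B"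
    proof
      fix p :: "real poly" assume p: "p \<in> {p. \<forall>i\<ge>n. coeff p i = 0}"
      have "p = (\<Sum>i<n. smult (coeff p i) (monom 1 i))"
        using p by (intro poly_eqI) (simp only: co, auto)
      also have "\<dots> \<in> rp.span ?B"
        by (intro rp.span_sum rp.span_scale rp.span_base) auto
      finally show "p \<in> rp.span ?B" .
    qed
  qed
qed

lemma degree_le_coeff: "degree p \<le> d \<longleftrightarrow> (\<forall>i\<ge>Suc d. coeff p i = 0)"
  by (auto simp: Suc_le_eq coeff_eq_0 intro: degree_le)

lemma rp_has_dim_degree: "rp.has_dim {p :: real poly. degree p \<le> d} (d + 1)"
  using rp_has_dim[of "Suc d"] by (simp add: degree_le_coeff)

lemma linear_emb_mult: "Vector_Spaces.linear smult (\<lambda>c. smult [:c:]) (\<lambda>q. emb k' p * emb k q)"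
  by unfold_locales (auto simp: emb_add emb_smult algebra_simps)

lemma linear_lc: "Vector_Spaces.linear (\<lambda>c. smult [:c:]) smult (lc d k)"
  by unfold_locales (auto simp: lc_add lc_smult)

lemma lc_0 [simp]: "lc d k 0 = 0"
  by (simp add: lc_def)

lemma Jspace_has_dim: "pp.has_dim (Jspace d k c) (d + 1)"
proof -
  have "pp.has_dim ((\<lambda>q. emb (\<not> k) (lpow d c) * emb k q) ` {p. degree p \<le> d}) (d + 1)"
  proof (rule rp_pp.has_dim_inj_image[OF linear_emb_mult rp_has_dim_degree])
    fix q assume "emb (\<not> k) (lpow d c) * emb k q = 0"
    then have "lc d k (emb (\<not> k) (lpow d c) * emb k q) = 0" by (simp only: lc_0)
    then show "q = 0" by (simp add: lc_emb_mult)
  qed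
  moreover have "(\<lambda>q. emb (\<not> k) (lpow d c) * emb k q) ` {p. degree p \<le> d} = Jspace d k c"
    unfolding Jspace_def by auto
  ultimately show ?thesis by simp
qed

lemma chains_has_dim:
  assumes "finite A" "\<And>a. a \<in> A \<Longrightarrow> pp.has_dim (W a) (n a)"
  shows "ch.has_dim {f. (\<forall>a\<in>A. f a \<in> W a) \<and> (\<forall>a. a \<notin> A \<longrightarrow> f a = 0)} (\<Sum>a\<in>A. n a)"
  using assms
proof (induction A rule: finite_induct)
  case empty
  have "{f :: 'a \<Rightarrow> real poly poly. \<forall>a. f a = 0} = {0}" by (auto simp: fun_eq_iff)
  moreover have "ch.has_dim {0 :: 'a \<Rightarrow> real poly poly} 0"
    by (rule ch.has_dimI[of "{}"]) (auto simp: chain_vs.independent_empty)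
  ultimately show ?case by simp
next
  case (insert x A)
  let ?V = "\<lambda>A. {f. (\<forall>a\<in>A. f a \<in> W a) \<and> (\<forall>a. a \<notin> A \<longrightarrow> f a = 0)}"
  have W: "pp.subspace (W a)" if "a \<in> insert x A" for a
    using insert.prems[OF that] pp.has_dim_subspace by blast
  have lin: "Vector_Spaces.linear (\<lambda>c f z. smult [:c:] (f z)) (\<lambda>c. smult [:c:])
      (\<lambda>f :: 'a \<Rightarrow> real poly poly. f x)"
    by unfold_locales auto
  have sub: "chain_vs.subspace (?V (insert x A))"
    unfolding chain_vs.subspace_def using W pp.subspace_0 pp.subspace_add pp.subspace_scale
    by auto
  have ker: "{f \<in> ?V (insert x A). f x = 0} = ?V A"
    using insert.hyps(2) W[of x] pp.subspace_0 by (auto split: if_splits) metis+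
  have "(\<lambda>f. f x) ` ?V (insert x A) = W x"
  proof
    show "W x \<subseteq> (\<lambda>f. f x) ` ?V (insert x A)"
    proof
      fix w assume "w \<in> W x"
      then have "(\<lambda>a. if a = x then w else 0) \<in> ?V (insert x A)"
        using W pp.subspace_0 by auto
      then show "w \<in> (\<lambda>f. f x) ` ?V (insert x A)" by (rule rev_image_eqI) simp
    qed
  qed auto
  then have "ch.has_dim (?V (insert x A)) ((\<Sum>a\<in>A. n a) + n x)"
    using ch_pp.has_dim_kernel_image[OF lin sub] insert ker by simp
  then show ?case using insert.hyps by (simp add: add.commute)
qed

lemma smult_sum2: "smult c (\<Sum>x\<in>A. f x) = (\<Sum>x\<in>A. smult c (f x))"
  by (induction A rule: infinite_finite_induct) (auto simp: smult_add_right)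

lemma bipolys_has_dim: "pp.has_dim (bipolys d) ((d + 1)\<^sup>2)"
proof -
  \<comment> \<open>The factor \<open>emb True 1\<close> equals 1 and only brings the embedding into
    the shape required by \<open>linear_emb_mult\<close>.\<close>
  let ?W = "(\<lambda>q. emb True 1 * emb True q) ` {p. degree p \<le> d}"
  let ?V = "{f. (\<forall>a\<in>{..d}. f a \<in> ?W) \<and> (\<forall>a. a \<notin> {..d} \<longrightarrow> f a = 0)}"
  let ?F = "\<lambda>f :: nat \<Rightarrow> real poly poly. \<Sum>j\<le>d. f j * monom 1 j"
  have W: "pp.has_dim ?W (d + 1)"
    by (rule rp_pp.has_dim_inj_image[OF linear_emb_mult rp_has_dim_degree]) (auto simp: emb_def)
  have lin: "Vector_Spaces.linear (\<lambda>c f z. smult [:c:] (f z)) (\<lambda>c. smult [:c:]) ?F"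
    by unfold_locales (auto simp: algebra_simps sum.distrib smult_sum2)
  have co: "coeff (?F (\<lambda>j. [:g j:])) j = (if j \<le> d then g j else 0)" for g j
    by (simp add: coeff_sum smult_monom if_distrib[of "\<lambda>x. _ * x"] cong: if_cong)
  have Vg: "f = (\<lambda>j. [:coeff (f j) 0:])" if "f \<in> ?V" for f
  proof
    fix j
    have "f j \<in> ?W \<or> f j = 0" using that by blast
    then show "f j = [:coeff (f j) 0:]" by (auto simp: emb_def)
  qed
  have "pp.has_dim (?F ` ?V) (\<Sum>j\<in>{..d}. d + 1)"
  proof (rule ch_pp.has_dim_inj_image[OF lin chains_has_dim])
    fix f assume f: "f \<in> ?V" "?F f = 0"
    define g where "g j = coeff (f j) 0" for j
    have fg: "f = (\<lambda>j. [:g j:])" using Vg[OF f(1)] by (simp add: g_def)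
    show "f = 0"
    proof
      fix j show "f j = 0 j"
        using co[of g j] f fg by (cases "j \<le> d") auto
    qed
  qed (use W in auto)
  moreover have "?F ` ?V = bipolys d"
  proof
    show "?F ` ?V \<subseteq> bipolys d"
    proof
      fix p assume "p \<in> ?F ` ?V"
      then obtain f where f: "f \<in> ?V" "p = ?F f" by auto
      define g where "g j = coeff (f j) 0" for j
      have fg: "f = (\<lambda>j. [:g j:])" using Vg[OF f(1)] by (simp add: g_def)
      have "degree (g j) \<le> d" if "j \<le> d" for j
      proof -
        have "f j \<in> ?W" using f(1) that by blast
        then show ?thesis by (auto simp: g_def emb_def)
      qed
      moreover have "coeff p j = (if j \<le> d then g j else 0)" for j unfolding f(2) fg by (rule co)
      ultimately show "p \<in> bipolys d" unfolding bipolys_coeff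
        by (auto intro!: coeff_eq_0 elim: le_less_trans[rotated])
    qed
    show "bipolys d \<subseteq> ?F ` ?V"
    proof
      fix p assume p: "p \<in> bipolys d"
      define f where "f j = (if j \<le> d then [:coeff p j:] else 0)" for j
      have "f \<in> ?V" using p by (auto simp: f_def bipolys_def emb_def)
      moreover have "?F f = p"
      proof -
        have "?F f = ?F (\<lambda>j. [:coeff p j:])" by (rule sum.cong) (auto simp: f_def)
        also have "\<dots> = p" using p by (intro poly_eqI) (simp only: co, auto simp: bipolys_def coeff_eq_0)
        finally show ?thesis .
      qed
      ultimately show "p \<in> ?F ` ?V" by blast
    qed
  qed
  ultimately show ?thesis by (simp add: power2_eq_square)
qed

section \<open>The spaces attached to vertices\<close>

lemma J_vertex_Jspace: "J_vertex d v = {p + q | p q. p \<in> Jspace d False (fst v) \<and> q \<in> Jspace d True (snd v)}"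
  unfolding J_vertex_def Jspace_dvd by auto

lemma Jspace_subspace: "pp.subspace (Jspace d k c)"
  using Jspace_has_dim pp.has_dim_subspace by blast

lemma J_vertex_subspace: "pp.subspace (J_vertex d v)"
  unfolding J_vertex_Jspace by (rule pp.subspace_sums[OF Jspace_subspace Jspace_subspace])

lemma Jspace_J_vertex: "p \<in> Jspace d k (co (\<not> k) v) \<Longrightarrow> p \<in> J_vertex d v"
  using pp.subspace_0[OF Jspace_subspace, of d "\<not> k" "co k v"]
  unfolding J_vertex_Jspace co_def
  by (cases k) (force intro: exI[of _ 0] exI[of _ p])+

text \<open>Taking the coefficient of the d-th power of x maps onto all polynomials in y of degree
  at most \<open>d\<close>; the kernel is (y - b)^d times the polynomials in x of degree below
  \<open>d\<close>. Hence the dimension is (d + 1) + d.\<close>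

lemma J_vertex_has_dim:
  assumes "d \<ge> 1"
  shows "pp.has_dim (J_vertex d v) (2 * d + 1)"
proof -
  let ?P = "\<lambda>k. lpow d (co k v)"
  let ?D = "{p :: real poly. degree p \<le> d}"
  let ?D' = "{p :: real poly. \<forall>i\<ge>d. coeff p i = 0}"
  have Jv: "J_vertex d v = {emb True (?P True) * emb False q + emb False (?P False) * emb True r | q r. q \<in> ?D \<and> r \<in> ?D}"
    unfolding J_vertex_Jspace Jspace_def by (auto simp: co_def)
  have lcq: "lc d False (emb True (?P True) * emb False q) = q" for q
    using lc_emb_mult[of d False] by simp
  have lcr: "lc d False (emb False (?P False) * emb True r) = smult (coeff r d) (?P False)" for r
    using lc_emb_mult'[of d False] by simp
  have "lc d False ` J_vertex d v = ?D"
  proof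
    show "lc d False ` J_vertex d v \<subseteq> ?D"
      unfolding Jv by (auto simp: lc_add lcq lcr intro!: degree_add_le order.trans[OF degree_smult_le])
    show "?D \<subseteq> lc d False ` J_vertex d v"
    proof
      fix q assume "q \<in> ?D"
      then have "emb True (?P True) * emb False q + emb False (?P False) * emb True 0 \<in> J_vertex d v"
        unfolding Jv by (intro CollectI exI[of _ q] exI[of _ 0]) auto
      then show "q \<in> lc d False ` J_vertex d v"
        by (rule rev_image_eqI) (simp add: lcq)
    qed
  qed
  then have im: "rp.has_dim (lc d False ` J_vertex d v) (d + 1)" using rp_has_dim_degree by simp
  have "{p \<in> J_vertex d v. lc d False p = 0} = (\<lambda>q. emb False (?P False) * emb True q) ` ?D'"
  proof (intro equalityI subsetI)
    fix p assume "p \<in> {p \<in> J_vertex d v. lc d False p = 0}"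
    then obtain q r where qr: "q \<in> ?D" "r \<in> ?D" "lc d False p = 0"
      "p = emb True (?P True) * emb False q + emb False (?P False) * emb True r" unfolding Jv by auto
    \<comment> \<open>A vanishing leading coefficient makes \<open>q\<close> a multiple of the pure
      power in y, so the first summand can be absorbed into the second.\<close>
    have "q + smult (coeff r d) (?P False) = 0" using qr(3,4) by (simp add: lc_add lcq lcr)
    then have q: "q = smult (- coeff r d) (?P False)" by (simp add: eq_neg_iff_add_eq_0)
    have "p = emb False (?P False) * emb True (r - smult (coeff r d) (?P True))"
      unfolding qr(4) q by (simp add: emb_diff emb_smult emb_minus algebra_simps)
    moreover have "r - smult (coeff r d) (?P True) \<in> ?D'"
    proof (clarify)
      fix i assume "d \<le> i"
      then show "coeff (r - smult (coeff r d) (?P True)) i = 0"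
        using qr(2) by (cases "i = d") (auto simp: coeff_eq_0)
    qed
    ultimately show "p \<in> (\<lambda>q. emb False (?P False) * emb True q) ` ?D'" by blast
  next
    fix p assume "p \<in> (\<lambda>q. emb False (?P False) * emb True q) ` ?D'"
    then obtain r where r: "r \<in> ?D'" "p = emb False (?P False) * emb True r" by blast
    have "degree r \<le> d" using r(1) by (auto simp: degree_le_coeff)
    then have "p \<in> J_vertex d v" unfolding Jv r(2) by (intro CollectI exI[of _ 0] exI[of _ r]) auto
    moreover have "lc d False p = 0" using r by (simp add: lcr)
    ultimately show "p \<in> {p \<in> J_vertex d v. lc d False p = 0}" by blast
  qed
  moreover have "pp.has_dim ((\<lambda>q. emb False (?P False) * emb True q) ` ?D') d"
  proof (rule rp_pp.has_dim_inj_image[OF linear_emb_mult rp_has_dim])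
    fix q assume "emb False (?P False) * emb True q = 0"
    then have "lc d True (emb False (?P False) * emb True q) = 0" by (simp only: lc_0)
    then show "q = 0" using lc_emb_mult[of d True] by simp
  qed
  ultimately have "pp.has_dim (J_vertex d v) (d + (d + 1))"
    using pp_rp.has_dim_kernel_image[OF linear_lc J_vertex_subspace _ im] by simp
  then show ?thesis by (simp add: mult_2)
qed

text \<open>A Vandermonde argument: a relation between the powers annihilates the moments of
  \<open>c\<close> up to order \<open>d\<close>, hence the values of every polynomial of degree at
  most \<open>d\<close> weighted by \<open>c\<close>.\<close>

lemma lpow_independent_aux:
  assumes fin: "finite \<Gamma>" "card \<Gamma> = Suc d"
    and s: "(\<Sum>g\<in>\<Gamma>. smult (c g) (lpow d g)) = 0" and g0: "g0 \<in> \<Gamma>"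
  shows "c g0 = 0"
proof -
  \<comment> \<open>The coefficient of degree \<open>d - m\<close> in the relation is the m-th
    moment up to sign and a nonzero binomial coefficient.\<close>
  have mom: "(\<Sum>g\<in>\<Gamma>. c g * g ^ m) = 0" if "m \<le> d" for m
  proof -
    have "0 = coeff (\<Sum>g\<in>\<Gamma>. smult (c g) (lpow d g)) (d - m)" using s by simp
    also have "\<dots> = (\<Sum>g\<in>\<Gamma>. c g * (of_nat (d choose (d - m)) * (- g) ^ m))"
      using that by (simp add: coeff_sum lpow_def coeff_linear_poly_power)
    also have "\<dots> = of_nat (d choose (d - m)) * (- 1) ^ m * (\<Sum>g\<in>\<Gamma>. c g * g ^ m)"
      unfolding sum_distrib_left
    proof (rule sum.cong)
      fix g show "c g * (of_nat (d choose (d - m)) * (- g) ^ m) = of_nat (d choose (d - m)) * (- 1) ^ m * (c g * g ^ m)"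
        by (simp only: power_minus[of g m] mult_ac)
    qed simp
    finally show ?thesis using that by (auto simp: not_less)
  qed
  \<comment> \<open>The numerator of the Lagrange polynomial of \<open>g0\<close>: it vanishes at
    all other nodes, so only the term of \<open>g0\<close> survives.\<close>
  define q where "q = (\<Prod>g\<in>\<Gamma> - {g0}. [:- g, 1:])"
  have dq: "degree q \<le> d"
  proof -
    have "degree q = (\<Sum>g\<in>\<Gamma> - {g0}. degree [:- g, 1:])"
      unfolding q_def by (rule degree_prod_sum_eq) auto
    also have "\<dots> = d" using fin g0 by simp
    finally show ?thesis by simp
  qed
  have "poly q g = (\<Sum>m\<le>d. coeff q m * g ^ m)" for g
    by (subst poly_as_sum_of_monoms'[OF dq, symmetric]) (simp add: poly_sum poly_monom)
  then have "(\<Sum>g\<in>\<Gamma>. c g * poly q g) = (\<Sum>g\<in>\<Gamma>. \<Sum>m\<le>d. coeff q m * (c g * g ^ m))"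
    by (simp add: sum_distrib_left mult_ac)
  also have "\<dots> = (\<Sum>m\<le>d. coeff q m * (\<Sum>g\<in>\<Gamma>. c g * g ^ m))"
    by (subst sum.swap) (simp add: sum_distrib_left)
  also have "\<dots> = 0" using mom by simp
  finally have "(\<Sum>g\<in>\<Gamma>. c g * poly q g) = 0" .
  moreover have "poly q g = 0" if "g \<in> \<Gamma> - {g0}" for g
    unfolding q_def poly_prod using that fin by (intro prod_zero) auto
  then have "(\<Sum>g\<in>\<Gamma>. c g * poly q g) = c g0 * poly q g0"
    using sum.remove[OF fin(1) g0, of "\<lambda>g. c g * poly q g"] by simp
  moreover have "poly q g0 \<noteq> 0" unfolding q_def poly_prod using fin by (simp add: prod_zero_iff)
  ultimately show ?thesis by simp
qed

lemma lpow_spanning: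
  assumes fin: "finite \<Gamma>" "card \<Gamma> = Suc d" and p: "degree p \<le> d"
  shows "p \<in> rp.span (lpow d ` \<Gamma>)"
proof -
  have inj: "inj_on (lpow d) \<Gamma>"
  proof (rule inj_onI, rule ccontr)
    fix g h assume gh: "g \<in> \<Gamma>" "h \<in> \<Gamma>" "lpow d g = lpow d h" "g \<noteq> h"
    let ?c = "\<lambda>x. if x = g then 1 else if x = h then - 1 else (0::real)"
    have "(\<Sum>x\<in>\<Gamma>. smult (?c x) (lpow d x)) = (\<Sum>x\<in>{g, h}. smult (?c x) (lpow d x))"
      using gh fin by (intro sum.mono_neutral_right) auto
    then have "(\<Sum>x\<in>\<Gamma>. smult (?c x) (lpow d x)) = 0" using gh by simp
    from lpow_independent_aux[OF fin this gh(1)] show False by simp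
  qed
  have ind: "rp.independent (lpow d ` \<Gamma>)"
  proof (rule rp.independent_if_scalars_zero)
    fix f x assume s: "(\<Sum>x\<in>lpow d ` \<Gamma>. smult (f x) x) = 0" and "x \<in> lpow d ` \<Gamma>"
    then obtain g where g: "g \<in> \<Gamma>" "x = lpow d g" by auto
    show "f x = 0" using lpow_independent_aux[OF fin _ g(1), of "\<lambda>g. f (lpow d g)"] s g(2)
      by (simp add: sum.reindex[OF inj])
  qed (use fin in simp)
  let ?D = "{p :: real poly. degree p \<le> d}"
  have "rp.has_dim (rp.span (lpow d ` \<Gamma>)) (Suc d)"
    using fin card_image[OF inj] by (intro rp.has_dimI[OF _ ind]) auto
  moreover have "rp.span (lpow d ` \<Gamma>) \<subseteq> ?D"
    by (rule rp.span_minimal) (use rp_has_dim_degree rp.has_dim_subspace in auto)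
  ultimately have "rp.span (lpow d ` \<Gamma>) = ?D"
    using rp.has_dim_eq rp_has_dim_degree by simp
  then show ?thesis using p by blast
qed

section \<open>Local structure of a T-mesh\<close>

definition lo :: "bool \<Rightarrow> (real \<times> real) set \<Rightarrow> real" where "lo k C = Inf (co k ` C)"
definition hi :: "bool \<Rightarrow> (real \<times> real) set \<Rightarrow> real" where "hi k C = Sup (co k ` C)"

text \<open>A quadrant is given by the sign of each coordinate; \<open>inq s z C\<close> says that the cell \<open>C\<close> fills the
  quadrant \<open>s\<close> at \<open>z\<close>.\<close>

definition inq :: "(bool \<Rightarrow> bool) \<Rightarrow> real \<times> real \<Rightarrow> (real \<times> real) set \<Rightarrow> bool" where
  "inq s z C \<longleftrightarrow> (\<forall>k. if s k then lo k C \<le> co k z \<and> co k z < hi k C else lo k C < co k z \<and> co k z \<le> hi k C)"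

text \<open>For \<open>w\<close> close to \<open>z\<close>, the quadrant at \<open>z\<close> that contains the quadrant \<open>t\<close> at \<open>w\<close>.\<close>

definition dirq :: "(bool \<Rightarrow> bool) \<Rightarrow> real \<times> real \<Rightarrow> real \<times> real \<Rightarrow> bool \<Rightarrow> bool" where
  "dirq t z w k = (if co k z < co k w then True else if co k w < co k z then False else t k)"

text \<open>In the following a ray is given by its coordinate axis \<open>k\<close> and its sign \<open>s\<close>; the quadrants adjacent to it
  are \<open>qd k s True\<close> and \<open>qd k s False\<close>.\<close>

definition qd :: "bool \<Rightarrow> bool \<Rightarrow> bool \<Rightarrow> bool \<Rightarrow> bool" where
  "qd k s t i = (if i = k then s else t)"

definition dirn :: "bool \<Rightarrow> seg \<Rightarrow> bool" where
  "dirn k e \<longleftrightarrow> co k (fst e) < co k (snd e) \<and> co (\<not> k) (fst e) = co (\<not> k) (snd e)"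

text \<open>The segment \<open>e\<close> contains an initial piece of the ray \<open>(k, s)\<close> from \<open>z\<close>.\<close>

definition onq :: "bool \<Rightarrow> bool \<Rightarrow> real \<times> real \<Rightarrow> seg \<Rightarrow> bool" where
  "onq k s z e \<longleftrightarrow> dirn k e \<and> co (\<not> k) z = co (\<not> k) (fst e) \<and>
     (if s then co k (fst e) \<le> co k z \<and> co k z < co k (snd e) else co k (fst e) < co k z \<and> co k z \<le> co k (snd e))"

definition mk :: "bool \<Rightarrow> real \<Rightarrow> real \<Rightarrow> real \<times> real" where
  "mk k a b = (if k then (a, b) else (b, a))"

lemma co_mk [simp]: "co k (mk k a b) = a" "co (\<not> k) (mk k a b) = b"
  by (auto simp: co_def mk_def)

lemma mk_ext: "z = mk k a b \<longleftrightarrow> co k z = a \<and> co (\<not> k) z = b"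
  using prod_eq_co2[of z "mk k a b" k] by simp

lemma dirn_iff: "dirn True e \<longleftrightarrow> horizontal e" "dirn False e \<longleftrightarrow> vertical e"
  by (auto simp: dirn_def horizontal_def vertical_def co_def)

lemma dirn_cases: "horizontal e \<or> vertical e \<longleftrightarrow> (\<exists>k. dirn k e)"
  using dirn_iff by (metis (full_types))

lemma dirn_unique: "dirn k e \<Longrightarrow> dirn k' e \<Longrightarrow> k = k'"
  unfolding dirn_def by (cases "k = k'") auto

lemma dirn_pts:
  assumes "dirn k e"
  shows "pts e = {z. co (\<not> k) z = co (\<not> k) (fst e) \<and> co k (fst e) \<le> co k z \<and> co k z \<le> co k (snd e)}"
proof -
  obtain a1 a2 b1 b2 where e: "e = ((a1, a2), (b1, b2))" by (metis surj_pair)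
  show ?thesis
  proof (cases k)
    case True
    then have "a1 < b1" "b2 = a2" using assms e by (auto simp: dirn_def co_def)
    then have "pts e = {a1..b1} \<times> {a2}"
      using closed_segment_same_snd[of "(a1,a2)" "(b1,b2)"] e
      by (simp add: pts_def closed_segment_eq_real_ivl)
    moreover have "z \<in> {a1..b1} \<times> {a2} \<longleftrightarrow> snd z = a2 \<and> a1 \<le> fst z \<and> fst z \<le> b1" for z
      by (cases z) auto
    ultimately show ?thesis using True e by (simp add: co_def set_eq_iff)
  next
    case False
    then have "a2 < b2" "b1 = a1" using assms e by (auto simp: dirn_def co_def)
    then have "pts e = {a1} \<times> {a2..b2}"
      using closed_segment_same_fst[of "(a1,a2)" "(b1,b2)"] e
      by (simp add: pts_def closed_segment_eq_real_ivl)
    moreover have "z \<in> {a1} \<times> {a2..b2} \<longleftrightarrow> fst z = a1 \<and> a2 \<le> snd z \<and> snd z \<le> b2" for z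
      by (cases z) auto
    ultimately show ?thesis using False e by (simp add: co_def set_eq_iff)
  qed
qed

lemma dirn_open_segment:
  assumes "dirn k e"
  shows "open_segment (fst e) (snd e) = {z. co (\<not> k) z = co (\<not> k) (fst e) \<and> co k (fst e) < co k z \<and> co k z < co k (snd e)}"
proof -
  have "z \<noteq> fst e \<longleftrightarrow> co k z \<noteq> co k (fst e)" "z \<noteq> snd e \<longleftrightarrow> co k z \<noteq> co k (snd e)"
    if "co (\<not> k) z = co (\<not> k) (fst e)" for z
    using that assms prod_eq_co2[of z _ k] by (auto simp: dirn_def)
  then show ?thesis
    unfolding open_segment_def pts_def[symmetric] dirn_pts[OF assms] by (auto simp: order_less_le)
qed

lemma dirn_ends: "dirn k e \<Longrightarrow> fst e \<in> pts e \<and> snd e \<in> pts e \<and> fst e \<noteq> snd e"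
  by (auto simp: dirn_pts) (auto simp: dirn_def)

lemma onq_pts: "onq k s z e \<Longrightarrow> z \<in> pts e"
  unfolding onq_def by (auto simp: dirn_pts split: if_splits)

lemma onq_fst: "dirn k e \<Longrightarrow> onq k True (fst e) e"
  and onq_snd: "dirn k e \<Longrightarrow> onq k False (snd e) e"
  unfolding onq_def dirn_def by auto

lemma qd_surj: "s = qd k (s k) (s (\<not> k))"
  by (auto simp: qd_def fun_eq_iff)

lemma qd_swap: "qd k s t = qd (\<not> k) t s"
  by (auto simp: qd_def fun_eq_iff)

lemma all_co: "(\<forall>k. P k) \<longleftrightarrow> P k \<and> P (\<not> k)"
  by (cases k) (auto, (metis (full_types))+)

lemma inq_qd: "inq (qd k s t) z C \<longleftrightarrow>
    (if s then lo k C \<le> co k z \<and> co k z < hi k C else lo k C < co k z \<and> co k z \<le> hi k C) \<and>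
    (if t then lo (\<not> k) C \<le> co (\<not> k) z \<and> co (\<not> k) z < hi (\<not> k) C
     else lo (\<not> k) C < co (\<not> k) z \<and> co (\<not> k) z \<le> hi (\<not> k) C)"
  unfolding inq_def by (subst all_co[of _ k]) (auto simp: qd_def)

locale tmesh =
  fixes M :: "(real \<times> real) set set"
  assumes T_mesh: "T_mesh M"
begin

definition \<Phi> :: "(real \<times> real) set" where "\<Phi> = \<Union>M"

lemma finite_M: "finite M"
  using T_mesh unfolding T_mesh_def by (auto dest: division_ofD)

lemma cell_box:
  assumes "C \<in> M"
  obtains a b where "C = cbox a b" "\<And>k. co k a < co k b" "\<And>k. lo k C = co k a" "\<And>k. hi k C = co k b"
proof -
  obtain a b where C: "C = cbox a b" using T_mesh assms unfolding T_mesh_def by (metis division_ofD(4))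
  have "box a b \<noteq> {}" using T_mesh assms C unfolding T_mesh_def by (metis interior_cbox)
  then have ab: "fst a < fst b" "snd a < snd b"
    using box_ne_empty(2)[of a b] by (auto simp: Basis_prod_def inner_prod_def)
  have C': "C = {fst a..fst b} \<times> {snd a..snd b}" unfolding C by (metis cbox_Pair_eq cbox_interval prod.collapse)
  have "fst ` C = {fst a..fst b}" "snd ` C = {snd a..snd b}" unfolding C' using ab by (auto simp: image_iff)
  moreover have "co True = fst" "co False = snd" by (auto simp: co_def fun_eq_iff)
  ultimately have "co k ` C = {co k a..co k b}" "co k a < co k b" for k using ab by (cases k; simp)+
  then have "co k a < co k b" "lo k C = co k a" "hi k C = co k b" for k
    unfolding lo_def hi_def by (auto simp: less_imp_le)
  then show ?thesis using that C by blast
qed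

lemma lo_hi: "C \<in> M \<Longrightarrow> lo k C < hi k C"
  by (metis cell_box)

lemma mem_cell: "C \<in> M \<Longrightarrow> z \<in> C \<longleftrightarrow> (\<forall>k. lo k C \<le> co k z \<and> co k z \<le> hi k C)"
proof -
  assume "C \<in> M"
  then obtain a b where C: "C = cbox a b" "\<And>k. lo k C = co k a" "\<And>k. hi k C = co k b" by (metis cell_box)
  have "z \<in> cbox a b \<longleftrightarrow> (\<forall>k. co k a \<le> co k z \<and> co k z \<le> co k b)"
    by (subst all_co[of _ True]) (auto simp: co_def mem_box Basis_prod_def inner_prod_def)
  then show ?thesis using C by simp
qed

lemma mem_interior_cell: "C \<in> M \<Longrightarrow> z \<in> interior C \<longleftrightarrow> (\<forall>k. lo k C < co k z \<and> co k z < hi k C)"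
proof -
  assume "C \<in> M"
  then obtain a b where C: "C = cbox a b" "\<And>k. lo k C = co k a" "\<And>k. hi k C = co k b" by (metis cell_box)
  have "z \<in> box a b \<longleftrightarrow> (\<forall>k. co k a < co k z \<and> co k z < co k b)"
    by (subst all_co[of _ True]) (auto simp: co_def mem_box Basis_prod_def inner_prod_def)
  then show ?thesis using C interior_cbox by metis
qed

lemma closed_cell: "C \<in> M \<Longrightarrow> closed C"
  by (metis cell_box closed_cbox)

lemma frontier_cell: "C \<in> M \<Longrightarrow> z \<in> frontier C \<longleftrightarrow> z \<in> C \<and> (\<exists>k. co k z = lo k C \<or> co k z = hi k C)"
  using mem_cell[of C z] mem_interior_cell[of C z] closed_cell[of C]
  by (auto simp: frontier_def) (metis order_less_le)+

text \<open>\<open>vertices\<close> speaks of the corners in some representation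
  \<open>cbox a b\<close> of a cell; these corners are determined because the box is
  nonempty.\<close>

lemma vertices_iff: "z \<in> vertices M \<longleftrightarrow> (\<exists>C\<in>M. \<forall>k. co k z = lo k C \<or> co k z = hi k C)"
proof
  assume "z \<in> vertices M"
  then obtain a b where ab: "cbox a b \<in> M" "z \<in> {fst a, fst b} \<times> {snd a, snd b}"
    unfolding vertices_def by auto
  obtain a' b' where ab': "cbox a b = cbox a' b'" "\<And>k. co k a' < co k b'" "\<And>k. lo k (cbox a b) = co k a'" "\<And>k. hi k (cbox a b) = co k b'"
    using cell_box[OF ab(1)] by metis
  have "cbox a' b' \<noteq> {}" using T_mesh ab(1) ab'(1) unfolding T_mesh_def by (metis interior_empty)
  then have "a' = a \<and> b' = b" using eq_cbox[of a b a' b'] ab'(1) by auto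
  then have "co k z = lo k (cbox a b) \<or> co k z = hi k (cbox a b)" for k
    unfolding ab'(3,4) using ab(2) by (auto simp: co_def)
  then show "\<exists>C\<in>M. \<forall>k. co k z = lo k C \<or> co k z = hi k C" using ab(1) by blast
next
  assume "\<exists>C\<in>M. \<forall>k. co k z = lo k C \<or> co k z = hi k C"
  then obtain C where C: "C \<in> M" "\<forall>k. co k z = lo k C \<or> co k z = hi k C" by blast
  obtain a b where ab: "C = cbox a b" "\<And>k. lo k C = co k a" "\<And>k. hi k C = co k b"
    using cell_box[OF C(1)] by metis
  have "fst z \<in> {fst a, fst b}" "snd z \<in> {snd a, snd b}"
    using C(2)[rule_format, of True] C(2)[rule_format, of False] ab by (auto simp: co_def)
  then have "z \<in> {fst a, fst b} \<times> {snd a, snd b}" by (metis mem_Times_iff)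
  then show "z \<in> vertices M" unfolding vertices_def using C(1) ab(1) by blast
qed

lemma finite_vertices: "finite (vertices M)"
proof -
  have "vertices M \<subseteq> (\<Union>C\<in>M. {lo True C, hi True C} \<times> {lo False C, hi False C})"
  proof
    fix z assume "z \<in> vertices M"
    then obtain C where C: "C \<in> M" "\<forall>k. co k z = lo k C \<or> co k z = hi k C" unfolding vertices_iff by blast
    then have "fst z \<in> {lo True C, hi True C}" "snd z \<in> {lo False C, hi False C}"
      using C(2)[rule_format, of True] C(2)[rule_format, of False] by (simp_all add: co_def)
    then have "z \<in> {lo True C, hi True C} \<times> {lo False C, hi False C}" by (metis mem_Times_iff)
    then show "z \<in> (\<Union>C\<in>M. {lo True C, hi True C} \<times> {lo False C, hi False C})" using C by blast
  qed
  moreover have "finite (\<Union>C\<in>M. {lo True C, hi True C} \<times> {lo False C, hi False C})"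
    using finite_M by auto
  ultimately show ?thesis using finite_subset by blast
qed

lemma finite_edges: "finite (edges M)"
proof -
  have "edges M \<subseteq> vertices M \<times> vertices M"
  proof
    fix e assume "e \<in> edges M"
    then have "fst e \<in> vertices M \<and> snd e \<in> vertices M" unfolding edges_def by blast
    then show "e \<in> vertices M \<times> vertices M" by (simp add: mem_Times_iff)
  qed
  then show ?thesis using finite_vertices finite_subset by blast
qed

lemma finite_interior_edges: "finite (interior_edges M)"
  using finite_edges unfolding interior_edges_def by auto

lemma finite_interior_vertices: "finite (interior_vertices M)"
  using finite_vertices unfolding interior_vertices_def by auto

text \<open>Closer to \<open>z\<close> than the least nonzero distance of its coordinates to a cell
  bound, every comparison of \<open>w\<close> with a bound is decided by that of \<open>z\<close>,
  or, if \<open>z\<close> lies on the bound, by the side on which \<open>w\<close> lies.\<close>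

lemma inq_near:
  obtains \<epsilon> where "\<epsilon> > 0" "\<And>w C t. (\<And>k. \<bar>co k w - co k z\<bar> < \<epsilon>) \<Longrightarrow> C \<in> M \<Longrightarrow> inq t w C \<longleftrightarrow> inq (dirq t z w) z C"
proof -
  define D where "D = (\<lambda>(C, k). \<bar>co k z - lo k C\<bar>) ` (M \<times> UNIV) \<union> (\<lambda>(C, k). \<bar>co k z - hi k C\<bar>) ` (M \<times> UNIV) - {0}"
  define \<epsilon> where "\<epsilon> = Min (insert 1 D)"
  have fin: "finite (insert 1 D)" unfolding D_def using finite_M by auto
  have pos: "\<epsilon> > 0" unfolding \<epsilon>_def using fin by (subst Min_gr_iff) (auto simp: D_def)
  have le: "\<epsilon> \<le> \<bar>co k z - lo k C\<bar> \<or> co k z = lo k C" "\<epsilon> \<le> \<bar>co k z - hi k C\<bar> \<or> co k z = hi k C" if "C \<in> M" for C k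
    unfolding \<epsilon>_def using that fin by (auto simp: D_def intro!: Min_le)
  have "inq t w C \<longleftrightarrow> inq (dirq t z w) z C" if w: "\<And>k. \<bar>co k w - co k z\<bar> < \<epsilon>" and C: "C \<in> M" for w C t
  proof -
    have "(if t k then lo k C \<le> co k w \<and> co k w < hi k C else lo k C < co k w \<and> co k w \<le> hi k C) \<longleftrightarrow>
      (if dirq t z w k then lo k C \<le> co k z \<and> co k z < hi k C else lo k C < co k z \<and> co k z \<le> hi k C)" for k
      using w[of k] le[OF C, of k] lo_hi[OF C, of k] unfolding dirq_def by (auto split: if_splits)
    then show ?thesis unfolding inq_def by simp
  qed
  then show ?thesis using that pos by blast
qed

lemma inq_mem: "C \<in> M \<Longrightarrow> inq s z C \<Longrightarrow> z \<in> C"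
  unfolding mem_cell inq_def by (metis less_imp_le)

lemma ex_inq: "C \<in> M \<Longrightarrow> z \<in> C \<Longrightarrow> \<exists>s. inq s z C"
  unfolding mem_cell inq_def using lo_hi[of C]
  by (intro exI[of _ "\<lambda>k. co k z < hi k C"]) (auto simp: not_less intro: less_le_trans)

definition shift :: "(bool \<Rightarrow> bool) \<Rightarrow> real \<times> real \<Rightarrow> real \<Rightarrow> real \<times> real" where
  "shift s z r = (fst z + (if s True then r else - r), snd z + (if s False then r else - r))"

lemma co_shift: "co k (shift s z r) = co k z + (if s k then r else - r)"
  by (cases k) (auto simp: co_def shift_def)

text \<open>Pushing \<open>z\<close> slightly into the quadrant produces a common interior point of
  the two cells.\<close>

lemma inq_unique:
  assumes "C \<in> M" "C' \<in> M" "inq s z C" "inq s z C'"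
  shows "C = C'"
proof (rule ccontr)
  assume "C \<noteq> C'"
  then have disj: "interior C \<inter> interior C' = {}"
    using T_mesh assms(1,2) unfolding T_mesh_def by (metis division_ofD(5))
  obtain \<epsilon> where e: "\<epsilon> > 0" "\<And>w C t. (\<And>k. \<bar>co k w - co k z\<bar> < \<epsilon>) \<Longrightarrow> C \<in> M \<Longrightarrow> inq t w C \<longleftrightarrow> inq (dirq t z w) z C"
    using inq_near by metis
  define w where "w = shift s z (\<epsilon> / 2)"
  have near: "\<bar>co k w - co k z\<bar> < \<epsilon>" for k using e(1) by (auto simp: w_def co_shift)
  have dq: "dirq t z w = s" for t using e(1) by (auto simp: dirq_def fun_eq_iff w_def co_shift)
  have "inq t w C" "inq t w C'" for t using e(2)[OF near] dq assms by auto
  from this[of "\<lambda>_. True"] this[of "\<lambda>_. False"] have "w \<in> interior C" "w \<in> interior C'"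
    unfolding mem_interior_cell[OF assms(1)] mem_interior_cell[OF assms(2)] inq_def by auto
  then show False using disj by blast
qed

text \<open>The global notion of interior becomes a condition on the four quadrants; all later
  arguments on interior edges and vertices go through it.\<close>

lemma interior_\<Phi>_iff: "z \<in> interior \<Phi> \<longleftrightarrow> (\<forall>s. \<exists>C\<in>M. inq s z C)"
proof -
  obtain \<epsilon> where e: "\<epsilon> > 0" "\<And>w C t. (\<And>k. \<bar>co k w - co k z\<bar> < \<epsilon>) \<Longrightarrow> C \<in> M \<Longrightarrow> inq t w C \<longleftrightarrow> inq (dirq t z w) z C"
    using inq_near by metis
  have dist: "\<bar>co k w - co k z\<bar> \<le> dist w z" for k w
    unfolding co_def by (metis dist_fst_le dist_snd_le dist_real_def)
  show ?thesis
  proof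
    assume "z \<in> interior \<Phi>"
    then obtain r where r: "r > 0" "ball z r \<subseteq> \<Phi>" using mem_interior by blast
    show "\<forall>s. \<exists>C\<in>M. inq s z C"
    proof
      fix s
      \<comment> \<open>Both coordinates are displaced by \<open>q\<close>, so r / 3 keeps the sum
        of the two displacements below \<open>r\<close>.\<close>
      define q where "q = min (\<epsilon> / 2) (r / 3)"
      have q: "q > 0" "q < \<epsilon>" "2 * q < r" using e(1) r(1) by (auto simp: q_def min_def)
      define w where "w = shift s z q"
      have "dist w z \<le> \<bar>fst w - fst z\<bar> + \<bar>snd w - snd z\<bar>"
        unfolding dist_prod_def dist_real_def by (rule order.trans[OF sqrt_sum_squares_le_sum_abs]) simp
      also have "\<dots> < r" using q by (auto simp: w_def shift_def)
      finally have "w \<in> \<Phi>" using r(2) by (auto simp: dist_commute)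
      then obtain C where C: "C \<in> M" "w \<in> C" unfolding \<Phi>_def by blast
      obtain t where t: "inq t w C" using ex_inq[OF C] by blast
      have near: "\<bar>co k w - co k z\<bar> < \<epsilon>" for k using q by (auto simp: w_def co_shift)
      have dq: "dirq t z w = s" for t using q by (auto simp: dirq_def fun_eq_iff w_def co_shift)
      have "inq s z C" using e(2)[OF near C(1)] t dq by auto
      then show "\<exists>C\<in>M. inq s z C" using C by blast
    qed
  next
    assume *: "\<forall>s. \<exists>C\<in>M. inq s z C"
    have "ball z \<epsilon> \<subseteq> \<Phi>"
    proof
      fix w assume "w \<in> ball z \<epsilon>"
      then have near: "\<bar>co k w - co k z\<bar> < \<epsilon>" for k using dist[of k w] by (auto simp: dist_commute)
      obtain C where C: "C \<in> M" "inq (dirq (\<lambda>_. True) z w) z C" using * by blast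
      then have "inq (\<lambda>_. True) w C" using e(2)[OF near C(1)] by auto
      then show "w \<in> \<Phi>" unfolding \<Phi>_def using inq_mem C(1) by blast
    qed
    then show "z \<in> interior \<Phi>" using e(1) mem_interior by blast
  qed
qed

text \<open>The two quadrants at \<open>z\<close> adjacent to the ray \<open>(k, s)\<close> are not filled by the same cell.\<close>

definition wall :: "bool \<Rightarrow> bool \<Rightarrow> real \<times> real \<Rightarrow> bool" where
  "wall k s z \<longleftrightarrow> (\<exists>C\<in>M. \<exists>t. inq (qd k s t) z C \<and> \<not> inq (qd k s (\<not> t)) z C)"

section \<open>Edges recovered from the cells around a point\<close>

lemma edges_dirn: "e \<in> edges M \<Longrightarrow> \<exists>k. dirn k e"
  unfolding edges_def using dirn_cases by auto

text \<open>The assumption puts \<open>z\<close> on a side of \<open>C\<close>. The edge is bounded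
  by the nearest vertices on that line before and after \<open>z\<close>; they exist because the two
  corners of \<open>C\<close> on the line are vertices.\<close>

lemma edge_exists:
  assumes C: "C \<in> M" and i: "inq (qd k s t) z C" and ni: "\<not> inq (qd k s (\<not> t)) z C"
  shows "\<exists>e\<in>edges M. onq k s z e"
proof -
  define c where "c = co (\<not> k) z"
  have c: "c = (if t then lo (\<not> k) C else hi (\<not> k) C)"
    using i ni lo_hi[OF C, of "\<not> k"] unfolding inq_qd c_def by (auto split: if_splits)
  define V where "V = {r. mk k r c \<in> vertices M}"
  have finV: "finite V"
  proof -
    have "V \<subseteq> co k ` vertices M" unfolding V_def by (auto intro!: image_eqI)
    then show ?thesis using finite_vertices finite_subset by blast
  qed
  have lohi: "lo k C \<in> V" "hi k C \<in> V"
    unfolding V_def vertices_iff using C c by (auto simp: all_co[of _ k] intro!: bexI[OF _ C])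
  \<comment> \<open>Strictness depends on \<open>s\<close>: if \<open>z\<close> is itself a vertex,
    the edge has to start at \<open>z\<close> in the direction of the ray instead of ending
    there.\<close>
  define A where "A = {r \<in> V. if s then r \<le> co k z else r < co k z}"
  define B where "B = {r \<in> V. if s then co k z < r else co k z \<le> r}"
  have A: "lo k C \<in> A" "finite A" "A \<noteq> {}" using i lohi finV by (auto simp: A_def inq_qd split: if_splits)
  have B: "hi k C \<in> B" "finite B" "B \<noteq> {}" using i lohi finV by (auto simp: B_def inq_qd split: if_splits)
  define a where "a = Max A"
  define b where "b = Min B"
  have a: "a \<in> A" "lo k C \<le> a" using A Max_in[of A] Max_ge[of A "lo k C"] by (auto simp: a_def)
  have b: "b \<in> B" "b \<le> hi k C" using B Min_in[of B] Min_le[of B "hi k C"] by (auto simp: b_def)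
  have ab: "if s then a \<le> co k z \<and> co k z < b else a < co k z \<and> co k z \<le> b"
    using a(1) b(1) by (auto simp: A_def B_def split: if_splits)
  have AB: "V = A \<union> B" by (auto simp: A_def B_def)
  have gap: "r = a \<or> r = b" if "r \<in> V" "a \<le> r" "r \<le> b" for r
    using that AB Max_ge[OF A(2), of r] Min_le[OF B(2), of r] unfolding a_def[symmetric] b_def[symmetric]
    by auto
  define e where "e = (mk k a c, mk k b c)"
  have dn: "dirn k e" using ab by (auto simp: e_def dirn_def split: if_splits)
  have pe: "pts e = {z. co (\<not> k) z = c \<and> a \<le> co k z \<and> co k z \<le> b}"
    using dirn_pts[OF dn] by (simp add: e_def)
  have "pts e \<subseteq> frontier C"
  proof
    fix w assume "w \<in> pts e"
    then show "w \<in> frontier C"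
      using c a(2) b(2) lo_hi[OF C, of "\<not> k"] unfolding frontier_cell[OF C] mem_cell[OF C] pe all_co[of _ k]
      by (auto intro!: exI[of _ "\<not> k"] split: if_splits)
  qed
  moreover have "pts e \<inter> vertices M = {fst e, snd e}"
  proof
    show "pts e \<inter> vertices M \<subseteq> {fst e, snd e}"
    proof
      fix w assume w: "w \<in> pts e \<inter> vertices M"
      then have wm: "w = mk k (co k w) c" by (simp add: pe mk_ext)
      then have "co k w \<in> V" using w unfolding V_def by simp
      moreover have "a \<le> co k w" "co k w \<le> b" using w pe by auto
      ultimately have "co k w = a \<or> co k w = b" using gap by blast
      then show "w \<in> {fst e, snd e}" using wm by (auto simp: e_def)
    qed
    show "{fst e, snd e} \<subseteq> pts e \<inter> vertices M"
      using dirn_ends[OF dn] a(1) b(1) AB unfolding e_def V_def by auto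
  qed
  moreover have "fst e \<in> vertices M" "snd e \<in> vertices M" using a(1) b(1) AB unfolding e_def V_def by auto
  ultimately have "e \<in> edges M" unfolding edges_def using dn dirn_cases C by blast
  moreover have "onq k s z e" using ab dn unfolding onq_def by (auto simp: e_def c_def)
  ultimately show ?thesis by blast
qed

text \<open>The corners of \<open>C\<close> on the line of \<open>e\<close> are vertices and cannot
  lie inside an edge, so the edge stays within the side of \<open>C\<close>.\<close>

lemma edge_cell:
  assumes e: "e \<in> edges M" and on: "onq k s z e" and C: "C \<in> M"
    and i: "inq (qd k s t) z C" and ni: "\<not> inq (qd k s (\<not> t)) z C"
  shows "lo k C \<le> co k (fst e)" "co k (snd e) \<le> hi k C"
    "co (\<not> k) (fst e) = (if t then lo (\<not> k) C else hi (\<not> k) C)"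
proof -
  have dn: "dirn k e" using on unfolding onq_def by simp
  define c where "c = co (\<not> k) z"
  have ec: "co (\<not> k) (fst e) = c" using on by (simp add: onq_def c_def)
  have c: "c = (if t then lo (\<not> k) C else hi (\<not> k) C)"
    using i ni lo_hi[OF C, of "\<not> k"] unfolding inq_qd c_def by (auto split: if_splits)
  then show "co (\<not> k) (fst e) = (if t then lo (\<not> k) C else hi (\<not> k) C)" using ec by simp
  have v: "mk k (lo k C) c \<in> vertices M" "mk k (hi k C) c \<in> vertices M"
    unfolding vertices_iff using C c by (auto simp: all_co[of _ k] intro!: bexI[OF _ C])
  have ends: "r = co k (fst e) \<or> r = co k (snd e)" if "mk k r c \<in> vertices M" "co k (fst e) \<le> r" "r \<le> co k (snd e)" for r
  proof -
    have "mk k r c \<in> pts e \<inter> vertices M" using that dirn_pts[OF dn] ec by simp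
    then have "mk k r c = fst e \<or> mk k r c = snd e" using e unfolding edges_def by blast
    then show ?thesis using co_mk(1) by metis
  qed
  show "lo k C \<le> co k (fst e)"
    using ends[OF v(1)] i on
    by (cases "lo k C \<le> co k (fst e)") (auto simp: inq_qd onq_def split: if_splits)
  show "co k (snd e) \<le> hi k C"
    using ends[OF v(2)] i on
    by (cases "co k (snd e) \<le> hi k C") (auto simp: inq_qd onq_def split: if_splits)
qed

lemma edge_cell_onq:
  assumes "C \<in> M" "onq k s z e" "lo k C \<le> co k (fst e)" "co k (snd e) \<le> hi k C"
    "co (\<not> k) (fst e) = (if t then lo (\<not> k) C else hi (\<not> k) C)"
  shows "inq (qd k s t) z C" "\<not> inq (qd k s (\<not> t)) z C"
  using assms lo_hi[OF assms(1), of "\<not> k"] by (auto simp: inq_qd onq_def split: if_splits)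

lemma upd_qd: "t(k := s) = qd k s (t (\<not> k))"
proof
  fix i show "(t(k := s)) i = qd k s (t (\<not> k)) i" by (cases k; cases i) (auto simp: qd_def)
qed

lemma inq_flip:
  assumes "inq t w C" "co j w = lo j C \<or> co j w = hi j C"
  shows "\<not> inq (t(j := \<not> t j)) w C"
  using assms unfolding inq_def by (auto dest!: spec[of _ j] split: if_splits)

lemma point_near:
  assumes "onq k s z e" "\<epsilon> > 0"
  obtains w where "\<And>j. \<bar>co j w - co j z\<bar> < \<epsilon>" "w \<in> open_segment (fst e) (snd e)"
    "\<And>t. dirq t z w = t(k := s)"
proof -
  have dn: "dirn k e" using assms unfolding onq_def by simp
  define q where "q = min (\<epsilon> / 2) ((if s then co k (snd e) - co k z else co k z - co k (fst e)) / 2)"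
  have q: "q > 0" "q < \<epsilon>" "q < (if s then co k (snd e) - co k z else co k z - co k (fst e))"
    using assms by (auto simp: q_def onq_def min_def split: if_splits)
  define w where "w = mk k (co k z + (if s then q else - q)) (co (\<not> k) z)"
  have cw: "co k w = co k z + (if s then q else - q)" "co (\<not> k) w = co (\<not> k) z" by (simp_all add: w_def)
  have "\<forall>j. \<bar>co j w - co j z\<bar> < \<epsilon>" unfolding all_co[of _ k] using cw q by auto
  moreover have "w \<in> open_segment (fst e) (snd e)"
    using cw q assms by (auto simp: dirn_open_segment[OF dn] onq_def split: if_splits)
  moreover have "dirq t z w = t(k := s)" for t
  proof
    have "\<forall>j. dirq t z w j = (t(k := s)) j" unfolding all_co[of _ k] using cw q by (auto simp: dirq_def)
    then show "dirq t z w j = (t(k := s)) j" for j by blast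
  qed
  ultimately show ?thesis using that by blast
qed

text \<open>A point of the open edge just beyond \<open>z\<close> lies on the frontier of some cell,
  and the local picture at \<open>z\<close> determines that of this point.\<close>

lemma wall_edge:
  assumes e: "e \<in> edges M" and on: "onq k s z e"
  shows "wall k s z"
proof -
  obtain \<epsilon> where eps: "\<epsilon> > 0" "\<And>w C t. (\<And>k. \<bar>co k w - co k z\<bar> < \<epsilon>) \<Longrightarrow> C \<in> M \<Longrightarrow> inq t w C \<longleftrightarrow> inq (dirq t z w) z C"
    using inq_near by metis
  obtain w where w: "\<And>j. \<bar>co j w - co j z\<bar> < \<epsilon>" "w \<in> open_segment (fst e) (snd e)"
    "\<And>t. dirq t z w = t(k := s)" using point_near[OF on eps(1)] by metis
  have near: "inq t w C \<longleftrightarrow> inq (t(k := s)) z C" if "C \<in> M" for t C using eps(2)[OF w(1) that] w(3) by simp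
  have "w \<in> pts e" using w(2) by (simp add: pts_def open_segment_def)
  then obtain C where C: "C \<in> M" "w \<in> frontier C" using e unfolding edges_def by blast
  obtain j where j: "co j w = lo j C \<or> co j w = hi j C" "w \<in> C" using C frontier_cell by blast
  obtain t where t: "inq t w C" using ex_inq C j by blast
  have nt: "\<not> inq (t(j := \<not> t j)) w C" using inq_flip[OF t j(1)] .
  \<comment> \<open>Quadrants at \<open>w\<close> that differ only in the direction of the ray
    belong to the same quadrant at \<open>z\<close>, so the cell must end transversally to the
    ray.\<close>
  have "j \<noteq> k"
  proof
    assume "j = k"
    then have "(t(j := \<not> t j))(k := s) = t(k := s)" by simp
    then show False using t nt near[OF C(1), of t] near[OF C(1), of "t(j := \<not> t j)"] by metis
  qed
  then have jk: "j = (\<not> k)" by auto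
  have "inq (qd k s (t (\<not> k))) z C"
    using t near[OF C(1), of t] upd_qd[of t k s] by metis
  moreover have "\<not> inq (qd k s (\<not> t (\<not> k))) z C"
  proof -
    have "(t(j := \<not> t j))(k := s) = qd k s (\<not> t (\<not> k))" using jk using jk by (simp add: upd_qd[of _ k])
    then show ?thesis using nt near[OF C(1), of "t(j := \<not> t j)"] by metis
  qed
  ultimately show ?thesis unfolding wall_def using C by blast
qed

lemma interior_edge_edge: "e \<in> interior_edges M \<Longrightarrow> e \<in> edges M"
  unfolding interior_edges_def by simp

lemma interior_edge_quads:
  assumes e: "e \<in> interior_edges M" and on: "onq k s z e"
  shows "\<exists>C\<in>M. inq (qd k s t) z C"
proof -
  obtain \<epsilon> where eps: "\<epsilon> > 0" "\<And>w C t. (\<And>k. \<bar>co k w - co k z\<bar> < \<epsilon>) \<Longrightarrow> C \<in> M \<Longrightarrow> inq t w C \<longleftrightarrow> inq (dirq t z w) z C"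
    using inq_near by metis
  obtain w where w: "\<And>j. \<bar>co j w - co j z\<bar> < \<epsilon>" "w \<in> open_segment (fst e) (snd e)"
    "\<And>t. dirq t z w = t(k := s)" using point_near[OF on eps(1)] by metis
  have "w \<in> interior \<Phi>" using e w(2) unfolding interior_edges_def \<Phi>_def by blast
  then obtain C where C: "C \<in> M" "inq (qd k s t) w C" using interior_\<Phi>_iff by blast
  have "(qd k s t)(k := s) = qd k s t" by (simp add: upd_qd qd_def)
  then show ?thesis using C eps(2)[OF w(1) C(1)] w(3) by metis
qed

text \<open>\<open>C\<close> is the cell adjacent to the edge \<open>e\<close> on the side of larger (\<open>t\<close>) or smaller coordinates.\<close>

definition sidep :: "bool \<Rightarrow> seg \<Rightarrow> bool \<Rightarrow> (real \<times> real) set \<Rightarrow> bool" where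
  "sidep k e t C \<longleftrightarrow> C \<in> M \<and> lo k C \<le> co k (fst e) \<and> co k (snd e) \<le> hi k C \<and>
     co (\<not> k) (fst e) = (if t then lo (\<not> k) C else hi (\<not> k) C)"

definition side :: "seg \<Rightarrow> bool \<Rightarrow> (real \<times> real) set" where
  "side e t = (THE C. sidep (horizontal e) e t C)"

lemma sidep_inq:
  assumes "sidep k e t C" "onq k s z e"
  shows "inq (qd k s t) z C" "\<not> inq (qd k s (\<not> t)) z C"
  using assms edge_cell_onq unfolding sidep_def by blast+

lemma sidep_unique: "dirn k e \<Longrightarrow> sidep k e t C \<Longrightarrow> sidep k e t C' \<Longrightarrow> C = C'"
  using sidep_inq(1)[OF _ onq_fst] inq_unique unfolding sidep_def by blast

text \<open>The wall along \<open>e\<close> supplies a cell on one side. The cell filling the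
  opposite quadrant is a different one, so it is bounded by the edge as well.\<close>

lemma sidep_exists:
  assumes e: "e \<in> edges M" and on: "onq k s z e" and q: "\<And>t. \<exists>C\<in>M. inq (qd k s t) z C"
  shows "\<exists>C. sidep k e t C"
proof -
  obtain C u where C: "C \<in> M" "inq (qd k s u) z C" "\<not> inq (qd k s (\<not> u)) z C"
    using wall_edge[OF e on] unfolding wall_def by blast
  obtain C' where C': "C' \<in> M" "inq (qd k s (\<not> u)) z C'" using q by blast
  have "\<not> inq (qd k s u) z C'" using C C' inq_unique by blast
  then have "sidep k e u C" "sidep k e (\<not> u) C'"
    using edge_cell[OF e on C] edge_cell[OF e on C'] C C' unfolding sidep_def by auto
  then show ?thesis by (cases "t = u") auto
qed

lemma side_sidep:
  assumes "e \<in> interior_edges M" "dirn k e"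
  shows "sidep k e t (side e t)"
proof -
  have "horizontal e = k" using assms(2) dirn_iff dirn_unique by (metis (full_types))
  moreover have "\<exists>C. sidep k e t C"
    using sidep_exists[OF interior_edge_edge[OF assms(1)] onq_fst[OF assms(2)]]
      interior_edge_quads[OF assms(1) onq_fst[OF assms(2)]] by blast
  then obtain C where "sidep k e t C" by blast
  then have "(THE C. sidep k e t C) = C" using sidep_unique[OF assms(2)] by (intro the_equality)
  ultimately show ?thesis unfolding side_def using \<open>sidep k e t C\<close> by simp
qed

lemma side_in_M: "e \<in> interior_edges M \<Longrightarrow> side e t \<in> M"
  using side_sidep edges_dirn interior_edge_edge unfolding sidep_def by metis

lemma side_onq:
  assumes "e \<in> interior_edges M" "onq k s z e" "C \<in> M"
  shows "inq (qd k s t) z C \<longleftrightarrow> C = side e t"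
proof -
  have dn: "dirn k e" using assms unfolding onq_def by simp
  show ?thesis
    using sidep_inq(1)[OF side_sidep[OF assms(1) dn] assms(2)] side_in_M[OF assms(1)] inq_unique assms(3) by blast
qed

text \<open>The cells on both sides accompany the whole edge, so filled quadrants at one point of
  \<open>e\<close> carry over to all its inner points.\<close>

lemma interior_edgeI:
  assumes e: "e \<in> edges M" and on: "onq k s z e" and q: "\<And>t. \<exists>C\<in>M. inq (qd k s t) z C"
  shows "e \<in> interior_edges M"
proof -
  have dn: "dirn k e" using on unfolding onq_def by simp
  have "open_segment (fst e) (snd e) \<subseteq> interior \<Phi>"
  proof
    fix w assume w: "w \<in> open_segment (fst e) (snd e)"
    show "w \<in> interior \<Phi>" unfolding interior_\<Phi>_iff
    proof
      fix r
      obtain C where C: "sidep k e (r (\<not> k)) C" using sidep_exists[OF e on q] by blast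
      have "onq k (r k) w e" using w dn unfolding dirn_open_segment[OF dn] onq_def by auto
      then have "inq (qd k (r k) (r (\<not> k))) w C" using sidep_inq(1)[OF C] by blast
      then show "\<exists>C\<in>M. inq r w C" using C qd_surj[of r k] unfolding sidep_def by metis
    qed
  qed
  then show ?thesis using e unfolding interior_edges_def \<Phi>_def by blast
qed

section \<open>Functions of cells that do not change across interior edges\<close>

lemma adjacent_edge:
  assumes C: "C \<in> M" "C' \<in> M" "C \<noteq> C'" and i: "inq (qd k s True) z C" "inq (qd k s False) z C'"
  shows "\<exists>e\<in>interior_edges M. onq k s z e \<and> side e True = C \<and> side e False = C'"
proof -
  have "\<not> inq (qd k s False) z C" using inq_unique C i by blast
  then obtain e where e: "e \<in> edges M" "onq k s z e"
    using edge_exists[OF C(1), of k s True z] i by auto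
  have "\<And>t. \<exists>C\<in>M. inq (qd k s t) z C" using C i by (metis (full_types))
  then have "e \<in> interior_edges M" using interior_edgeI e by blast
  then show ?thesis using side_onq e C i by metis
qed

lemma quads_equal:
  assumes p: "\<And>e. e \<in> interior_edges M \<Longrightarrow> p (side e True) = p (side e False)"
    and C: "C \<in> M" "C' \<in> M" and i: "inq (qd k s t) z C" "inq (qd k s t') z C'"
  shows "p C = p C'"
proof (cases "C = C'")
  case False
  then have "t \<noteq> t'" using inq_unique C i by blast
  then consider "t" "\<not> t'" | "\<not> t" "t'" by blast
  then show ?thesis
  proof cases
    case 1
    then show ?thesis using adjacent_edge[OF C False, of k s z] i p by fastforce
  next
    case 2
    then show ?thesis using adjacent_edge[OF C(2,1), of k s z] i p False by fastforce
  qed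
qed simp

text \<open>Two cells in opposite quadrants are compared through a third cell \<open>D\<close>,
  which shares one sign with each of them.\<close>

lemma interior_cells_equal:
  assumes p: "\<And>e. e \<in> interior_edges M \<Longrightarrow> p (side e True) = p (side e False)"
    and z: "z \<in> interior \<Phi>" and C: "C \<in> M" "C' \<in> M" "z \<in> C" "z \<in> C'"
  shows "p C = p C'"
proof -
  obtain q q' where q: "inq q z C" "inq q' z C'" using ex_inq C by blast
  obtain D where D: "D \<in> M" "inq (qd True (q True) (q' False)) z D" using z interior_\<Phi>_iff by blast
  have 1: "inq (qd True (q True) (q False)) z C" "inq (qd True (q' True) (q' False)) z C'"
    using q qd_surj[of q True] qd_surj[of q' True] by auto
  have "p C = p D" using quads_equal[OF p C(1) D(1) 1(1) D(2)] by blast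
  moreover have "p D = p C'"
    using quads_equal[OF p D(1) C(2), of False "q' False" "q True" z "q' True"] D(2) 1(2)
    by (simp add: qd_swap[of True])
  ultimately show ?thesis by simp
qed

lemma inner_point: "C \<in> M \<Longrightarrow> interior C \<noteq> {}"
  using T_mesh unfolding T_mesh_def by blast

text \<open>The value of \<open>p\<close> on a cell defines a locally constant function on the
  connected interior of the domain.\<close>

lemma cell_constant:
  assumes p: "\<And>e. e \<in> interior_edges M \<Longrightarrow> p (side e True) = p (side e False)"
    and C: "C \<in> M" "C' \<in> M"
  shows "p C = p C'"
proof -
  define F where "F z = p (SOME C. C \<in> M \<and> z \<in> C)" for z
  have F: "F z = p C" if "z \<in> interior \<Phi>" "C \<in> M" "z \<in> C" for z C
  proof -
    have "(SOME C. C \<in> M \<and> z \<in> C) \<in> M \<and> z \<in> (SOME C. C \<in> M \<and> z \<in> C)"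
      using that(2,3) by (rule_tac someI[of "\<lambda>C. C \<in> M \<and> z \<in> C" C]) simp
    then show ?thesis unfolding F_def using interior_cells_equal[of p z _ C] p that by blast
  qed
  have con: "connected (interior \<Phi>)" using T_mesh unfolding T_mesh_def \<Phi>_def by blast
  have "F constant_on interior \<Phi>"
  proof (rule locally_constant_imp_constant[OF con])
    fix z assume z: "z \<in> interior \<Phi>"
    obtain \<epsilon> where eps: "\<epsilon> > 0" "\<And>w C t. (\<And>k. \<bar>co k w - co k z\<bar> < \<epsilon>) \<Longrightarrow> C \<in> M \<Longrightarrow> inq t w C \<longleftrightarrow> inq (dirq t z w) z C"
      using inq_near by metis
    have "F w = F z" if w: "w \<in> interior \<Phi>" "w \<in> ball z \<epsilon>" for w
    proof -
      have near: "\<bar>co k w - co k z\<bar> < \<epsilon>" for k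
        using w(2) dist_fst_le[of w z] dist_snd_le[of w z] by (auto simp: co_def dist_real_def dist_commute)
      obtain C t where C: "C \<in> M" "inq t w C" using w(1) interior_\<Phi>_iff by blast
      then have "inq (dirq t z w) z C" using eps(2)[OF near C(1)] by blast
      then show ?thesis using F[OF w(1) C(1)] F[OF z C(1)] inq_mem C by metis
    qed
    then show "\<exists>T. openin (top_of_set (interior \<Phi>)) T \<and> z \<in> T \<and> (\<forall>x\<in>T. F x = F z)"
    proof (intro exI[of _ "interior \<Phi> \<inter> ball z \<epsilon>"] conjI ballI)
      show "openin (top_of_set (interior \<Phi>)) (interior \<Phi> \<inter> ball z \<epsilon>)" by (simp add: openin_open_Int)
      show "z \<in> interior \<Phi> \<inter> ball z \<epsilon>" using z eps(1) by simp
    qed blast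
  qed
  then obtain c where c: "\<forall>z\<in>interior \<Phi>. F z = c" unfolding constant_on_def by blast
  have "p C = c" if C: "C \<in> M" for C
  proof -
    obtain z where z: "z \<in> interior C" using inner_point[OF C] by blast
    have "interior C \<subseteq> interior \<Phi>" using C unfolding \<Phi>_def by (intro interior_mono) auto
    then have "z \<in> interior \<Phi>" "z \<in> C" using z interior_subset by blast+
    then show ?thesis using F[OF _ C] c by metis
  qed
  then show ?thesis using C by simp
qed

text \<open>With these signs the jumps of a family of pieces have zero net flow at every interior vertex.\<close>

definition dir_sign :: "bool \<Rightarrow> 'a::ab_group_add \<Rightarrow> 'a" where
  "dir_sign k x = (if k then x else - x)"

definition jump :: "((real \<times> real) set \<Rightarrow> 'a::ab_group_add) \<Rightarrow> seg \<Rightarrow> 'a" where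
  "jump p e = (if e \<in> interior_edges M then dir_sign (horizontal e) (p (side e True) - p (side e False)) else 0)"

definition netflow :: "(seg \<Rightarrow> 'a::ab_group_add) \<Rightarrow> real \<times> real \<Rightarrow> 'a" where
  "netflow f v = (\<Sum>e\<in>{e \<in> interior_edges M. snd e = v}. f e) - (\<Sum>e\<in>{e \<in> interior_edges M. fst e = v}. f e)"

section \<open>The star of an interior vertex\<close>

lemma interior_vertex_quads: "v \<in> interior_vertices M \<Longrightarrow> \<exists>C\<in>M. inq s v C"
  unfolding interior_vertices_def using interior_\<Phi>_iff unfolding \<Phi>_def by blast

lemma vertex_edge_end:
  assumes "v \<in> vertices M" "e \<in> edges M" "onq k s v e"
  shows "(if s then fst e else snd e) = v"
proof -
  have "v \<in> {fst e, snd e}" using assms onq_pts unfolding edges_def by blast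
  then show ?thesis using assms(3) by (auto simp: onq_def)
qed

text \<open>The edge leaving \<open>v\<close> in the direction \<open>k\<close>, on the positive side if \<open>s\<close>.\<close>

definition star :: "real \<times> real \<Rightarrow> bool \<Rightarrow> bool \<Rightarrow> seg set" where
  "star v k s = {e \<in> interior_edges M. dirn k e \<and> (if s then fst e else snd e) = v}"

lemma star_onq: "e \<in> star v k s \<Longrightarrow> onq k s v e"
  unfolding star_def using onq_fst[of k e] onq_snd[of k e] by (cases s) simp_all

text \<open>An edge contains no vertices other than its ends, so neither of two overlapping edges on
  a line can end inside the other.\<close>

lemma edge_unique:
  assumes e: "e \<in> edges M" "e' \<in> edges M" and on: "onq k s v e" "onq k s v e'"
  shows "e = e'"
proof -
  have dn: "dirn k e" "dirn k e'" using on unfolding onq_def by auto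
  have line: "co (\<not> k) (fst e) = co (\<not> k) v" "co (\<not> k) (snd e) = co (\<not> k) v"
    "co (\<not> k) (fst e') = co (\<not> k) v" "co (\<not> k) (snd e') = co (\<not> k) v"
    using on unfolding onq_def dirn_def by auto
  have *: "w = fst f \<or> w = snd f"
    if "f \<in> edges M" "dirn k f" "w \<in> vertices M" "co (\<not> k) w = co (\<not> k) (fst f)" "co k (fst f) \<le> co k w" "co k w \<le> co k (snd f)" for w f
  proof -
    have "w \<in> pts f \<inter> vertices M" using that dirn_pts[OF that(2)] by blast
    then show ?thesis using that(1) unfolding edges_def by blast
  qed
  have v: "fst e \<in> vertices M" "snd e \<in> vertices M" "fst e' \<in> vertices M" "snd e' \<in> vertices M"
    using e unfolding edges_def by auto
  have c: "if s then co k (fst e) \<le> co k v \<and> co k v < co k (snd e) else co k (fst e) < co k v \<and> co k v \<le> co k (snd e)"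
    "if s then co k (fst e') \<le> co k v \<and> co k v < co k (snd e') else co k (fst e') < co k v \<and> co k v \<le> co k (snd e')"
    using on unfolding onq_def by auto
  have "fst e' = fst e \<or> fst e' = snd e" if "co k (fst e) \<le> co k (fst e')"
    using *[OF e(1) dn(1) v(3)] line c that by (simp split: if_splits)
  moreover have "fst e = fst e' \<or> fst e = snd e'" if "co k (fst e') \<le> co k (fst e)"
    using *[OF e(2) dn(2) v(1)] line c that by (simp split: if_splits)
  ultimately have 1: "fst e = fst e'" using c by (cases "co k (fst e) \<le> co k (fst e')") (fastforce split: if_splits)+
  have "snd e' = fst e \<or> snd e' = snd e" if "co k (snd e') \<le> co k (snd e)"
    using *[OF e(1) dn(1) v(4)] line c that by (simp split: if_splits)
  moreover have "snd e = fst e' \<or> snd e = snd e'" if "co k (snd e) \<le> co k (snd e')"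
    using *[OF e(2) dn(2) v(2)] line c that by (simp split: if_splits)
  ultimately have "snd e = snd e'" using c by (cases "co k (snd e) \<le> co k (snd e')") (fastforce split: if_splits)+
  with 1 show ?thesis by (simp add: prod_eq_iff)
qed

lemma star_unique: "e \<in> star v k s \<Longrightarrow> e' \<in> star v k s \<Longrightarrow> e = e'"
  using edge_unique[of e e' k s v] star_onq interior_edge_edge unfolding star_def by blast

lemma star_exists:
  assumes v: "v \<in> interior_vertices M" and w: "wall k s v"
  shows "\<exists>e. star v k s = {e}"
proof -
  have vv: "v \<in> vertices M" using v by (simp add: interior_vertices_def)
  obtain C t where C: "C \<in> M" "inq (qd k s t) v C" "\<not> inq (qd k s (\<not> t)) v C" using w unfolding wall_def by blast
  obtain e where e: "e \<in> edges M" "onq k s v e" using edge_exists[OF C] by blast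
  have "e \<in> interior_edges M" using interior_edgeI[OF e] interior_vertex_quads[OF v] by blast
  then have "e \<in> star v k s" using vertex_edge_end[OF vv e] e(2) unfolding star_def onq_def by simp
  then show ?thesis using star_unique by blast
qed

lemma star_empty: "\<not> wall k s v \<Longrightarrow> star v k s = {}"
  using wall_edge star_onq interior_edge_edge unfolding star_def by blast

lemma sum_star:
  assumes "v \<in> interior_vertices M"
    and "\<And>e. e \<in> star v k s \<Longrightarrow> f e = y" and "\<not> wall k s v \<Longrightarrow> y = 0"
  shows "(\<Sum>e\<in>star v k s. f e) = y"
proof (cases "wall k s v")
  case True
  then obtain e where "star v k s = {e}" using star_exists assms(1) by blast
  then show ?thesis using assms(2)[of e] by simp
next
  case False
  then show ?thesis using assms(3) star_empty by simp
qed

lemma netflow_star: "netflow f v = (\<Sum>e\<in>star v True False. f e) + (\<Sum>e\<in>star v False False. f e)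
   - (\<Sum>e\<in>star v True True. f e) - (\<Sum>e\<in>star v False True. f e)"
proof -
  have fin: "finite (star v k s)" for k s unfolding star_def using finite_interior_edges by auto
  have disj: "star v True s \<inter> star v False s = {}" for s
    unfolding star_def using dirn_unique[of True _ False] by blast
  have "{e \<in> interior_edges M. (if s then fst e else snd e) = v} = star v True s \<union> star v False s" for s
  proof -
    have "dirn True e \<or> dirn False e" if "e \<in> interior_edges M" for e
      using edges_dirn[OF interior_edge_edge[OF that]] by (metis (full_types))
    then show ?thesis unfolding star_def by blast
  qed
  from this[of True] this[of False] have U: "{e \<in> interior_edges M. fst e = v} = star v True True \<union> star v False True"
    "{e \<in> interior_edges M. snd e = v} = star v True False \<union> star v False False" by simp_all
  show ?thesis unfolding netflow_def U sum.union_disjoint[OF fin fin disj] by (simp add: algebra_simps)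
qed

text \<open>Each quadrant at \<open>v\<close> borders two rays, and its piece enters the two jumps
  with opposite signs. A ray that is not a wall has the same cell on both sides and contributes
  0.\<close>

lemma netflow_jump:
  assumes v: "v \<in> interior_vertices M"
  shows "netflow (jump p) v = 0"
proof -
  define Q where "Q k s t = (THE C. C \<in> M \<and> inq (qd k s t) v C)" for k s t
  have Q: "Q k s t = C" if "C \<in> M" "inq (qd k s t) v C" for k s t C
    unfolding Q_def
  proof (rule the_equality)
    show "C \<in> M \<and> inq (qd k s t) v C" using that by simp
    show "C' = C" if "C' \<in> M \<and> inq (qd k s t) v C'" for C'
      using inq_unique that \<open>C \<in> M\<close> \<open>inq (qd k s t) v C\<close> by blast
  qed
  have s: "(\<Sum>e\<in>star v k s. jump p e) = dir_sign k (p (Q k s True) - p (Q k s False))" for k s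
  proof (rule sum_star[OF v])
    fix e assume e: "e \<in> star v k s"
    then have ie: "e \<in> interior_edges M" "dirn k e" unfolding star_def by auto
    have "horizontal e = k" using ie(2) dirn_iff dirn_unique by (metis (full_types))
    moreover have "Q k s t = side e t" for t
      using Q side_onq[OF ie(1) star_onq[OF e] side_in_M[OF ie(1)]] side_in_M[OF ie(1)] by blast
    ultimately show "jump p e = dir_sign k (p (Q k s True) - p (Q k s False))" using ie(1) by (simp add: jump_def)
  next
    assume nw: "\<not> wall k s v"
    obtain C where C: "C \<in> M" "inq (qd k s True) v C" using interior_vertex_quads[OF v] by blast
    then have "inq (qd k s False) v C" using nw unfolding wall_def by (metis (full_types))
    then show "dir_sign k (p (Q k s True) - p (Q k s False)) = 0" using Q C by (simp add: dir_sign_def)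
  qed
  \<comment> \<open>The same quadrant named from its horizontal and from its vertical ray; this is
    what makes the terms cancel in pairs.\<close>
  have sw: "Q False s t = Q True t s" for s t unfolding Q_def using qd_swap[of False s t] by simp
  show ?thesis unfolding netflow_star s sw by (simp add: dir_sign_def)
qed

lemma bdry_netflow: "bdry M f v = (if v \<in> interior_vertices M then netflow f v else 0)"
  by (simp add: bdry_def netflow_def)

end

section \<open>Topology of the domain\<close>

definition cx :: "real \<times> real \<Rightarrow> complex" where
  "cx z = Complex (fst z) (snd z)"

definition rx :: "complex \<Rightarrow> real \<times> real" where
  "rx c = (Re c, Im c)"

lemma cx_rx [simp]: "cx (rx c) = c" "rx (cx z) = z"
  by (auto simp: cx_def rx_def)

lemma continuous_on_cx [continuous_intros]: "continuous_on A f \<Longrightarrow> continuous_on A (\<lambda>x. cx (f x))"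
  unfolding cx_def by (auto intro: continuous_intros)

lemma continuous_on_rx [continuous_intros]: "continuous_on A f \<Longrightarrow> continuous_on A (\<lambda>x. rx (f x))"
  unfolding rx_def by (auto intro!: continuous_intros)

lemma cx_image: "cx ` S = {c. rx c \<in> S}"
  by (auto simp: image_iff) (metis cx_rx(1))

lemma open_cx: "open S \<Longrightarrow> open (cx ` S)"
  unfolding cx_image using continuous_open_preimage[of UNIV rx S] continuous_on_rx[of UNIV id]
  by (auto simp: vimage_def)

lemma homeomorphic_cx: "S homeomorphic cx ` S"
  unfolding homeomorphic_def homeomorphism_def
  by (intro exI[of _ cx] exI[of _ rx]) (auto intro!: continuous_intros simp: image_iff)

text \<open>The point \<open>m + \<i> * r * h\<close> crosses the segment from \<open>m - h\<close> to \<open>m + h\<close> at \<open>r = 0\<close>.\<close>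

lemma Ln_jump_limit:
  assumes h: "h \<noteq> (0::complex)"
  shows "((\<lambda>r. Ln ((m + \<i> * of_real r * h - (m + h)) / (m + \<i> * of_real r * h - (m - h)))) \<longlongrightarrow> \<i> * pi) (at_right 0)"
    and "((\<lambda>r. Ln ((m + \<i> * of_real r * h - (m + h)) / (m + \<i> * of_real r * h - (m - h)))) \<longlongrightarrow> - \<i> * pi) (at_left 0)"
proof -
  \<comment> \<open>The quotient is \<open>- w r\<close>, where \<open>w r\<close> runs through the
    unit circle and passes 1 at \<open>r = 0\<close>. So the principal logarithm is continuous at
    \<open>w\<close>, and the jump is the sign of \<open>Im (w r)\<close> in the formula for the
    logarithm of \<open>- w r\<close>.\<close>
  define w where "w r = (1 - \<i> * of_real r) / (1 + \<i> * of_real r)" for r :: real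
  have ne: "1 + \<i> * of_real r \<noteq> 0" "1 - \<i> * of_real r \<noteq> 0" for r :: real by (auto simp: complex_eq_iff)
  have eq: "(m + \<i> * of_real r * h - (m + h)) / (m + \<i> * of_real r * h - (m - h)) = - w r" for r :: real
  proof -
    have "(m + \<i> * of_real r * h - (m + h)) = - h * (1 - \<i> * of_real r)"
      "(m + \<i> * of_real r * h - (m - h)) = h * (1 + \<i> * of_real r)" by (auto simp: algebra_simps)
    then show ?thesis using h by (simp add: w_def)
  qed
  have Im_w: "Im (w r) = - 2 * r / (1 + r\<^sup>2)" for r
    by (simp add: w_def Im_divide power2_eq_square)
  have w0: "w r \<noteq> 0" for r using ne by (simp add: w_def)
  have tw: "((\<lambda>r. Ln (w r)) \<longlongrightarrow> 0) (at 0)"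
  proof -
    have "(w \<longlongrightarrow> (1 - \<i> * of_real 0) / (1 + \<i> * of_real 0)) (at 0)"
      unfolding w_def using ne by (intro tendsto_intros) auto
    then have "(w \<longlongrightarrow> 1) (at 0)" by simp
    then have "((\<lambda>r. Ln (w r)) \<longlongrightarrow> Ln 1) (at 0)" by (intro tendsto_Ln) auto
    then show ?thesis by simp
  qed
  have tr: "((\<lambda>r. Ln (w r)) \<longlongrightarrow> 0) (at_right 0)" "((\<lambda>r. Ln (w r)) \<longlongrightarrow> 0) (at_left 0)"
    using tw filterlim_at_split[of "\<lambda>r. Ln (w r)" "nhds 0" 0] by auto
  have pos: "1 + r\<^sup>2 > 0" for r :: real by (simp add: add_pos_nonneg)
  have r: "Ln (- w r) = Ln (w r) + \<i> * pi" if "r > 0" for r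
    using Ln_minus[OF w0] that pos[of r] unfolding Im_w by simp
  have l: "Ln (- w r) = Ln (w r) - \<i> * pi" if "r < 0" for r
  proof -
    have "2 * r / (1 + r\<^sup>2) < 0" using that pos[of r] by (simp add: divide_less_0_iff)
    then have "Im (w r) > 0" using Im_w[of r] by simp
    then show ?thesis using Ln_minus[OF w0] by simp
  qed
  have "((\<lambda>r. Ln (w r) + \<i> * pi) \<longlongrightarrow> \<i> * pi) (at_right 0)"
    using tendsto_add[OF tr(1) tendsto_const[of "\<i> * pi"]] by simp
  then have "((\<lambda>r. Ln (- w r)) \<longlongrightarrow> \<i> * pi) (at_right 0)"
    by (rule Lim_transform_eventually) (auto simp: eventually_at_right_field r intro!: exI[of _ 1])
  then show "((\<lambda>r. Ln ((m + \<i> * of_real r * h - (m + h)) / (m + \<i> * of_real r * h - (m - h)))) \<longlongrightarrow> \<i> * pi) (at_right 0)"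
    unfolding eq .
  have "((\<lambda>r. Ln (w r) - \<i> * pi) \<longlongrightarrow> - \<i> * pi) (at_left 0)"
    using tendsto_diff[OF tr(2) tendsto_const[of "\<i> * pi"]] by simp
  then have "((\<lambda>r. Ln (- w r)) \<longlongrightarrow> - \<i> * pi) (at_left 0)"
    by (rule Lim_transform_eventually) (auto simp: eventually_at_left_field l intro!: exI[of _ "-1"])
  then show "((\<lambda>r. Ln ((m + \<i> * of_real r * h - (m + h)) / (m + \<i> * of_real r * h - (m - h)))) \<longlongrightarrow> - \<i> * pi) (at_left 0)"
    unfolding eq .
qed

text \<open>A nonpositive quotient makes \<open>z\<close> a convex combination of \<open>a\<close>
  and \<open>b\<close>. Hence the principal logarithm of the quotient is cut only along the
  segment.\<close>

lemma segment_quotient: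
  fixes z a b :: complex
  assumes "z \<notin> closed_segment a b"
  shows "(z - b) / (z - a) \<notin> \<real>\<^sub>\<le>\<^sub>0"
proof
  assume "(z - b) / (z - a) \<in> \<real>\<^sub>\<le>\<^sub>0"
  then obtain t where t: "(z - b) / (z - a) = - of_real t" "t \<ge> 0"
    by (auto simp: complex_nonpos_Reals_iff complex_eq_iff intro!: that[of "- Re ((z - b) / (z - a))"])
  have ne: "z \<noteq> a" using assms by auto
  then have "z - b = - of_real t * (z - a)" using t by (simp add: field_simps)
  then have e: "of_real (1 + t) * z = b + of_real t * a" by (simp add: algebra_simps)
  have "z = (1 - 1 / (1 + t)) *\<^sub>R a + (1 / (1 + t)) *\<^sub>R b"
  proof -
    have 1: "1 - 1 / (1 + t) = t / (1 + t)" using t(2) by (simp add: field_simps)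
    have "(1 + t) *\<^sub>R z = t *\<^sub>R a + b" using e by (simp add: scaleR_conv_of_real algebra_simps)
    then have "(1 / (1 + t)) *\<^sub>R (1 + t) *\<^sub>R z = (1 / (1 + t)) *\<^sub>R (t *\<^sub>R a + b)" by simp
    then show ?thesis using t(2) unfolding 1 by (simp add: scaleR_add_right)
  qed
  then have "z \<in> closed_segment a b"
    unfolding in_segment using t(2) by (intro exI[of _ "1 / (1 + t)"]) auto
  then show False using assms by blast
qed

lemma Ln_quotient_derivative:
  assumes "z \<notin> closed_segment a b"
  shows "((\<lambda>z. Ln ((z - b) / (z - a))) has_field_derivative 1 / (z - b) - 1 / (z - a)) (at z within A)"
proof -
  have ne: "z \<noteq> a" "z \<noteq> b" using assms by auto
  have "((\<lambda>z. Ln ((z - b) / (z - a))) has_field_derivative inverse ((z - b) / (z - a)) * ((1 * (z - a) - (z - b) * 1) / ((z - a) * (z - a)))) (at z within A)"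
    using segment_quotient[OF assms] ne by (auto intro!: derivative_eq_intros)
  moreover have "inverse ((z - b) / (z - a)) * ((1 * (z - a) - (z - b) * 1) / ((z - a) * (z - a))) = 1 / (z - b) - 1 / (z - a)"
    using ne by (simp add: divide_simps)
  ultimately show ?thesis by simp
qed

text \<open>The values are integer multiples of 2 pi i, so distinct ones are at least 2 pi
  apart.\<close>

lemma log_constant_on:
  fixes f :: "real \<times> real \<Rightarrow> complex"
  assumes "connected S" "continuous_on S f" "\<And>x. x \<in> S \<Longrightarrow> exp (f x) = 1"
  shows "f constant_on S"
proof (rule continuous_discrete_range_constant[OF assms(1,2)])
  fix x assume x: "x \<in> S"
  have "2 * pi \<le> norm (f y - f x)" if y: "y \<in> S" "f y \<noteq> f x" for y
  proof -
    obtain n m :: int where nm: "Re (f x) = 0" "Re (f y) = 0" "Im (f x) = of_int (2 * n) * pi" "Im (f y) = of_int (2 * m) * pi"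
      using assms(3)[OF x] assms(3)[OF y(1)] unfolding exp_eq_1 by blast
    then have "n \<noteq> m" using y(2) by (auto simp: complex_eq_iff)
    then have "1 \<le> \<bar>of_int (m - n) :: real\<bar>" by linarith
    then have "2 * pi \<le> \<bar>Im (f y - f x)\<bar>" using nm by (simp add: left_diff_distrib[symmetric] abs_mult)
    then show ?thesis using abs_Im_le_cmod order.trans by blast
  qed
  then show "\<exists>e>0. \<forall>y. y \<in> S \<and> f y \<noteq> f x \<longrightarrow> e \<le> norm (f y - f x)"
    by (intro exI[of _ "2 * pi"]) auto
qed

section \<open>Simple connectedness of the interior and absence of pinch points\<close>

context tmesh
begin

text \<open>For open connected sets, winding numbers decide. They vanish around points outside the
  closed domain, and around boundary points by continuity.\<close>

lemma simply_connected_interior: "simply_connected (cx ` interior \<Phi>)"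
proof -
  have op: "open (cx ` interior \<Phi>)" by (rule open_cx) simp
  have con: "connected (cx ` interior \<Phi>)"
    using T_mesh unfolding T_mesh_def \<Phi>_def by (intro connected_continuous_image continuous_on_cx continuous_on_id) auto
  have sc: "simply_connected (cx ` \<Phi>)"
    using T_mesh homeomorphic_simply_connected[OF homeomorphic_cx] unfolding T_mesh_def \<Phi>_def by blast
  have "winding_number g z = 0" if g: "path g" "path_image g \<subseteq> cx ` interior \<Phi>" "pathfinish g = pathstart g" "z \<notin> cx ` interior \<Phi>" for g z
  proof -
    have sub: "path_image g \<subseteq> cx ` \<Phi>" using g(2) interior_subset by blast
    have out: "winding_number g w = 0" if "w \<notin> cx ` \<Phi>" for w
      using simply_connected_imp_winding_number_zero[OF sc g(1) sub g(3) that] .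
    \<comment> \<open>A point outside the interior is a limit of points outside the domain.\<close>
    have zc: "rx z \<in> closure (- \<Phi>)" using g(4) unfolding cx_image closure_complement by simp
    then obtain x where x: "\<And>n. x n \<in> - \<Phi>" "x \<longlonglongrightarrow> rx z" unfolding closure_sequential by blast
    have "(\<lambda>n. cx (x n)) \<longlonglongrightarrow> cx (rx z)"
      using continuous_on_tendsto_compose[OF continuous_on_cx[OF continuous_on_id, of UNIV] x(2)] by simp
    moreover have "isCont (winding_number g) z"
      using continuous_at_winding_number[OF g(1)] g(2,4) by blast
    ultimately have "(\<lambda>n. winding_number g (cx (x n))) \<longlonglongrightarrow> winding_number g z"
      using isCont_tendsto_compose[of z "winding_number g" "\<lambda>n. cx (x n)"] by simp
    moreover have "winding_number g (cx (x n)) = 0" for n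
      using out[of "cx (x n)"] x(1)[of n] unfolding cx_image by simp
    ultimately show ?thesis using LIMSEQ_unique[of "\<lambda>_. 0" "winding_number g z" 0] by simp
  qed
  then show ?thesis using simply_connected_eq_winding_number_zero[OF op] con by blast
qed

lemma holomorphic_log_interior:
  assumes "v \<notin> interior \<Phi>"
  shows "\<exists>g. \<forall>z\<in>cx ` interior \<Phi>. (g has_field_derivative 1 / (z - cx v)) (at z)"
proof -
  have op: "open (cx ` interior \<Phi>)" by (rule open_cx) simp
  have nz: "z - cx v \<noteq> 0" if "z \<in> cx ` interior \<Phi>" for z
    using that assms unfolding cx_image by auto
  have "(\<lambda>z. 1 / (z - cx v)) holomorphic_on cx ` interior \<Phi>"
    using nz by (intro holomorphic_intros) auto
  then show ?thesis using simply_connected_eq_global_primitive[OF op] simply_connected_interior by blast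
qed

lemma quad_interior:
  assumes eps: "\<And>w C t. (\<And>k. \<bar>co k w - co k z\<bar> < \<epsilon>) \<Longrightarrow> C \<in> M \<Longrightarrow> inq t w C \<longleftrightarrow> inq (dirq t z w) z C"
    and C: "C \<in> M" "inq s z C"
    and w: "\<And>k. \<bar>co k w - co k z\<bar> < \<epsilon>" "\<And>k. if s k then co k z < co k w else co k w < co k z"
  shows "w \<in> interior C"
proof -
  have dq: "dirq t z w = s" for t
  proof
    fix k show "dirq t z w k = s k" using w(2)[of k] by (auto simp: dirq_def split: if_splits)
  qed
  have "inq t w C" for t using eps[OF w(1) C(1)] dq C(2) by simp
  from this[of "\<lambda>_. True"] this[of "\<lambda>_. False"] show ?thesis
    unfolding mem_interior_cell[OF C(1)] inq_def by simp
qed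

text \<open>If both neighbours of two opposite filled quadrants were empty, a short segment through
  them would meet the domain only in \<open>z\<close>. The quotient \<open>H\<close> with zero and
  pole at its ends has a continuous logarithm \<open>g\<close> on the domain, which differs from the
  principal one by a constant on the connected interior. But the principal logarithm jumps by 2 pi i
  across \<open>z\<close>, while \<open>g\<close> is continuous there.\<close>

lemma no_pinch:
  assumes C: "C \<in> M" "inq q z C" and C': "C' \<in> M" "inq (\<lambda>k. \<not> q k) z C'"
  shows "\<exists>k. \<exists>D\<in>M. inq (q(k := \<not> q k)) z D"
proof (rule ccontr)
  assume neg: "\<not> ?thesis"
  obtain \<epsilon> where eps: "\<epsilon> > 0" "\<And>w C t. (\<And>k. \<bar>co k w - co k z\<bar> < \<epsilon>) \<Longrightarrow> C \<in> M \<Longrightarrow> inq t w C \<longleftrightarrow> inq (dirq t z w) z C"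
    using inq_near by metis
  \<comment> \<open>\<open>u\<close> points into the quadrant \<open>q\<close>, and \<open>h\<close>
    is a multiple of \<open>u\<close> turned by a right angle. So the segment from
    \<open>m - h\<close> to \<open>m + h\<close> runs through the empty quadrants, and the path
    crossing it at \<open>m\<close> runs through the filled ones.\<close>
  define u where "u = Complex (if q True then 1 else - 1) (if q False then 1 else - 1)"
  have u0: "u \<noteq> 0" by (simp add: u_def complex_eq_iff)
  define h where "h = - \<i> * of_real (\<epsilon> / 2) * u"
  have h0: "h \<noteq> 0" using u0 eps(1) by (simp add: h_def)
  define m where "m = cx z"
  have quad: "inq s z D" if D: "D \<in> M" "w \<in> D" "\<And>k. \<bar>co k w - co k z\<bar> < \<epsilon>" "\<And>k. (if s k then co k z < co k w else co k w < co k z)" for w s D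
  proof -
    obtain t where t: "inq t w D" using ex_inq[OF D(1,2)] by blast
    have "dirq t z w = s"
    proof
      fix k show "dirq t z w k = s k" using D(4)[of k] by (auto simp: dirq_def split: if_splits)
    qed
    then show ?thesis using eps(2)[OF D(3,1)] t by metis
  qed
  have only: "w = z" if w: "w \<in> \<Phi>" "cx w \<in> closed_segment (m - h) (m + h)" for w
  proof (rule ccontr)
    assume ne: "w \<noteq> z"
    obtain x where x: "cx w = (1 - x) *\<^sub>R (m - h) + x *\<^sub>R (m + h)" "0 \<le> x" "x \<le> 1" using w(2) unfolding in_segment by blast
    define y where "y = (2 * x - 1) * (\<epsilon> / 2)"
    have "cx w = m + of_real (2 * x - 1) * h" unfolding x(1) by (simp add: scaleR_conv_of_real algebra_simps)
    moreover have "of_real (2 * x - 1) * h = - \<i> * of_real y * u" by (simp only: h_def y_def of_real_mult mult_ac)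
    ultimately have cw: "cx w = m - \<i> * of_real y * u" by simp
    have "\<bar>2 * x - 1\<bar> * (\<epsilon> / 2) \<le> 1 * (\<epsilon> / 2)" using x(2,3) eps(1) by (intro mult_right_mono) auto
    then have yb: "\<bar>y\<bar> < \<epsilon>" using eps(1) by (simp add: y_def abs_mult)
    have f: "fst w = fst z + (if q False then y else - y)" "snd w = snd z - (if q True then y else - y)"
      using arg_cong[OF cw, of Re] arg_cong[OF cw, of Im] by (auto simp: cx_def m_def u_def)
    have y0: "y \<noteq> 0" using ne f by (auto simp: prod_eq_iff split: if_splits)
    define s where "s k = (if k then (q False \<longleftrightarrow> y > 0) else (q True \<longleftrightarrow> y < 0))" for k
    obtain D where D: "D \<in> M" "w \<in> D" using w(1) unfolding \<Phi>_def by blast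
    have 1: "\<bar>co k w - co k z\<bar> < \<epsilon>" for k using f yb by (cases k) (auto simp: co_def)
    have 2: "if s k then co k z < co k w else co k w < co k z" for k
      using f y0 by (cases k) (auto simp: co_def s_def)
    have "inq s z D" using quad[OF D 1 2] .
    moreover have "s = q(True := \<not> q True) \<or> s = q(False := \<not> q False)"
    proof -
      have ext2: "f = g \<longleftrightarrow> f True = g True \<and> f False = g False" for f g :: "bool \<Rightarrow> bool"
        unfolding fun_eq_iff using all_co[of "\<lambda>k. f k = g k" True] by simp
      show ?thesis using y0 unfolding ext2 by (auto simp: s_def)
    qed
    ultimately show False using neg D(1) by metis
  qed
  define H where "H w = (cx w - (m + h)) / (cx w - (m - h))" for w
  have Hnz: "cx w \<noteq> m - h \<and> cx w \<noteq> m + h" if "w \<in> \<Phi>" for w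
  proof -
    have "cx w \<noteq> c" if "c = m - h \<or> c = m + h" for c
    proof
      assume "cx w = c"
      then have "cx w \<in> closed_segment (m - h) (m + h)" using that by auto
      then have "w = z" using only \<open>w \<in> \<Phi>\<close> by blast
      then show False using \<open>cx w = c\<close> that h0 by (auto simp: m_def)
    qed
    then show ?thesis by blast
  qed
  have cH: "continuous_on S H" if "S \<subseteq> \<Phi>" for S
    unfolding H_def using Hnz that by (intro continuous_intros) auto
  \<comment> \<open>A finite union of closed convex cells is an ANR, hence locally path connected;
    simple connectedness then gives continuous logarithms of nonvanishing continuous
    functions.\<close>
  obtain g where g: "continuous_on \<Phi> g" "\<And>w. w \<in> \<Phi> \<Longrightarrow> H w = exp (g w)"
  proof -
    have "ANR \<Phi>" unfolding \<Phi>_def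
      using finite_M closed_cell cell_box by (intro ANR_finite_Union_convex_closed) (auto, metis convex_box(1))
    then have "Borsukian \<Phi>"
      using T_mesh unfolding T_mesh_def \<Phi>_def by (intro simply_connected_imp_Borsukian ANR_imp_locally_path_connected) auto
    moreover have "H \<in> \<Phi> \<rightarrow> - {0}" using Hnz by (auto simp: H_def)
    ultimately show ?thesis using that cH[of \<Phi>] unfolding Borsukian_continuous_logarithm by blast
  qed
  have zi: "z \<notin> interior \<Phi>" using neg unfolding interior_\<Phi>_iff by blast
  \<comment> \<open>\<open>z\<close> is not an interior point, so the interior misses the segment
    altogether and \<open>H\<close> avoids the branch cut there.\<close>
  have "(\<lambda>w. g w - Ln (H w)) constant_on interior \<Phi>"
  proof (rule log_constant_on)
    show "connected (interior \<Phi>)" using T_mesh unfolding T_mesh_def \<Phi>_def by blast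
    have "H w \<notin> \<real>\<^sub>\<le>\<^sub>0" if w: "w \<in> interior \<Phi>" for w
      unfolding H_def using only[of w] w zi interior_subset by (intro segment_quotient) blast
    then show "continuous_on (interior \<Phi>) (\<lambda>w. g w - Ln (H w))"
      using g(1) interior_subset continuous_on_subset cH by (intro continuous_intros) blast+
    show "exp (g w - Ln (H w)) = 1" if w: "w \<in> interior \<Phi>" for w
    proof -
      have "w \<in> \<Phi>" using w interior_subset by blast
      then have "H w = exp (g w)" "H w \<noteq> 0" using g(2) by auto
      then show ?thesis by (simp add: exp_diff)
    qed
  qed
  then obtain c where c: "\<And>w. w \<in> interior \<Phi> \<Longrightarrow> g w - Ln (H w) = c" unfolding constant_on_def by blast
  define \<gamma> where "\<gamma> r = rx (m + \<i> * of_real r * h)" for r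
  have g_eq: "\<gamma> r = rx (m + of_real (r * \<epsilon> / 2) * u)" for r by (simp add: \<gamma>_def h_def algebra_simps)
  have cog: "co k (\<gamma> r) = co k z + (if q k then r * \<epsilon> / 2 else - (r * \<epsilon> / 2))" for k r
    unfolding g_eq by (cases k) (auto simp: co_def rx_def u_def m_def cx_def)
  have small: "\<bar>co k (\<gamma> r) - co k z\<bar> < \<epsilon>" if "\<bar>r\<bar> < 1" for k r
  proof -
    have "\<bar>r\<bar> * (\<epsilon> / 2) \<le> 1 * (\<epsilon> / 2)" using that eps(1) by (intro mult_right_mono) auto
    then show ?thesis using eps(1) unfolding cog by (simp add: abs_mult)
  qed
  have int: "w \<in> interior \<Phi>" if "D \<in> M" "inq s z D" "\<And>k. \<bar>co k w - co k z\<bar> < \<epsilon>" "\<And>k. if s k then co k z < co k w else co k w < co k z" for w s D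
    using quad_interior[OF eps(2) that] that(1) interior_mono[of D \<Phi>] unfolding \<Phi>_def by blast
  have int_pos: "\<gamma> r \<in> interior \<Phi>" if "0 < r" "r < 1" for r
    using that eps(1) by (intro int[OF C small]) (auto simp: cog)
  have int_neg: "\<gamma> r \<in> interior \<Phi>" if "-1 < r" "r < 0" for r
    using that eps(1) by (intro int[OF C' small]) (auto simp: cog mult_neg_pos)
  have ev: "eventually (\<lambda>r. \<gamma> r \<in> interior \<Phi>) (at_right 0)" "eventually (\<lambda>r. \<gamma> r \<in> interior \<Phi>) (at_left 0)"
    unfolding eventually_at_right_field eventually_at_left_field
    using int_pos zero_less_one neg_less_0_iff_less[of "1 :: real"] int_neg by blast+
  have zm: "z \<in> \<Phi>" using inq_mem C unfolding \<Phi>_def by blast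
  have gam: "(\<gamma> \<longlongrightarrow> z) (at 0 within A)" for A
  proof -
    have "continuous_on UNIV \<gamma>" unfolding \<gamma>_def by (intro continuous_intros)
    then have "(\<gamma> \<longlongrightarrow> \<gamma> 0) (at 0)" by (simp add: continuous_on_def)
    moreover have "\<gamma> 0 = z" by (simp add: \<gamma>_def m_def)
    ultimately show ?thesis using tendsto_within_subset by fastforce
  qed
  have gg: "((\<lambda>r. g (\<gamma> r)) \<longlongrightarrow> g z) (at 0 within A)" if "eventually (\<lambda>r. \<gamma> r \<in> interior \<Phi>) (at 0 within A)" for A
    by (rule continuous_on_tendsto_compose[OF g(1) gam zm], rule eventually_mono[OF that])
      (use interior_subset in blast)
  have HL: "Ln (H (\<gamma> r)) = Ln ((m + \<i> * of_real r * h - (m + h)) / (m + \<i> * of_real r * h - (m - h)))" for r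
    by (simp add: H_def \<gamma>_def)
  have "((\<lambda>r. g (\<gamma> r) - Ln (H (\<gamma> r))) \<longlongrightarrow> g z - \<i> * pi) (at_right 0)"
    unfolding HL by (intro tendsto_intros Ln_jump_limit(1)[OF h0] gg ev)
  moreover have "((\<lambda>r. g (\<gamma> r) - Ln (H (\<gamma> r))) \<longlongrightarrow> c) (at_right 0)"
    by (rule tendsto_eventually, rule eventually_mono[OF ev(1)]) (rule c)
  ultimately have "g z - \<i> * pi = c" using tendsto_unique trivial_limit_at_right_real by blast
  moreover have "((\<lambda>r. g (\<gamma> r) - Ln (H (\<gamma> r))) \<longlongrightarrow> g z - (- \<i> * pi)) (at_left 0)"
    unfolding HL by (intro tendsto_diff Ln_jump_limit(2)[OF h0] gg ev)
  moreover have "((\<lambda>r. g (\<gamma> r) - Ln (H (\<gamma> r))) \<longlongrightarrow> c) (at_left 0)"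
    by (rule tendsto_eventually, rule eventually_mono[OF ev(2)]) (rule c)
  ultimately have "g z - \<i> * pi = g z - (- \<i> * pi)" using tendsto_unique trivial_limit_at_left_real by metis
  then show False by (simp add: complex_eq_iff)
qed

text \<open>Covers boundary points as well: neighbouring quadrants are separated by an edge through
  \<open>z\<close>, and for opposite ones \<open>no_pinch\<close> provides an intermediate cell. A
  general equivalence \<open>P\<close> is allowed because agreement of derivatives holds only at the
  given point.\<close>

lemma local_cells_equal:
  assumes p: "\<And>e. e \<in> interior_edges M \<Longrightarrow> z \<in> pts e \<Longrightarrow> P (side e True) (side e False)"
    and P: "equivp P" and C: "C \<in> M" "C' \<in> M" "z \<in> C" "z \<in> C'"
  shows "P C C'"
proof -
  have adj: "P D D'" if DD: "D \<in> M" "D' \<in> M" "inq (qd k s t) z D" "inq (qd k s t') z D'" for D D' k s t t'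
  proof (cases "D = D'")
    case False
    then have "t \<noteq> t'" using inq_unique DD by blast
    then consider "t" "\<not> t'" | "\<not> t" "t'" by blast
    then show ?thesis
    proof cases
      case 1
      then have "inq (qd k s True) z D" "inq (qd k s False) z D'" using DD by auto
      then obtain e where "e \<in> interior_edges M" "onq k s z e" "side e True = D" "side e False = D'"
        using adjacent_edge[OF DD(1,2) False] by blast
      then show ?thesis using p[of e] onq_pts by blast
    next
      case 2
      then have "inq (qd k s True) z D'" "inq (qd k s False) z D" using DD by auto
      then obtain e where "e \<in> interior_edges M" "onq k s z e" "side e True = D'" "side e False = D"
        using adjacent_edge[OF DD(2,1) False[symmetric]] by blast
      then show ?thesis using p[of e] onq_pts equivp_symp[OF P] by blast
    qed
  qed (use P in \<open>simp add: equivp_reflp\<close>)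
  obtain q q' where q: "inq q z C" "inq q' z C'" using ex_inq C by blast
  have adj1: "P D D'" if "D \<in> M" "D' \<in> M" "inq r z D" "inq r' z D'" "r i = r' i" for D D' r r' i
    using adj[OF that(1,2), of i "r i" "r (\<not> i)" "r' (\<not> i)"] that(3-5) qd_surj[of r i] qd_surj[of r' i] by simp
  show ?thesis
  proof (cases "q True = q' True \<or> q False = q' False")
    case True
    then show ?thesis using adj1[OF C(1,2) q] by blast
  next
    case False
    then have "q' = (\<lambda>k. \<not> q k)"
      unfolding fun_eq_iff using all_co[of "\<lambda>k. q' k = (\<not> q k)" True] by auto
    then obtain k D where D: "D \<in> M" "inq (q(k := \<not> q k)) z D" using no_pinch[OF C(1) q(1) C(2)] q(2) by blast
    have "P C D" using adj1[OF C(1) D(1) q(1) D(2), of "\<not> k"] by simp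
    moreover have "P D C'" using adj1[OF D(1) C(2) D(2) q(2), of k] \<open>q' = (\<lambda>k. \<not> q k)\<close> by simp
    ultimately show ?thesis using P by (metis equivp_transp)
  qed
qed

text \<open>Summation by parts, grouping the edges by their endpoints.\<close>

lemma sum_netflow:
  fixes f :: "seg \<Rightarrow> real" and G :: "real \<times> real \<Rightarrow> complex"
  shows "(\<Sum>e\<in>interior_edges M. of_real (f e) * (G (snd e) - G (fst e))) = (\<Sum>v\<in>vertices M. of_real (netflow f v) * G v)"
proof -
  have "(\<Sum>e\<in>interior_edges M. of_real (f e) * G (h e)) = (\<Sum>v\<in>vertices M. of_real (\<Sum>e\<in>{e \<in> interior_edges M. h e = v}. f e) * G v)"
    if "h ` interior_edges M \<subseteq> vertices M" for h
  proof -
    have "(\<Sum>e\<in>interior_edges M. of_real (f e) * G (h e)) =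
      (\<Sum>v\<in>vertices M. \<Sum>e\<in>{e \<in> interior_edges M. h e = v}. of_real (f e) * G (h e))"
      by (rule sum.group[OF finite_interior_edges finite_vertices that, symmetric])
    also have "\<dots> = (\<Sum>v\<in>vertices M. of_real (\<Sum>e\<in>{e \<in> interior_edges M. h e = v}. f e) * G v)"
      by (intro sum.cong) (auto simp: sum_distrib_right)
    finally show ?thesis .
  qed
  note * = this
  have "snd ` interior_edges M \<subseteq> vertices M" "fst ` interior_edges M \<subseteq> vertices M"
    unfolding interior_edges_def edges_def by blast+
  then show ?thesis using *[of snd] *[of fst]
    by (simp add: netflow_def right_diff_distrib left_diff_distrib sum_subtractf)
qed

section \<open>Exactness of closed cochains by logarithms along edges\<close>

lemma linear_cx: "linear cx"
  by (auto simp: linear_iff cx_def complex_eq_iff)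

lemma mem_segment_cx: "cx z \<in> closed_segment (cx a) (cx b) \<longleftrightarrow> z \<in> closed_segment a b"
  unfolding closed_segment_linear_image[OF linear_cx] by (auto simp: image_iff) (metis cx_rx(2))

lemma interior_cell_no_edge:
  assumes "C \<in> M" "z \<in> interior C" "e \<in> edges M"
  shows "z \<notin> pts e"
proof
  assume "z \<in> pts e"
  then obtain C' where C': "C' \<in> M" "z \<in> frontier C'" using assms(3) unfolding edges_def by blast
  then have "z \<in> C'" using frontier_cell by blast
  then obtain t where t: "inq t z C'" using ex_inq C' by blast
  have "inq t z C" using assms(2) unfolding mem_interior_cell[OF assms(1)] inq_def by (simp add: less_imp_le)
  then have "C = C'" using inq_unique assms(1) C'(1) t by blast
  then show False using assms(2) C'(2) by (simp add: frontier_def)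
qed

lemma inner_edge_point:
  assumes e: "e \<in> interior_edges M" "dirn k e" and z: "z \<in> open_segment (fst e) (snd e)"
    and e': "e' \<in> edges M" "z \<in> pts e'"
  shows "e' = e"
proof -
  have ee: "e \<in> edges M" using e(1) interior_edge_edge by blast
  have "z \<in> pts e" "z \<noteq> fst e" "z \<noteq> snd e" using z unfolding open_segment_def pts_def by auto
  then have "z \<notin> vertices M" using ee unfolding edges_def by blast
  obtain k' where k': "dirn k' e'" using edges_dirn[OF e'(1)] by blast
  have "z \<noteq> fst e'" "z \<noteq> snd e'" using \<open>z \<notin> vertices M\<close> e'(1) unfolding edges_def by auto
  then have "z \<in> open_segment (fst e') (snd e')" using e'(2) unfolding open_segment_def pts_def by simp
  then have on': "onq k' s z e'" for s using k' unfolding dirn_open_segment[OF k'] onq_def by auto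
  have on: "onq k s z e" for s using z e(2) unfolding dirn_open_segment[OF e(2)] onq_def by auto
  show ?thesis
  proof (cases "k' = k")
    case True
    then show ?thesis using edge_unique[OF e'(1) ee] on on' by blast
  next
    case False
    then have k'k: "k' = (\<not> k)" by auto
    \<comment> \<open>A perpendicular edge at \<open>z\<close> would separate the two upper
      quadrants, yet both are filled by the single cell \<open>side e True\<close>.\<close>
    obtain C t where C: "C \<in> M" "inq (qd (\<not> k) True t) z C" "\<not> inq (qd (\<not> k) True (\<not> t)) z C"
      using wall_edge[OF e'(1) on', of True] k'k unfolding wall_def by blast
    have "C = side e True" using side_onq[OF e(1) on[of t] C(1), of True] C(2) qd_swap[of k t True] by simp
    then have "inq (qd (\<not> k) True (\<not> t)) z C"
      using side_onq[OF e(1) on[of "\<not> t"] C(1), of True] qd_swap[of k "\<not> t" True] by simp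
    then show ?thesis using C(3) by blast
  qed
qed

text \<open>Every closed 1-cochain is exact: the multivalued harmonic function whose differential has poles
  with residues \<open>netflow f v\<close> at the vertices \<open>v\<close> outside the interior of the domain becomes locally constant
  after subtracting holomorphic logarithms of \<open>z - v\<close>, which exist by simple connectedness.\<close>

lemma potential:
  fixes f :: "seg \<Rightarrow> real"
  assumes f: "\<And>v. v \<in> interior_vertices M \<Longrightarrow> netflow f v = 0"
  obtains p :: "(real \<times> real) set \<Rightarrow> real" where "\<And>e. e \<in> interior_edges M \<Longrightarrow> jump p e = f e"
proof -
  define N where "N = vertices M - interior_vertices M"
  have "v \<notin> interior \<Phi>" if "v \<in> N" for v using that unfolding N_def interior_vertices_def \<Phi>_def by blast
  then have "\<forall>v\<in>N. \<exists>g. \<forall>z\<in>cx ` interior \<Phi>. (g has_field_derivative 1 / (z - cx v)) (at z)"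
    using holomorphic_log_interior by blast
  then obtain L where L: "\<And>v z. v \<in> N \<Longrightarrow> z \<in> cx ` interior \<Phi> \<Longrightarrow> (L v has_field_derivative 1 / (z - cx v)) (at z)"
    by metis
  define De where "De e z = Ln ((z - cx (snd e)) / (z - cx (fst e)))" for e z
  have De: "(De e has_field_derivative 1 / (cx z - cx (snd e)) - 1 / (cx z - cx (fst e))) (at (cx z))" if "z \<notin> pts e" for z e
    unfolding De_def using that by (intro Ln_quotient_derivative) (simp add: mem_segment_cx pts_def)
  \<comment> \<open>The first sum has a cut along each edge with jump proportional to
    \<open>f e\<close>; the second removes the poles of its derivative at vertices outside the
    interior.\<close>
  define S where "S z = (\<Sum>e\<in>interior_edges M. of_real (f e) * De e z) - (\<Sum>v\<in>N. of_real (netflow f v) * L v z)" for z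
  have const: "\<exists>c. \<forall>z\<in>cx ` interior C. S z = c" if C: "C \<in> M" for C
  proof (rule has_field_derivative_zero_constant)
    show "convex (cx ` interior C)"
      using cell_box[OF C] linear_cx by (metis convex_box(1) convex_interior convex_linear_image)
    fix z assume "z \<in> cx ` interior C"
    then obtain w where w: "w \<in> interior C" "z = cx w" by blast
    have wi: "z \<in> cx ` interior \<Phi>" using w C interior_mono[of C \<Phi>] unfolding \<Phi>_def by blast
    have wp: "w \<notin> pts e" if "e \<in> interior_edges M" for e
      using interior_cell_no_edge[OF C w(1)] that interior_edge_edge by blast
    have "(S has_field_derivative (\<Sum>e\<in>interior_edges M. of_real (f e) * (1 / (cx w - cx (snd e)) - 1 / (cx w - cx (fst e))))
       - (\<Sum>v\<in>N. of_real (netflow f v) * (1 / (cx w - cx v)))) (at z)"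
      unfolding S_def w(2) using wi w(2)
      by (intro DERIV_diff DERIV_sum DERIV_cmult De wp L) auto
    moreover have "(\<Sum>e\<in>interior_edges M. of_real (f e) * (1 / (cx w - cx (snd e)) - 1 / (cx w - cx (fst e))))
       = (\<Sum>v\<in>vertices M. of_real (netflow f v) * (1 / (cx w - cx v)))"
      by (rule sum_netflow)
    \<comment> \<open>By assumption the residues at interior vertices vanish; the remaining ones are
      exactly those carried by the functions \<open>L v\<close>.\<close>
    moreover have "(\<Sum>v\<in>vertices M. of_real (netflow f v) * (1 / (cx w - cx v))) = (\<Sum>v\<in>N. of_real (netflow f v) * (1 / (cx w - cx v)))"
      using f finite_vertices by (intro sum.mono_neutral_right) (auto simp: N_def)
    ultimately show "(S has_field_derivative 0) (at z within cx ` interior C)"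
      using has_field_derivative_at_within by fastforce
  qed
  then obtain c where c: "\<And>C z. C \<in> M \<Longrightarrow> z \<in> interior C \<Longrightarrow> S (cx z) = c C" by (metis imageI)
  \<comment> \<open>Across an edge \<open>e\<close> the constants \<open>c\<close> differ by 2 pi i
    \<open>f e\<close>, whence the normalisation.\<close>
  define p where "p C = Im (c C) / (2 * pi)" for C
  have "jump p e = f e" if e: "e \<in> interior_edges M" for e
  proof -
    obtain k where k: "dirn k e" using e edges_dirn interior_edge_edge by blast
    define H where "H = (co k (snd e) - co k (fst e)) / 2"
    have H: "H > 0" using k by (simp add: H_def dirn_def)
    define h where "h = (cx (snd e) - cx (fst e)) / 2"
    define m where "m = (cx (snd e) + cx (fst e)) / 2"
    have ab: "cx (snd e) = m + h" "cx (fst e) = m - h" by (simp_all add: m_def h_def field_simps)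
    have h0: "h \<noteq> 0" using dirn_ends[OF k] by (auto simp: h_def cx_def complex_eq_iff prod_eq_iff)
    define \<gamma> where "\<gamma> r = rx (m + \<i> * of_real r * h)" for r
    have cog: "co k (\<gamma> r) = (co k (snd e) + co k (fst e)) / 2"
      "co (\<not> k) (\<gamma> r) = co (\<not> k) (fst e) + (if k then r * H else - (r * H))" for r
      using k by (cases k; simp add: \<gamma>_def rx_def co_def m_def h_def H_def cx_def dirn_def)+
    have mo: "rx m \<in> open_segment (fst e) (snd e)"
      using cog[of 0] k unfolding dirn_open_segment[OF k] by (simp add: \<gamma>_def dirn_def)
    \<comment> \<open>Multiplication by i turns left: \<open>r > 0\<close> is the upper side of a
      horizontal edge, but the side of smaller x of a vertical one. This is the origin of
      \<open>dir_sign\<close> in \<open>jump\<close>.\<close>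
    have inC: "\<gamma> r \<in> interior (side e t)"
      if "r \<noteq> 0" "\<bar>r\<bar> * H < hi (\<not> k) (side e t) - lo (\<not> k) (side e t)" "t \<longleftrightarrow> (k \<longleftrightarrow> r > 0)" for r t
    proof -
      have s: "sidep k e t (side e t)" using side_sidep[OF e k] .
      then have "side e t \<in> M" by (simp add: sidep_def)
      moreover have "r > 0 \<and> r * H > 0 \<and> \<bar>r\<bar> * H = r * H \<or> r < 0 \<and> r * H < 0 \<and> \<bar>r\<bar> * H = - (r * H)"
        using H that(1) by (cases "r > 0") (auto simp: mult_neg_pos)
      ultimately show ?thesis
        using s that k unfolding mem_interior_cell[OF \<open>side e t \<in> M\<close>] all_co[of _ k] sidep_def dirn_def cog
        by (cases "r > 0"; cases k) auto
    qed
    have ev: "\<exists>\<delta>>0. \<forall>r. \<bar>r\<bar> < \<delta> \<longrightarrow> \<bar>r\<bar> * H < hi (\<not> k) (side e t) - lo (\<not> k) (side e t)" for t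
      using H lo_hi[OF side_in_M[OF e], of "\<not> k" t]
      by (intro exI[of _ "(hi (\<not> k) (side e t) - lo (\<not> k) (side e t)) / H"]) (simp add: field_simps)
    have evr: "eventually (\<lambda>r. c (side e k) = S (cx (\<gamma> r))) (at_right 0)"
    proof -
      obtain \<delta> where d: "\<delta> > 0" "\<And>r. \<bar>r\<bar> < \<delta> \<Longrightarrow> \<bar>r\<bar> * H < hi (\<not> k) (side e k) - lo (\<not> k) (side e k)" using ev[of k] by blast
      have "c (side e k) = S (cx (\<gamma> r))" if "0 < r" "r < \<delta>" for r
        using c[OF side_in_M[OF e] inC[of r k, OF _ d(2)]] that by simp
      then show ?thesis using \<open>\<delta> > 0\<close> unfolding eventually_at_right_field by blast
    qed
    have evl: "eventually (\<lambda>r. c (side e (\<not> k)) = S (cx (\<gamma> r))) (at_left 0)"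
    proof -
      obtain \<delta> where d: "\<delta> > 0" "\<And>r. \<bar>r\<bar> < \<delta> \<Longrightarrow> \<bar>r\<bar> * H < hi (\<not> k) (side e (\<not> k)) - lo (\<not> k) (side e (\<not> k))" using ev[of "\<not> k"] by blast
      have "c (side e (\<not> k)) = S (cx (\<gamma> r))" if "- \<delta> < r" "r < 0" for r
        using c[OF side_in_M[OF e] inC[of r "\<not> k", OF _ d(2)]] that by simp
      then show ?thesis using \<open>\<delta> > 0\<close> unfolding eventually_at_left_field
        by (intro exI[of _ "- \<delta>"]) simp
    qed
    \<comment> \<open>All summands except the logarithm of \<open>e\<close> itself are continuous at
      the midpoint of \<open>e\<close>, so the jump of \<open>S\<close> comes from that logarithm
      alone.\<close>
    define R where "R z = (\<Sum>e'\<in>interior_edges M - {e}. of_real (f e') * De e' z) - (\<Sum>v\<in>N. of_real (netflow f v) * L v z)" for z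
    have SR: "S z = R z + of_real (f e) * De e z" for z
      unfolding S_def R_def using sum.remove[OF finite_interior_edges e, of "\<lambda>e. of_real (f e) * De e z"] by simp
    have contR: "isCont R m"
    proof -
      have "isCont (De e') m" if "e' \<in> interior_edges M - {e}" for e'
      proof -
        have "rx m \<notin> pts e'" using inner_edge_point[OF e k mo] that interior_edge_edge by blast
        then show ?thesis using De[of "rx m" e'] DERIV_isCont by fastforce
      qed
      moreover have "m \<in> cx ` interior \<Phi>"
        using mo e unfolding interior_edges_def \<Phi>_def cx_image by blast
      then have "isCont (L v) m" if "v \<in> N" for v using L[OF that] DERIV_isCont by blast
      ultimately show ?thesis unfolding R_def by (intro continuous_intros) auto
    qed
    have gm: "((\<lambda>r. cx (\<gamma> r)) \<longlongrightarrow> m) (at 0 within A)" for A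
    proof -
      have "((\<lambda>r. m + \<i> * of_real r * h) \<longlongrightarrow> m + \<i> * of_real 0 * h) (at 0 within A)" by (intro tendsto_intros)
      then show ?thesis by (simp add: \<gamma>_def)
    qed
    have tR: "((\<lambda>r. R (cx (\<gamma> r))) \<longlongrightarrow> R m) (at 0 within A)" for A
      using isCont_tendsto_compose[OF contR gm] .
    have Deg: "De e (cx (\<gamma> r)) = Ln ((m + \<i> * of_real r * h - (m + h)) / (m + \<i> * of_real r * h - (m - h)))" for r
      unfolding De_def ab by (simp add: \<gamma>_def)
    have "((\<lambda>r. S (cx (\<gamma> r))) \<longlongrightarrow> R m + of_real (f e) * (\<i> * pi)) (at_right 0)"
      unfolding SR Deg by (intro tendsto_intros tR Ln_jump_limit(1)[OF h0])
    moreover have "((\<lambda>r. S (cx (\<gamma> r))) \<longlongrightarrow> c (side e k)) (at_right 0)"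
      using Lim_transform_eventually[OF tendsto_const evr] .
    ultimately have 1: "c (side e k) = R m + of_real (f e) * (\<i> * pi)"
      using tendsto_unique trivial_limit_at_right_real by blast
    have "((\<lambda>r. S (cx (\<gamma> r))) \<longlongrightarrow> R m + of_real (f e) * (- \<i> * pi)) (at_left 0)"
      unfolding SR Deg by (intro tendsto_add tendsto_mult tendsto_const tR Ln_jump_limit(2)[OF h0])
    moreover have "((\<lambda>r. S (cx (\<gamma> r))) \<longlongrightarrow> c (side e (\<not> k))) (at_left 0)"
      using Lim_transform_eventually[OF tendsto_const evl] .
    ultimately have 2: "c (side e (\<not> k)) = R m + of_real (f e) * (- \<i> * pi)"
      using tendsto_unique trivial_limit_at_left_real by blast
    have "p (side e k) - p (side e (\<not> k)) = f e"
      unfolding p_def 1 2 by (simp add: field_simps)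
    moreover have "horizontal e = k" using k dirn_iff dirn_unique by (metis (full_types))
    ultimately show ?thesis using e by (cases k) (simp_all add: jump_def dir_sign_def)
  qed
  then show ?thesis using that by blast
qed

end

section \<open>Splines as cycles\<close>

definition cont_diff :: "bool \<Rightarrow> nat \<Rightarrow> (real \<times> real) set \<Rightarrow> (real \<times> real \<Rightarrow> real) \<Rightarrow> bool" where
  "cont_diff k m \<Phi> s \<longleftrightarrow>
     (\<exists>D. D 0 = s \<and> (\<forall>j\<le>m. continuous_on \<Phi> (D j)) \<and>
       (\<forall>j<m. \<forall>z\<in>\<Phi>.
          ((\<lambda>u. D j (upd k z u)) has_real_derivative D (Suc j) z) (at (co k z) within {u. upd k z u \<in> \<Phi>})))"

lemma cont_diff_True: "cont_diff True m \<Phi> s \<longleftrightarrow> cont_diff_x m \<Phi> s"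
  unfolding cont_diff_def cont_diff_x_def by (simp add: upd_def co_def split_beta)

lemma cont_diff_False: "cont_diff False m \<Phi> s \<longleftrightarrow> cont_diff_y m \<Phi> s"
  unfolding cont_diff_def cont_diff_y_def by (simp add: upd_def co_def split_beta)

lemma has_real_derivative_Union:
  assumes "finite F" "\<And>i. i \<in> F \<Longrightarrow> (f has_real_derivative D) (at x within S i)"
  shows "(f has_real_derivative D) (at x within (\<Union>i\<in>F. S i))"
  using assms
proof (induction F rule: finite_induct)
  case (insert i F)
  then show ?case unfolding has_field_derivative_iff by (auto simp: at_within_union intro: filterlim_sup)
qed (simp add: has_field_derivative_iff)

locale spline_mesh = tmesh +
  fixes d :: nat
  assumes d1: "d \<ge> 1"
begin

lemma interior_edge_dirn: "e \<in> interior_edges M \<Longrightarrow> \<exists>k. dirn k e"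
  using edges_dirn interior_edge_edge by blast

lemma J_edge_Jspace: "dirn k e \<Longrightarrow> J_edge d e = Jspace d k (co (\<not> k) (fst e))"
  using dirn_iff[of e] dirn_unique[of k e "\<not> k"] unfolding J_edge_def
  by (cases k) (auto simp: Jspace_dvd co_def)

definition sel :: "real \<times> real \<Rightarrow> (real \<times> real) set" where
  "sel z = (SOME C. C \<in> M \<and> z \<in> C)"

lemma sel: "z \<in> \<Phi> \<Longrightarrow> sel z \<in> M \<and> z \<in> sel z"
  unfolding sel_def \<Phi>_def by (rule someI_ex) blast

definition glue :: "((real \<times> real) set \<Rightarrow> real poly poly) \<Rightarrow> real \<times> real \<Rightarrow> real" where
  "glue p z = (if z \<in> \<Phi> then eval2 (p (sel z)) z else 0)"

definition piece_families :: "((real \<times> real) set \<Rightarrow> real poly poly) set" where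
  "piece_families = {p. (\<forall>C\<in>M. p C \<in> bipolys d) \<and> (\<forall>C. C \<notin> M \<longrightarrow> p C = 0) \<and>
     (\<forall>e\<in>interior_edges M. p (side e True) - p (side e False) \<in> J_edge d e)}"

text \<open>Divisibility of the jumps gives agreement across each edge through \<open>z\<close>;
  \<open>local_cells_equal\<close> extends it to cells that share only a corner.\<close>

lemma piece_families_agree:
  assumes p: "p \<in> piece_families" and C: "C \<in> M" "C' \<in> M" "z \<in> C" "z \<in> C'" and j: "j < d"
  shows "eval2 ((pd k ^^ j) (p C)) z = eval2 ((pd k ^^ j) (p C')) z"
proof (rule local_cells_equal[OF _ _ C])
  show "equivp (\<lambda>C C'. eval2 ((pd k ^^ j) (p C)) z = eval2 ((pd k ^^ j) (p C')) z)"
    by (intro equivpI reflpI sympI transpI) auto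
  fix e assume e: "e \<in> interior_edges M" "z \<in> pts e"
  obtain i where i: "dirn i e" using e edges_dirn interior_edge_edge by blast
  have "co (\<not> i) z = co (\<not> i) (fst e)" using e(2) dirn_pts[OF i] by blast
  then have "p (side e True) - p (side e False) \<in> Jspace d i (co (\<not> i) z)"
    using p e(1) J_edge_Jspace[OF i] unfolding piece_families_def by auto
  then have "eval2 ((pd k ^^ j) (p (side e True) - p (side e False))) z = 0" using Jspace_pd_vanish j by blast
  then show "eval2 ((pd k ^^ j) (p (side e True))) z = eval2 ((pd k ^^ j) (p (side e False))) z"
    by (simp add: pd_funpow_diff)
qed

lemma upd_cell: "C \<in> M \<Longrightarrow> {u. upd k z u \<in> C} =
  (if lo (\<not> k) C \<le> co (\<not> k) z \<and> co (\<not> k) z \<le> hi (\<not> k) C then {lo k C..hi k C} else {})"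
  unfolding mem_cell all_co[of _ k] by auto

lemma glue_cell: "p \<in> piece_families \<Longrightarrow> C \<in> M \<Longrightarrow> z \<in> C \<Longrightarrow> glue p z = eval2 (p C) z"
proof -
  assume p: "p \<in> piece_families" and C: "C \<in> M" "z \<in> C"
  have z: "z \<in> \<Phi>" using C unfolding \<Phi>_def by blast
  then show ?thesis using piece_families_agree[OF p _ C(1) _ C(2), of "sel z" 0] sel[OF z] d1 by (simp add: glue_def)
qed

lemma glue_splines:
  assumes p: "p \<in> piece_families"
  shows "glue p \<in> splines M d"
proof -
  have cd: "cont_diff k (d - 1) \<Phi> (glue p)" for k
  proof -
    define D where "D j z = (if z \<in> \<Phi> then eval2 ((pd k ^^ j) (p (sel z))) z else 0)" for j z
    have D: "D j z = eval2 ((pd k ^^ j) (p C)) z" if "j < d" "C \<in> M" "z \<in> C" for j C z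
    proof -
      have z: "z \<in> \<Phi>" using that unfolding \<Phi>_def by blast
      then show ?thesis using piece_families_agree[OF p _ that(2) _ that(3,1), of "sel z"] sel[OF z] by (simp add: D_def)
    qed
    have "D 0 = glue p" by (auto simp: D_def glue_def fun_eq_iff)
    moreover have "continuous_on \<Phi> (D j)" if "j \<le> d - 1" for j
    proof -
      have "j < d" using that d1 by simp
      then have "continuous_on C (D j)" if "C \<in> M" for C
        using D[OF _ that] continuous_on_eval2 by (metis (no_types, lifting) continuous_on_cong)
      then show ?thesis unfolding \<Phi>_def
        using continuous_on_closed_Union[of M "\<lambda>C. C" "D j"] finite_M closed_cell by simp
    qed
    moreover have "((\<lambda>u. D j (upd k z u)) has_real_derivative D (Suc j) z) (at (co k z) within {u. upd k z u \<in> \<Phi>})"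
      if j: "j < d - 1" and z: "z \<in> \<Phi>" for j z
    proof -
      have "((\<lambda>u. D j (upd k z u)) has_real_derivative D (Suc j) z) (at (co k z) within {u. upd k z u \<in> C})" if C: "C \<in> M" for C
      proof (cases "z \<in> C")
        case True
        have "((\<lambda>u. eval2 ((pd k ^^ j) (p C)) (upd k z u)) has_real_derivative D (Suc j) z) (at (co k z) within {u. upd k z u \<in> C})"
          using has_real_derivative_eval2[of "(pd k ^^ j) (p C)" k z] D[OF _ C True, of "Suc j"] j by simp
        then show ?thesis
          by (rule has_field_derivative_transform_within[OF _ zero_less_one]) (use True D[OF _ C] j in auto)
      next
        case False
        \<comment> \<open>The slice of a cell is closed, so if the cell misses \<open>z\<close> the
          filter within it is trivial at \<open>z\<close> and imposes no condition.\<close>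
        have cl: "closed {u. upd k z u \<in> C}" unfolding upd_cell[OF C] by auto
        have "co k z \<notin> {u. upd k z u \<in> C}" using False by simp
        then have "\<not> co k z islimpt {u. upd k z u \<in> C}" using cl closed_limpt by blast
        then have "at (co k z) within {u. upd k z u \<in> C} = bot" using trivial_limit_within by blast
        then show ?thesis by (simp add: has_field_derivative_iff)
      qed
      moreover have "{u. upd k z u \<in> \<Phi>} = (\<Union>C\<in>M. {u. upd k z u \<in> C})" unfolding \<Phi>_def by blast
      ultimately show ?thesis using has_real_derivative_Union[OF finite_M] by simp
    qed
    ultimately show ?thesis unfolding cont_diff_def by blast
  qed
  have "\<forall>C\<in>M. \<exists>q\<in>bipolys d. \<forall>z\<in>C. glue p z = eval2 q z"
    using glue_cell[OF p] p unfolding piece_families_def by blast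
  moreover have "\<forall>z. z \<notin> \<Phi> \<longrightarrow> glue p z = 0" by (simp add: glue_def)
  ultimately show ?thesis
    using cd[of True] cd[of False] unfolding splines_def cont_diff_True cont_diff_False \<Phi>_def by blast
qed

lemma infinite_edge:
  assumes "dirn k e"
  shows "infinite (co k ` pts e)"
proof -
  have "{co k (fst e)..co k (snd e)} \<subseteq> co k ` pts e"
  proof
    fix r assume r: "r \<in> {co k (fst e)..co k (snd e)}"
    then have "mk k r (co (\<not> k) (fst e)) \<in> pts e" unfolding dirn_pts[OF assms] by simp
    then show "r \<in> co k ` pts e" by (rule rev_image_eqI) simp
  qed
  then show ?thesis using assms infinite_super infinite_Icc unfolding dirn_def by blast
qed

text \<open>The witnesses \<open>D\<close> of differentiability live on the whole domain, but on a
  cell they must be the formal derivatives of its piece, since derivatives within a nondegenerate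
  interval are unique.\<close>

lemma cont_diff_derivs:
  assumes D0: "D 0 = s"
    and D: "\<And>j z. j < m \<Longrightarrow> z \<in> \<Phi> \<Longrightarrow>
      ((\<lambda>u. D j (upd k z u)) has_real_derivative D (Suc j) z) (at (co k z) within {u. upd k z u \<in> \<Phi>})"
    and C: "C \<in> M" and s: "\<And>z. z \<in> C \<Longrightarrow> s z = eval2 q z"
  shows "j \<le> m \<Longrightarrow> z \<in> C \<Longrightarrow> D j z = eval2 ((pd k ^^ j) q) z"
proof (induction j arbitrary: z)
  case 0
  then show ?case using D0 s by simp
next
  case (Suc j)
  let ?I = "{u. upd k z u \<in> C}"
  have z: "z \<in> \<Phi>" using Suc C unfolding \<Phi>_def by blast
  have "?I \<subseteq> {u. upd k z u \<in> \<Phi>}" using C unfolding \<Phi>_def by blast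
  then have "((\<lambda>u. D j (upd k z u)) has_real_derivative D (Suc j) z) (at (co k z) within ?I)"
    using D[of j z] Suc z DERIV_subset by auto
  moreover have "((\<lambda>u. D j (upd k z u)) has_real_derivative eval2 (pd k ((pd k ^^ j) q)) z) (at (co k z) within ?I)"
    by (rule has_field_derivative_transform_within[OF has_real_derivative_eval2 zero_less_one]) (use Suc in auto)
  moreover have "at (co k z) within ?I \<noteq> bot"
  proof -
    have "?I = {lo k C..hi k C}" "co k z \<in> ?I" using Suc(3) mem_cell[OF C] unfolding upd_cell[OF C] by auto
    then show ?thesis using trivial_limit_within[of "co k z" ?I] islimpt_Icc[OF lo_hi[OF C, of k]] by simp
  qed
  ultimately show ?case
    using vector_derivative_unique_within[of "co k z" ?I]
    by (simp add: has_real_derivative_iff_has_vector_derivative)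
qed

lemma splines_glue:
  assumes s: "s \<in> splines M d"
  shows "\<exists>p\<in>piece_families. s = glue p"
proof -
  have "\<forall>C\<in>M. \<exists>p\<in>bipolys d. \<forall>z\<in>C. s z = eval2 p z" using s unfolding splines_def by blast
  then obtain p0 where p0: "\<And>C. C \<in> M \<Longrightarrow> p0 C \<in> bipolys d" "\<And>C z. C \<in> M \<Longrightarrow> z \<in> C \<Longrightarrow> s z = eval2 (p0 C) z"
    by metis
  define p where "p C = (if C \<in> M then p0 C else 0)" for C
  have p: "\<And>C. C \<in> M \<Longrightarrow> p C \<in> bipolys d" "\<And>C z. C \<in> M \<Longrightarrow> z \<in> C \<Longrightarrow> s z = eval2 (p C) z"
    using p0 by (auto simp: p_def)
  have "p (side e True) - p (side e False) \<in> J_edge d e" if e: "e \<in> interior_edges M" for e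
  proof -
    obtain k where k: "dirn k e" using e edges_dirn interior_edge_edge by blast
    \<comment> \<open>Divisibility by the power of the edge form is decided by the derivatives
      across the edge.\<close>
    have "cont_diff (\<not> k) (d - 1) \<Phi> s"
      using s unfolding splines_def \<Phi>_def by (cases k) (auto simp: cont_diff_True cont_diff_False)
    then obtain D where D: "D 0 = s" "\<And>j z. j < d - 1 \<Longrightarrow> z \<in> \<Phi> \<Longrightarrow>
      ((\<lambda>u. D j (upd (\<not> k) z u)) has_real_derivative D (Suc j) z) (at (co (\<not> k) z) within {u. upd (\<not> k) z u \<in> \<Phi>})"
      unfolding cont_diff_def by blast
    have sub: "pts e \<subseteq> side e t" for t
    proof
      fix w assume w: "w \<in> pts e"
      have sp: "sidep k e t (side e t)" using side_sidep[OF e k] .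
      then have "side e t \<in> M" by (simp add: sidep_def)
      then show "w \<in> side e t"
        using sp w lo_hi[OF \<open>side e t \<in> M\<close>, of "\<not> k"]
        unfolding mem_cell[OF \<open>side e t \<in> M\<close>] all_co[of _ k] sidep_def dirn_pts[OF k] by (auto split: if_splits)
    qed
    have "p (side e True) - p (side e False) \<in> Jspace d k (co (\<not> k) (fst e))"
    proof (rule Jspace_vanishing[OF _ infinite_edge[OF k]])
      show "p (side e True) - p (side e False) \<in> bipolys d"
        using bipolys_diff p(1) side_in_M[OF e] by blast
      fix u j assume "u \<in> co k ` pts e" and j: "j < d"
      then obtain w where w: "w \<in> pts e" "u = co k w" by blast
      have "D j w = eval2 ((pd (\<not> k) ^^ j) (p (side e t))) w" for t
      proof (rule cont_diff_derivs[OF D side_in_M[OF e] p(2)[OF side_in_M[OF e]]])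
        show "j \<le> d - 1" using j by simp
        show "w \<in> side e t" using w(1) sub by blast
      qed
      from this[of True] this[of False]
      have "eval2 ((pd (\<not> k) ^^ j) (p (side e True) - p (side e False))) w = 0" by (simp add: pd_funpow_diff)
      moreover have "co (\<not> k) w = co (\<not> k) (fst e)" using w(1) dirn_pts[OF k] by blast
      ultimately show "poly ((pderiv ^^ j) (slice (\<not> k) (p (side e True) - p (side e False)) u)) (co (\<not> k) (fst e)) = 0"
        using w(2) by (simp add: eval2_slice[where k="\<not> k"] slice_pd_funpow)
    qed
    then show ?thesis using J_edge_Jspace[OF k] by simp
  qed
  then have "p \<in> piece_families" unfolding piece_families_def using p(1) by (auto simp: p_def)
  moreover have "s = glue p"
  proof
    fix z
    show "s z = glue p z"
    proof (cases "z \<in> \<Phi>")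
      case True
      then show ?thesis using sel[OF True] p(2) by (simp add: glue_def)
    next
      case False
      then have "s z = 0" using s unfolding splines_def \<Phi>_def by blast
      then show ?thesis using False by (simp add: glue_def)
    qed
  qed
  ultimately show ?thesis by blast
qed

lemma splines_eq: "splines M d = glue ` piece_families"
  using glue_splines splines_glue by blast

lemma linear_glue: "Vector_Spaces.linear (\<lambda>c f z. smult [:c:] (f z)) (\<lambda>c f z. c * f z) glue"
  by unfold_locales (auto simp: glue_def fun_eq_iff)

lemma glue_inj: "p \<in> piece_families \<Longrightarrow> glue p = 0 \<Longrightarrow> p = 0"
proof
  fix C assume p: "p \<in> piece_families" "glue p = 0"
  show "p C = 0 C"
  proof (cases "C \<in> M")
    case True
    have "p C = 0"
    proof (rule eval2_eqI[of "{lo True C..hi True C}" "{lo False C..hi False C}"])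
      fix z assume "fst z \<in> {lo True C..hi True C}" "snd z \<in> {lo False C..hi False C}"
      then have "z \<in> C" unfolding mem_cell[OF True] all_co[of _ True] by (simp add: co_def)
      then show "eval2 (p C) z = eval2 0 z" using glue_cell[OF p(1) True] p(2) by simp
    qed (use lo_hi[OF True] infinite_Icc in auto)
    then show ?thesis by simp
  qed (use p in \<open>simp add: piece_families_def\<close>)
qed

section \<open>Jumps of piece families and cycles\<close>

lemma linear_jump: "Vector_Spaces.linear (\<lambda>c f z. smult [:c:] (f z)) (\<lambda>c f z. smult [:c:] (f z))
    (jump :: ((real \<times> real) set \<Rightarrow> real poly poly) \<Rightarrow> seg \<Rightarrow> real poly poly)"
  by unfold_locales (auto simp: jump_def dir_sign_def fun_eq_iff smult_diff_right)

lemma linear_bdry: "Vector_Spaces.linear (\<lambda>c f z. smult [:c:] (f z)) (\<lambda>c f z. smult [:c:] (f z)) (bdry M)"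
  by unfold_locales (auto simp: bdry_def fun_eq_iff smult_diff_right sum.distrib smult_sum2)

definition cycles :: "(seg \<Rightarrow> real poly poly) set" where
  "cycles = {f \<in> edge_chains M d. bdry M f = 0}"

lemma J_edge_dir_sign: "x \<in> J_edge d e \<longleftrightarrow> dir_sign k x \<in> J_edge d e" if "dirn i e"
proof -
  have "- y \<in> J_edge d e" if "y \<in> J_edge d e" for y
    using pp.subspace_neg[OF Jspace_subspace] that J_edge_Jspace[OF \<open>dirn i e\<close>] by metis
  from this[of x] this[of "- x"] show ?thesis by (auto simp: dir_sign_def)
qed

lemma netflow_coeff: "netflow (\<lambda>e. coeff (coeff (f e) j) i) v = coeff (coeff (netflow f v) j) i"
  by (simp add: netflow_def coeff_sum)

lemma coeff_dir_sign: "coeff (coeff (dir_sign k x) j) i = dir_sign k (coeff (coeff x j) i)"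
  by (simp add: dir_sign_def)

text \<open>The edge and cycle conditions on jumps are immediate; conversely a cycle is integrated
  by applying \<open>potential\<close> to each real coefficient separately.\<close>

lemma jump_image: "jump ` piece_families = cycles"
proof
  show "jump ` piece_families \<subseteq> cycles"
  proof
    fix f assume "f \<in> jump ` piece_families"
    then obtain p where p: "p \<in> piece_families" "f = jump p" by blast
    have "jump p e \<in> J_edge d e" if "e \<in> interior_edges M" for e
    proof -
      obtain i where "dirn i e" using interior_edge_dirn[OF \<open>e \<in> interior_edges M\<close>] by blast
      then show ?thesis using p(1) that J_edge_dir_sign unfolding piece_families_def jump_def by auto
    qed
    moreover have "bdry M (jump p) = 0" using netflow_jump by (auto simp: bdry_netflow fun_eq_iff)
    ultimately show "f \<in> cycles" unfolding cycles_def edge_chains_def p(2) by (auto simp: jump_def)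
  qed
  show "cycles \<subseteq> jump ` piece_families"
  proof
    fix f assume f: "f \<in> cycles"
    have fJ: "f e \<in> J_edge d e" if "e \<in> interior_edges M" for e using f that unfolding cycles_def edge_chains_def by blast
    have fb: "f e \<in> bipolys d" for e
    proof (cases "e \<in> interior_edges M")
      case True
      then show ?thesis using fJ unfolding J_edge_def by blast
    next
      case False
      then have "f e = 0" using f unfolding cycles_def edge_chains_def by blast
      then show ?thesis using bipolys_0 by simp
    qed
    have "netflow f v = 0" if "v \<in> interior_vertices M" for v
    proof -
      have "bdry M f v = 0" using f unfolding cycles_def by simp
      then show ?thesis using that by (simp add: bdry_netflow)
    qed
    then have ex: "\<exists>p :: (real \<times> real) set \<Rightarrow> real. \<forall>e\<in>interior_edges M. jump p e = coeff (coeff (f e) j) i" for i j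
      using potential[of "\<lambda>e. coeff (coeff (f e) j) i"] netflow_coeff[of f j i] by (metis coeff_0)
    define P where "P i j = (SOME p :: (real \<times> real) set \<Rightarrow> real. \<forall>e\<in>interior_edges M. jump p e = coeff (coeff (f e) j) i)" for i j
    have P: "jump (P i j) e = coeff (coeff (f e) j) i" if "e \<in> interior_edges M" for i j e
      using someI_ex[OF ex[of j i]] that unfolding P_def by blast
    \<comment> \<open>The potentials are used only up to bidegree (d, d), which keeps the pieces in
      \<open>bipolys d\<close>; higher coefficients of \<open>f\<close> vanish, so the jumps are
      still right.\<close>
    define p where "p C = (if C \<in> M then (\<Sum>j\<le>d. monom (\<Sum>i\<le>d. monom (P i j C) i) j) else 0)" for C
    have pc: "coeff (coeff (p C) j) i = (if i \<le> d \<and> j \<le> d then P i j C else 0)" if "C \<in> M" for C i j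
      using that by (simp add: p_def coeff_sum if_distrib[of "\<lambda>x. coeff x _"] cong: if_cong)
    have pb: "p C \<in> bipolys d" if "C \<in> M" for C using pc[OF that] by (auto simp: bipolys_coeff)
    have dlp: "jump p e = f e" if e: "e \<in> interior_edges M" for e
    proof (rule poly_poly_eqI)
      fix i j
      have "coeff (coeff (jump p e) j) i = (if i \<le> d \<and> j \<le> d then jump (P i j) e else 0)"
        using e side_in_M[OF e] pc by (simp add: jump_def coeff_dir_sign) (simp add: dir_sign_def)
      then show "coeff (coeff (jump p e) j) i = coeff (coeff (f e) j) i"
        using P[OF e] fb[of e] by (auto simp: bipolys_coeff not_le)
    qed
    have "p (side e True) - p (side e False) \<in> J_edge d e" if e: "e \<in> interior_edges M" for e
    proof -
      obtain i where "dirn i e" using e edges_dirn interior_edge_edge by blast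
      then show ?thesis using fJ[OF e] dlp[OF e] J_edge_dir_sign[of i e "p (side e True) - p (side e False)" "horizontal e"] e
        by (simp add: jump_def)
    qed
    then have "p \<in> piece_families" unfolding piece_families_def using pb by (auto simp: p_def)
    moreover have "jump p = f"
    proof
      fix e show "jump p e = f e"
      proof (cases "e \<in> interior_edges M")
        case False
        then have "f e = 0" using f unfolding cycles_def edge_chains_def by blast
        then show ?thesis using False by (simp add: jump_def)
      qed (rule dlp)
    qed
    ultimately show "f \<in> jump ` piece_families" by blast
  qed
qed

lemma M_nonempty: "M \<noteq> {}"
  using T_mesh unfolding T_mesh_def by blast

lemma jump_kernel: "ch.has_dim {p \<in> piece_families. jump p = 0} ((d + 1)\<^sup>2)"
proof -
  obtain C0 where C0: "C0 \<in> M" using M_nonempty by blast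
  let ?K = "{p \<in> piece_families. jump p = 0}"
  have Kc: "p C = p C'" if "p \<in> ?K" "C \<in> M" "C' \<in> M" for p C C'
  proof (rule cell_constant[OF _ that(2,3)])
    fix e assume e: "e \<in> interior_edges M"
    have "jump p e = 0" using that(1) by simp
    then show "p (side e True) = p (side e False)" using e by (auto simp: jump_def dir_sign_def split: if_splits)
  qed
  have const: "(\<lambda>C. if C \<in> M then q else 0) \<in> ?K" if "q \<in> bipolys d" for q
  proof -
    have "0 \<in> J_edge d e" if "e \<in> interior_edges M" for e
      using bipolys_0 by (simp add: J_edge_def)
    then show ?thesis using that side_in_M by (auto simp: piece_families_def jump_def dir_sign_def fun_eq_iff)
  qed
  have im: "?K = (\<lambda>q C. if C \<in> M then q else 0) ` bipolys d"
  proof (intro equalityI subsetI)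
    fix p assume p: "p \<in> ?K"
    have "p = (\<lambda>C. if C \<in> M then p C0 else 0)"
      using Kc[OF p _ C0] p by (auto simp: fun_eq_iff piece_families_def)
    moreover have "p C0 \<in> bipolys d" using p C0 by (simp add: piece_families_def)
    ultimately show "p \<in> (\<lambda>q C. if C \<in> M then q else 0) ` bipolys d" by blast
  qed (use const in auto)
  interpret pc: dim_space_pair "\<lambda>(c::real) (p :: real poly poly). smult [:c:] p"
    "\<lambda>(c::real) (f :: (real \<times> real) set \<Rightarrow> real poly poly) z. smult [:c:] (f z)" ..
  have "Vector_Spaces.linear (\<lambda>c p. smult [:c:] p) (\<lambda>c f z. smult [:c:] (f z))
    (\<lambda>(q :: real poly poly) C. if C \<in> M then q else 0)"
    by unfold_locales (auto simp: fun_eq_iff)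
  then show ?thesis unfolding im
    by (rule pc.has_dim_inj_image[OF _ bipolys_has_dim]) (use C0 in \<open>auto simp: fun_eq_iff split: if_splits\<close>)
qed

lemma piece_families_subspace: "chain_vs.subspace piece_families"
proof -
  have "pp.subspace (J_edge d e)" if "e \<in> interior_edges M" for e
  proof -
    obtain i where "dirn i e" using interior_edge_dirn[OF \<open>e \<in> interior_edges M\<close>] by blast
    then show ?thesis using J_edge_Jspace Jspace_subspace by metis
  qed
  note J = pp.subspace_add[OF this] pp.subspace_scale[OF this] pp.subspace_0[OF this]
  show ?thesis
    unfolding chain_vs.subspace_def
  proof (intro conjI ballI allI)
    show "0 \<in> piece_families" using J(3) by (auto simp: piece_families_def bipolys_0)
    fix p q assume pq: "p \<in> piece_families" "q \<in> piece_families"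
    have "(p (side e True) - p (side e False)) + (q (side e True) - q (side e False)) \<in> J_edge d e" if "e \<in> interior_edges M" for e
      using J(1)[OF that] pq that unfolding piece_families_def by blast
    then show "p + q \<in> piece_families" using pq by (auto simp: piece_families_def bipolys_add algebra_simps)
  next
    fix c p assume p: "p \<in> piece_families"
    have "smult [:c:] (p (side e True) - p (side e False)) \<in> J_edge d e" if "e \<in> interior_edges M" for e
      using J(2)[OF that] p that unfolding piece_families_def by blast
    then show "(\<lambda>z. smult [:c:] (p z)) \<in> piece_families" using p by (auto simp: piece_families_def bipolys_smult smult_diff_right)
  qed
qed

lemma dim_splines_cycles:
  assumes "ch.has_dim cycles n"
  shows "dim_splines M d = (d + 1)\<^sup>2 + n"
proof -
  have "ch.has_dim (jump ` piece_families) n" using assms jump_image by simp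
  then have "ch.has_dim piece_families ((d + 1)\<^sup>2 + n)"
    using ch_ch.has_dim_kernel_image[OF linear_jump piece_families_subspace jump_kernel] by blast
  then have "fn.has_dim (glue ` piece_families) ((d + 1)\<^sup>2 + n)"
    by (rule ch_fn.has_dim_inj_image[OF linear_glue]) (rule glue_inj)
  then show ?thesis unfolding dim_splines_def splines_eq by (rule fn.has_dim_dim)
qed

end

section \<open>Counting edges along l-edges\<close>

lemma pts_subset_dirn:
  assumes "dirn k l" "dirn i e" "pts e \<subseteq> pts l"
  shows "i = k"
proof (rule ccontr)
  assume "i \<noteq> k"
  then have ik: "i = (\<not> k)" by auto
  have "fst e \<in> pts l" "snd e \<in> pts l" using dirn_ends[OF assms(2)] assms(3) by auto
  then have "co i (fst e) = co i (snd e)" unfolding dirn_pts[OF assms(1)] ik by simp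
  then show False using assms(2) by (simp add: dirn_def)
qed

lemma pts_subset_iff:
  assumes "dirn k l" "dirn k e"
  shows "pts e \<subseteq> pts l \<longleftrightarrow> co (\<not> k) (fst e) = co (\<not> k) (fst l) \<and> co k (fst l) \<le> co k (fst e) \<and> co k (snd e) \<le> co k (snd l)"
proof
  assume "pts e \<subseteq> pts l"
  then have "fst e \<in> pts l" "snd e \<in> pts l" using dirn_ends[OF assms(2)] by auto
  then show "co (\<not> k) (fst e) = co (\<not> k) (fst l) \<and> co k (fst l) \<le> co k (fst e) \<and> co k (snd e) \<le> co k (snd l)"
    unfolding dirn_pts[OF assms(1)] by simp
qed (auto simp: dirn_pts[OF assms(1)] dirn_pts[OF assms(2)])

lemma pts_subset_antisym:
  assumes "dirn k l" "dirn k e" "pts e \<subseteq> pts l" "co k (snd l) - co k (fst l) \<le> co k (snd e) - co k (fst e)"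
  shows "e = l"
proof -
  have "co (\<not> k) (fst e) = co (\<not> k) (fst l)" "co k (fst e) = co k (fst l)" "co k (snd e) = co k (snd l)"
    using assms pts_subset_iff[OF assms(1,2)] by auto
  moreover have "co (\<not> k) (snd e) = co (\<not> k) (fst e)" "co (\<not> k) (snd l) = co (\<not> k) (fst l)"
    using assms(1,2) unfolding dirn_def by auto
  ultimately show ?thesis using prod_eq_co2[of "fst e" "fst l" k] prod_eq_co2[of "snd e" "snd l" k]
    by (simp add: prod_eq_iff[of e l])
qed

context spline_mesh
begin

abbreviation composed :: "seg \<Rightarrow> bool" where "composed \<equiv> composed_of_interior_edges M"

lemma composedD:
  assumes "composed l"
  shows "\<exists>k. dirn k l" "z \<in> pts l \<Longrightarrow> \<exists>e\<in>interior_edges M. pts e \<subseteq> pts l \<and> z \<in> pts e"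
proof -
  show "\<exists>k. dirn k l" using assms dirn_cases unfolding composed_of_interior_edges_def by blast
  have *: "pts l = \<Union>{pts e | e. e \<in> interior_edges M \<and> pts e \<subseteq> pts l}"
    using assms unfolding composed_of_interior_edges_def by (rule conjunct2)
  assume "z \<in> pts l"
  then have "z \<in> \<Union>{pts e | e. e \<in> interior_edges M \<and> pts e \<subseteq> pts l}" by (rule subsetD[OF equalityD1[OF *]])
  then show "\<exists>e\<in>interior_edges M. pts e \<subseteq> pts l \<and> z \<in> pts e" by blast
qed

lemma composedI:
  assumes "dirn k l" "\<And>z. z \<in> pts l \<Longrightarrow> \<exists>e\<in>interior_edges M. pts e \<subseteq> pts l \<and> z \<in> pts e"
  shows "composed l"
  unfolding composed_of_interior_edges_def
proof
  show "horizontal l \<or> vertical l" using assms(1) dirn_cases by blast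
  show "pts l = \<Union>{pts e | e. e \<in> interior_edges M \<and> pts e \<subseteq> pts l}"
  proof (intro equalityI subsetI)
    fix z assume "z \<in> pts l"
    then obtain e where "e \<in> interior_edges M" "pts e \<subseteq> pts l" "z \<in> pts e" using assms(2) by blast
    then show "z \<in> \<Union>{pts e | e. e \<in> interior_edges M \<and> pts e \<subseteq> pts l}" by blast
  qed blast
qed

lemma composed_edge: "e \<in> interior_edges M \<Longrightarrow> composed e"
  using interior_edge_dirn composedI by blast

text \<open>Between \<open>z\<close> and the next edge endpoint in the direction \<open>s\<close> no
  edge can begin or end, so an edge of the segment containing an intermediate point contains the
  initial piece of the ray.\<close>

lemma composed_onq:
  assumes l: "composed l" "dirn k l" and z: "z \<in> pts l"
    and s: "if s then co k z < co k (snd l) else co k (fst l) < co k z"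
  shows "\<exists>e\<in>interior_edges M. pts e \<subseteq> pts l \<and> onq k s z e"
proof -
  \<comment> \<open>Coordinates of edge endpoints beyond \<open>z\<close> in the direction
    \<open>s\<close>, from all edges of the mesh; the end of \<open>l\<close> is added so that the
    nearest one does not leave \<open>l\<close>.\<close>
  define B where "B = {b \<in> insert (co k (if s then snd l else fst l)) (co k ` fst ` interior_edges M \<union> co k ` snd ` interior_edges M).
     if s then co k z < b else b < co k z}"
  have B: "finite B" "co k (if s then snd l else fst l) \<in> B"
    unfolding B_def using finite_interior_edges s by auto
  define b where "b = (if s then Min B else Max B)"
  have bB: "b \<in> B" unfolding b_def using B Min_in[OF B(1)] Max_in[OF B(1)] by (metis empty_iff)
  have bl: "if s then b \<le> co k (snd l) else co k (fst l) \<le> b"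
    unfolding b_def using B Min_le[OF B] Max_ge[OF B] by auto
  define w where "w = mk k ((co k z + b) / 2) (co (\<not> k) z)"
  have zl: "co (\<not> k) z = co (\<not> k) (fst l)" "co k (fst l) \<le> co k z" "co k z \<le> co k (snd l)"
    using z unfolding dirn_pts[OF l(2)] by auto
  have zb: "if s then co k z < b else b < co k z" using bB unfolding B_def by simp
  have "w \<in> pts l" unfolding dirn_pts[OF l(2)] using zl zb bl by (auto simp: w_def split: if_splits)
  then obtain e where e: "e \<in> interior_edges M" "pts e \<subseteq> pts l" "w \<in> pts e" using composedD(2)[OF l(1)] by blast
  obtain i where "dirn i e" using interior_edge_dirn[OF e(1)] by blast
  then have k: "dirn k e" using pts_subset_dirn[OF l(2) _ e(2)] by blast
  have we: "co (\<not> k) (fst e) = co (\<not> k) z" "co k (fst e) \<le> (co k z + b) / 2" "(co k z + b) / 2 \<le> co k (snd e)"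
    using e(3) unfolding dirn_pts[OF k] by (auto simp: w_def)
  have mem: "co k (fst e) \<in> co k ` fst ` interior_edges M \<union> co k ` snd ` interior_edges M"
    "co k (snd e) \<in> co k ` fst ` interior_edges M \<union> co k ` snd ` interior_edges M" using e(1) by auto
  have "onq k s z e"
  proof (cases s)
    case True
    have "co k (fst e) \<le> co k z"
    proof (rule ccontr)
      assume "\<not> ?thesis"
      then have "co k (fst e) \<in> B" unfolding B_def using True mem by simp
      then have "b \<le> co k (fst e)" unfolding b_def using True B by simp
      then show False using we zb True by simp
    qed
    then show ?thesis using True we zb k unfolding onq_def by simp
  next
    case False
    have "co k z \<le> co k (snd e)"
    proof (rule ccontr)
      assume "\<not> ?thesis"
      then have "co k (snd e) \<in> B" unfolding B_def using False mem by simp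
      then have "co k (snd e) \<le> b" unfolding b_def using False B by simp
      then show False using we zb False by simp
    qed
    then show ?thesis using False we zb k unfolding onq_def by simp
  qed
  then show ?thesis using e by blast
qed

lemma onq_ends: "dirn k l \<Longrightarrow> onq k s z e \<Longrightarrow> pts e \<subseteq> pts l \<Longrightarrow>
    (if s then co k z < co k (snd l) else co k (fst l) < co k z)"
  using pts_subset_iff[of k l e] unfolding onq_def by (auto split: if_splits)

lemma vertex_onq:
  assumes "v \<in> vertices M" "e \<in> interior_edges M" "onq k s v e"
  shows "e \<in> star v k s"
  using vertex_edge_end[OF assms(1) interior_edge_edge[OF assms(2)] assms(3)] assms(2,3)
  unfolding star_def onq_def by simp

lemma composed_end_vertex:
  assumes l: "composed l" "dirn k l"
  shows "fst l \<in> vertices M" "snd l \<in> vertices M"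
proof -
  have lt: "co k (fst l) < co k (snd l)" using l(2) by (simp add: dirn_def)
  have v: "fst e \<in> vertices M" "snd e \<in> vertices M" if "e \<in> interior_edges M" for e
    using that unfolding interior_edges_def edges_def by auto
  obtain e where e: "e \<in> interior_edges M" "pts e \<subseteq> pts l" "onq k True (fst l) e"
    using composed_onq[OF l, of "fst l" True] dirn_ends[OF l(2)] lt by auto
  have ke: "dirn k e" using e(3) unfolding onq_def by simp
  have "fst e = fst l"
    using e(2,3) pts_subset_iff[OF l(2) ke] prod_eq_co2[of "fst e" "fst l" k] unfolding onq_def by auto
  then show "fst l \<in> vertices M" using v[OF e(1)] by simp
  obtain e' where e': "e' \<in> interior_edges M" "pts e' \<subseteq> pts l" "onq k False (snd l) e'"
    using composed_onq[OF l, of "snd l" False] dirn_ends[OF l(2)] lt by auto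
  have ke': "dirn k e'" using e'(3) unfolding onq_def by simp
  have "snd e' = snd l"
    using e'(2,3) pts_subset_iff[OF l(2) ke'] prod_eq_co2[of "snd e'" "snd l" k] ke' unfolding onq_def dirn_def by auto
  then show "snd l \<in> vertices M" using v[OF e'(1)] by simp
qed

lemma composed_merge:
  assumes l: "composed l" "dirn k l" and l': "composed l'" "dirn k l'" and z: "z \<in> pts l" "z \<in> pts l'"
  obtains m where "composed m" "dirn k m" "pts l \<subseteq> pts m" "pts l' \<subseteq> pts m"
proof -
  define c where "c = co (\<not> k) (fst l)"
  define m where "m = (mk k (min (co k (fst l)) (co k (fst l'))) c, mk k (max (co k (snd l)) (co k (snd l'))) c)"
  have c: "co (\<not> k) (fst l') = c" using z unfolding dirn_pts[OF l(2)] dirn_pts[OF l'(2)] by (simp add: c_def)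
  have zz: "co k (fst l) \<le> co k z" "co k z \<le> co k (snd l)" "co k (fst l') \<le> co k z" "co k z \<le> co k (snd l')"
    using z unfolding dirn_pts[OF l(2)] dirn_pts[OF l'(2)] by auto
  have dm: "dirn k m" using l(2) l'(2) unfolding m_def dirn_def by auto
  have pm: "pts m = pts l \<union> pts l'"
    unfolding dirn_pts[OF dm] dirn_pts[OF l(2)] dirn_pts[OF l'(2)] c c_def[symmetric]
    using zz by (auto simp: m_def)
  have "composed m"
  proof (rule composedI[OF dm])
    fix w assume "w \<in> pts m"
    then consider "w \<in> pts l" | "w \<in> pts l'" unfolding pm by blast
    then show "\<exists>e\<in>interior_edges M. pts e \<subseteq> pts m \<and> w \<in> pts e"
    proof cases
      case 1
      then show ?thesis using composedD(2)[OF l(1) 1] unfolding pm by blast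
    next
      case 2
      then show ?thesis using composedD(2)[OF l'(1) 2] unfolding pm by blast
    qed
  qed
  then show ?thesis using that dm pm by blast
qed

section \<open>Maximal composed segments, identified with the interior l-edges\<close>

definition maxl :: "seg set" where
  "maxl = {l. composed l \<and> (\<forall>l'. composed l' \<and> pts l \<subseteq> pts l' \<longrightarrow> l' = l)}"

lemma maxl_unique:
  assumes "l \<in> maxl" "l' \<in> maxl" "dirn k l" "dirn k l'" "z \<in> pts l" "z \<in> pts l'"
  shows "l = l'"
proof -
  have c: "composed l" "composed l'" using assms unfolding maxl_def by auto
  obtain m where "composed m" "pts l \<subseteq> pts m" "pts l' \<subseteq> pts m"
    by (rule composed_merge[OF c(1) assms(3) c(2) assms(4-6)])
  then show ?thesis using assms(1,2) unfolding maxl_def by blast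
qed

lemma finite_composed: "finite {l. composed l}"
proof -
  have "{l. composed l} \<subseteq> vertices M \<times> vertices M"
  proof
    fix l assume "l \<in> {l. composed l}"
    then have l: "composed l" by simp
    obtain k where "dirn k l" using composedD(1)[OF l] by blast
    then show "l \<in> vertices M \<times> vertices M" using composed_end_vertex[OF l] by (simp add: mem_Times_iff)
  qed
  then show ?thesis using finite_vertices finite_subset by blast
qed

lemma maxl_exists:
  assumes e: "composed e" "dirn k e"
  obtains l where "l \<in> maxl" "dirn k l" "pts e \<subseteq> pts l"
proof -
  define A where "A = {l. composed l \<and> dirn k l \<and> pts e \<subseteq> pts l}"
  define len where "len l = co k (snd l) - co k (fst l)" for l :: seg
  have A: "finite A" "e \<in> A" using finite_composed e unfolding A_def by auto
  then have "Max (len ` A) \<in> len ` A" by (intro Max_in) auto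
  then obtain l where l: "l \<in> A" "len l = Max (len ` A)" by (metis imageE)
  have "l \<in> maxl"
    unfolding maxl_def
  proof (intro CollectI conjI allI impI)
    show "composed l" using l unfolding A_def by blast
    fix l' assume l': "composed l' \<and> pts l \<subseteq> pts l'"
    obtain i where i: "dirn i l'" using composedD(1) l' by blast
    have kl: "dirn k l" using l(1) unfolding A_def by blast
    have ki: "k = i" using pts_subset_dirn[OF i kl] l' by blast
    have "l' \<in> A" using l' l(1) i ki unfolding A_def by blast
    then have "len l' \<le> len l" unfolding l(2) using A(1) by simp
    then show "l' = l" using pts_subset_antisym[of k l' l] i ki kl l' unfolding len_def by auto
  qed
  then show ?thesis using that l(1) unfolding A_def by blast
qed

text \<open>An interior edge continuing \<open>l\<close> beyond its end would merge with it into a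
  longer composed segment.\<close>

lemma maxl_end:
  assumes l: "l \<in> maxl" "dirn k l" and e: "e \<in> interior_edges M"
  shows "\<not> onq k s (if s then snd l else fst l) e"
proof
  let ?v = "if s then snd l else fst l"
  assume on: "onq k s ?v e"
  have ke: "dirn k e" using on unfolding onq_def by simp
  have cl: "composed l" using l unfolding maxl_def by blast
  have "?v \<in> pts l" using dirn_ends[OF l(2)] by simp
  then obtain m where m: "composed m" "dirn k m" "pts l \<subseteq> pts m" "pts e \<subseteq> pts m"
    using composed_merge[OF cl l(2) composed_edge[OF e] ke _ onq_pts[OF on]] by blast
  then have "m = l" using l(1) unfolding maxl_def by blast
  then show False using onq_ends[OF l(2) on] m(4) by (auto split: if_splits)
qed

lemma interior_iff_quads: "v \<in> vertices M \<Longrightarrow> v \<in> interior_vertices M \<longleftrightarrow> (\<forall>s. \<exists>C\<in>M. inq s v C)"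
  unfolding interior_vertices_def using interior_\<Phi>_iff[of v] unfolding \<Phi>_def by simp

text \<open>In both directions along \<open>l\<close> an interior edge leaves \<open>v\<close>; its
  two sides fill the two quadrants next to it, so all four are filled.\<close>

lemma inner_vertex:
  assumes l: "composed l" "dirn k l" and v: "v \<in> vertices M" "v \<in> pts l" "v \<noteq> fst l" "v \<noteq> snd l"
  shows "v \<in> interior_vertices M"
proof -
  have "co k v \<noteq> co k (fst l)" "co k v \<noteq> co k (snd l)"
    using v l(2) prod_eq_co2[of v "fst l" k] prod_eq_co2[of v "snd l" k] unfolding dirn_pts[OF l(2)] dirn_def by auto
  then have lt: "if s then co k v < co k (snd l) else co k (fst l) < co k v" for s
    using v(2) unfolding dirn_pts[OF l(2)] by auto
  have "\<exists>C\<in>M. inq r v C" for r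
  proof -
    obtain e where "e \<in> interior_edges M" "onq k (r k) v e" using composed_onq[OF l v(2) lt] by blast
    then show ?thesis using interior_edge_quads[of e k "r k" v "r (\<not> k)"] qd_surj[of r k] by simp
  qed
  then show ?thesis using interior_iff_quads[OF v(1)] by blast
qed

text \<open>If a perpendicular ray were no wall either, one cell would fill three quadrants and,
  being a box, the fourth too; this contradicts the wall opposite to the missing one.\<close>

lemma T_walls:
  assumes q: "\<And>s. \<exists>C\<in>M. inq s v C" and w: "wall k (\<not> s) v" and nw: "\<not> wall k s v"
  shows "wall (\<not> k) t v"
proof (rule ccontr)
  assume nt: "\<not> wall (\<not> k) t v"
  obtain D where D: "D \<in> M" "inq (qd k s t) v D" using q by blast
  then have "inq (qd k s (\<not> t)) v D" using nw unfolding wall_def by (metis (full_types))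
  moreover have "inq (qd k (\<not> s) t) v D"
    using D nt unfolding wall_def by (metis (full_types) qd_swap)
  ultimately have D2: "inq (qd k (\<not> s) (\<not> t)) v D" using D(2) unfolding inq_qd by (auto split: if_splits)
  obtain C u where C: "C \<in> M" "inq (qd k (\<not> s) u) v C" "\<not> inq (qd k (\<not> s) (\<not> u)) v C"
    using w unfolding wall_def by blast
  have "inq (qd k (\<not> s) u) v D" using D2 \<open>inq (qd k (\<not> s) t) v D\<close> by (cases "u = t") auto
  then have "C = D" using inq_unique C D by blast
  then show False using C(3) D2 \<open>inq (qd k (\<not> s) t) v D\<close> by (cases "u = t") auto
qed

lemma valence_star:
  assumes v: "v \<in> interior_vertices M"
  shows "valence M v = card (star v True True) + card (star v True False) + card (star v False True) + card (star v False False)"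
proof -
  have fin: "finite (star v k s)" for k s unfolding star_def using finite_interior_edges by auto
  have "{e \<in> edges M. fst e = v \<or> snd e = v} = star v True True \<union> star v True False \<union> star v False True \<union> star v False False" (is "?A = ?B")
  proof (intro equalityI subsetI)
    fix e assume "e \<in> ?A"
    then have e: "e \<in> edges M" "fst e = v \<or> snd e = v" by auto
    obtain k where k: "dirn k e" using edges_dirn[OF e(1)] by blast
    obtain s where s: "(if s then fst e else snd e) = v" using e(2) by (metis (full_types))
    have on: "onq k s v e" using s onq_fst[OF k] onq_snd[OF k] by (cases s) auto
    have "e \<in> interior_edges M" using interior_edgeI[OF e(1) on] interior_vertex_quads[OF v] by blast
    then have "e \<in> star v k s" using k s unfolding star_def by blast
    then show "e \<in> ?B" by (cases k; cases s) auto
  next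
    fix e assume "e \<in> ?B"
    then have "e \<in> interior_edges M \<and> (fst e = v \<or> snd e = v)" unfolding star_def by auto
    then show "e \<in> ?A" using interior_edge_edge[of e] by simp
  qed
  moreover have disj: "star v k s \<inter> star v k' s' = {}" if "k \<noteq> k' \<or> s \<noteq> s'" for k s k' s'
  proof (rule ccontr)
    assume "star v k s \<inter> star v k' s' \<noteq> {}"
    then obtain e where e: "e \<in> star v k s" "e \<in> star v k' s'" by blast
    then have "k = k'" using dirn_unique unfolding star_def by blast
    then have "s \<noteq> s'" using that by simp
    then have "fst e = snd e" using e unfolding star_def by (cases s; cases s') auto
    then show False using e dirn_ends unfolding star_def by blast
  qed
  ultimately show ?thesis
    unfolding valence_def using fin by (simp add: card_Un_disjoint Int_Un_distrib2)
qed

text \<open>At an interior end, maximality excludes a wall beyond the segment, while the segment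
  itself is a wall behind it; by \<open>T_walls\<close> both perpendicular rays are walls, which
  gives valence 3.\<close>

lemma maxl_end_cases:
  fixes s :: bool
  assumes l: "l \<in> maxl" "dirn k l"
  defines "v \<equiv> (if s then snd l else fst l)"
  shows "if v \<in> interior_vertices M then T_junction M v \<and> \<not> boundary_vertex M v else boundary_vertex M v \<and> \<not> T_junction M v"
proof -
  have cl: "composed l" using l unfolding maxl_def by blast
  have vv: "v \<in> vertices M" using composed_end_vertex[OF cl l(2)] by (simp add: v_def)
  have "\<Phi> = closure \<Phi>" unfolding \<Phi>_def using finite_M closed_cell by (metis closed_Union closure_closed)
  have "v \<in> \<Phi>"
  proof -
    obtain C where C: "C \<in> M" "\<forall>k. co k v = lo k C \<or> co k v = hi k C" using vv vertices_iff by blast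
    then have "v \<in> C" using lo_hi[OF C(1)] unfolding mem_cell[OF C(1)] by (metis less_imp_le order_refl)
    then show ?thesis using C unfolding \<Phi>_def by blast
  qed
  then have fr: "v \<in> frontier (\<Union>M) \<longleftrightarrow> v \<notin> interior (\<Union>M)"
    using \<open>\<Phi> = closure \<Phi>\<close> unfolding frontier_def \<Phi>_def by blast
  show ?thesis
  proof (cases "v \<in> interior_vertices M")
    case True
    have iv: "v \<in> interior (\<Union>M)" using True by (simp add: interior_vertices_def)
    have nw: "\<not> wall k s v"
    proof
      assume "wall k s v"
      then obtain e where "e \<in> star v k s" using star_exists[OF True] by blast
      then show False using star_onq[of e v k s] maxl_end[OF l, of e s] unfolding v_def star_def by auto
    qed
    have "if \<not> s then co k v < co k (snd l) else co k (fst l) < co k v"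
      using l(2) by (auto simp: v_def dirn_def)
    moreover have "v \<in> pts l" using dirn_ends[OF l(2)] by (simp add: v_def)
    ultimately obtain e where "e \<in> interior_edges M" "onq k (\<not> s) v e"
      using composed_onq[OF cl l(2), of v "\<not> s"] by blast
    then have w: "wall k (\<not> s) v" using wall_edge interior_edge_edge by blast
    have w2: "wall (\<not> k) t v" for t using T_walls[OF interior_vertex_quads[OF True] w nw] .
    have one: "card (star v i u) = 1" if "wall i u v" for i u using star_exists[OF True that] by (auto simp: card_1_singleton_iff)
    have zero: "card (star v k s) = 0" using star_empty[OF nw] by simp
    have "valence M v = 3"
      unfolding valence_star[OF True] using one[OF w] one[OF w2[of True]] one[OF w2[of False]] zero
      by (cases k; cases s) auto
    then show ?thesis using True fr iv unfolding T_junction_def boundary_vertex_def by simp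
  next
    case False
    then show ?thesis using vv fr unfolding T_junction_def boundary_vertex_def interior_vertices_def by simp
  qed
qed

lemma interior_l_edges_maxl: "interior_l_edges M = maxl"
proof
  show "interior_l_edges M \<subseteq> maxl" unfolding interior_l_edges_def maxl_def by blast
  show "maxl \<subseteq> interior_l_edges M"
  proof
    fix l assume l: "l \<in> maxl"
    then have "composed l" unfolding maxl_def by blast
    then obtain k where k: "dirn k l" using composedD(1) by blast
    have "\<forall>v\<in>{fst l, snd l}. T_junction M v \<or> boundary_vertex M v"
      using maxl_end_cases[OF l k, of True] maxl_end_cases[OF l k, of False] by (auto split: if_splits)
    then show "l \<in> interior_l_edges M" using l unfolding interior_l_edges_def maxl_def by blast
  qed
qed

lemma maxl_dirn: "l \<in> maxl \<Longrightarrow> \<exists>k. dirn k l"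
  unfolding maxl_def using composedD(1) by blast

lemma T_l_edges_maxl: "T_l_edges M = {l \<in> maxl. fst l \<in> interior_vertices M \<and> snd l \<in> interior_vertices M}"
proof -
  have "T_junction M (fst l) \<and> T_junction M (snd l) \<longleftrightarrow> fst l \<in> interior_vertices M \<and> snd l \<in> interior_vertices M" if "l \<in> maxl" for l
  proof -
    obtain k where k: "dirn k l" using maxl_dirn[OF \<open>l \<in> maxl\<close>] by blast
    show ?thesis
      using maxl_end_cases[OF that k, of True] maxl_end_cases[OF that k, of False] by (simp split: if_splits)
  qed
  then show ?thesis unfolding T_l_edges_def interior_l_edges_maxl by blast
qed

lemma cross_cuts_maxl: "cross_cuts M = {l \<in> maxl. fst l \<notin> interior_vertices M \<and> snd l \<notin> interior_vertices M}"
proof -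
  have "boundary_vertex M (fst l) \<and> boundary_vertex M (snd l) \<longleftrightarrow> fst l \<notin> interior_vertices M \<and> snd l \<notin> interior_vertices M" if "l \<in> maxl" for l
  proof -
    obtain k where k: "dirn k l" using maxl_dirn[OF \<open>l \<in> maxl\<close>] by blast
    show ?thesis
      using maxl_end_cases[OF that k, of True] maxl_end_cases[OF that k, of False] by (simp split: if_splits)
  qed
  then show ?thesis unfolding cross_cuts_def interior_l_edges_maxl by blast
qed

lemma finite_maxl: "finite maxl"
  by (rule finite_subset[OF _ finite_composed]) (auto simp: maxl_def)

text \<open>\<open>v\<close> is a corner of some cell, which fills a quadrant at \<open>v\<close>
  but neither neighbouring one; so there is a wall in each of the two directions.\<close>

lemma vertex_star_exists:
  assumes v: "v \<in> interior_vertices M"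
  obtains s e where "e \<in> star v k s"
proof -
  have "v \<in> vertices M" using v by (simp add: interior_vertices_def)
  then obtain C where C: "C \<in> M" "\<forall>k. co k v = lo k C \<or> co k v = hi k C" using vertices_iff by blast
  then have "v \<in> C" using lo_hi[OF C(1)] unfolding mem_cell[OF C(1)] by (metis less_imp_le order_refl)
  then obtain r where r: "inq r v C" using ex_inq[OF C(1)] by blast
  have "\<not> inq (r(\<not> k := \<not> r (\<not> k))) v C" using inq_flip[OF r] C(2) by blast
  moreover have "r(\<not> k := \<not> r (\<not> k)) = qd k (r k) (\<not> r (\<not> k))"
    using upd_qd[of r "\<not> k" "\<not> r (\<not> k)"] qd_swap[of k] by simp
  ultimately have "wall k (r k) v" using C(1) r qd_surj[of r k] unfolding wall_def by metis
  then show ?thesis using star_exists[OF v] that by blast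
qed

lemma maxl_through:
  assumes v: "v \<in> interior_vertices M"
  obtains l where "l \<in> maxl" "dirn k l" "v \<in> pts l"
proof -
  obtain s e where e: "e \<in> star v k s" using vertex_star_exists[OF v] by blast
  then have "e \<in> interior_edges M" "dirn k e" "v \<in> pts e" using star_onq onq_pts unfolding star_def by blast+
  then show ?thesis using maxl_exists[OF composed_edge] that by blast
qed

text \<open>The edges of direction \<open>k\<close> are counted by their lower endpoints.\<close>

lemma card_edges_dirn:
  "int (card {e \<in> interior_edges M. dirn k e}) = int (card (interior_vertices M))
     + int (card {l \<in> cross_cuts M. dirn k l}) - int (card {l \<in> T_l_edges M. dirn k l})"
proof -
  let ?E = "{e \<in> interior_edges M. dirn k e}"
  let ?I = "interior_vertices M"
  let ?P = "{l \<in> maxl. dirn k l \<and> fst l \<notin> ?I}"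
  let ?Q = "{l \<in> maxl. dirn k l \<and> snd l \<in> ?I}"
  have fI: "finite ?I" by (rule finite_interior_vertices)
  have fstE: "fst e \<in> vertices M" if "e \<in> ?E" for e
    using that unfolding interior_edges_def edges_def by auto
  have starE: "e \<in> star (fst e) k True" if "e \<in> ?E" for e using that unfolding star_def by auto
  have inj: "inj_on fst ?E"
  proof (rule inj_onI)
    fix e e' assume "e \<in> ?E" "e' \<in> ?E" "fst e = fst e'"
    then show "e = e'" using starE[of e] starE[of e'] star_unique by metis
  qed
  have cE: "card ?E = card (fst ` ?E)" using card_image[OF inj] by simp
  have fE: "finite (fst ` ?E)" using finite_interior_edges by simp
  have comp: "composed l" if "l \<in> maxl" for l using that unfolding maxl_def by blast
  \<comment> \<open>An edge whose lower endpoint is not interior is the initial edge of a maximal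
    segment.\<close>
  have bdry: "fst ` ?E - ?I = fst ` ?P"
  proof (intro equalityI subsetI)
    fix v assume v: "v \<in> fst ` ?E - ?I"
    then obtain e where e: "e \<in> ?E" "v = fst e" by blast
    obtain l where l: "l \<in> maxl" "dirn k l" "pts e \<subseteq> pts l"
      using maxl_exists[OF composed_edge] e(1) by blast
    have on: "onq k True v e" using e onq_fst by blast
    have "v \<in> pts l" using onq_pts[OF on] l(3) by blast
    moreover have "v \<noteq> snd l" using onq_ends[OF l(2) on l(3)] by auto
    moreover have "v \<in> vertices M" "v \<notin> ?I" using v fstE[OF e(1)] e(2) by auto
    ultimately have "v = fst l" using inner_vertex[OF comp[OF l(1)] l(2), of v] by metis
    then show "v \<in> fst ` ?P" using l v by blast
  next
    fix v assume "v \<in> fst ` ?P"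
    then obtain l where l: "l \<in> maxl" "dirn k l" "fst l \<notin> ?I" "v = fst l" by blast
    have "if True then co k v < co k (snd l) else co k (fst l) < co k v" using l(2,4) by (simp add: dirn_def)
    then obtain e where e: "e \<in> interior_edges M" "onq k True v e"
      using composed_onq[OF comp[OF l(1)] l(2), of v True] dirn_ends[OF l(2)] l(4) by blast
    have "v \<in> vertices M" using composed_end_vertex[OF comp[OF l(1)] l(2)] l(4) by simp
    then have "e \<in> star v k True" using vertex_onq e by blast
    then have "v \<in> fst ` ?E" unfolding star_def by (intro rev_image_eqI[of e]) auto
    then show "v \<in> fst ` ?E - ?I" using l(3,4) by simp
  qed
  \<comment> \<open>An interior vertex without an edge leaving it in this direction is the upper end
    of the maximal segment through it.\<close>
  have inn: "?I - fst ` ?E = snd ` ?Q"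
  proof (intro equalityI subsetI)
    fix v assume v: "v \<in> ?I - fst ` ?E"
    have vv: "v \<in> vertices M" using v by (simp add: interior_vertices_def)
    obtain l where l: "l \<in> maxl" "dirn k l" "v \<in> pts l" using maxl_through v by blast
    have "v = snd l"
    proof (rule ccontr)
      assume "v \<noteq> snd l"
      then have "co k v < co k (snd l)"
        using l(2,3) prod_eq_co2[of v "snd l" k] unfolding dirn_pts[OF l(2)] dirn_def by auto
      then obtain e where e: "e \<in> interior_edges M" "onq k True v e"
        using composed_onq[OF comp[OF l(1)] l(2,3), of True] by auto
      then have "e \<in> star v k True" using vertex_onq vv by blast
      then have "v \<in> fst ` ?E" unfolding star_def by auto
      then show False using v by blast
    qed
    then show "v \<in> snd ` ?Q" using l v by blast
  next
    fix v assume "v \<in> snd ` ?Q"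
    then obtain l where l: "l \<in> maxl" "dirn k l" "snd l \<in> ?I" "v = snd l" by blast
    have "v \<notin> fst ` ?E"
    proof
      assume "v \<in> fst ` ?E"
      then obtain e where "e \<in> interior_edges M" "onq k True v e" using onq_fst by auto
      then show False using maxl_end[OF l(1,2), of e True] l(4) by simp
    qed
    then show "v \<in> ?I - fst ` ?E" using l by blast
  qed
  have injP: "inj_on fst ?P"
  proof (rule inj_onI)
    fix l l' assume "l \<in> ?P" "l' \<in> ?P" "fst l = fst l'"
    then show "l = l'" using maxl_unique[of l l' k "fst l"] dirn_ends[of k l] dirn_ends[of k l'] by auto
  qed
  have injQ: "inj_on snd ?Q"
  proof (rule inj_onI)
    fix l l' assume "l \<in> ?Q" "l' \<in> ?Q" "snd l = snd l'"
    then show "l = l'" using maxl_unique[of l l' k "snd l"] dirn_ends[of k l] dirn_ends[of k l'] by auto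
  qed
  have 1: "int (card (fst ` ?E)) = int (card (fst ` ?E \<inter> ?I)) + int (card ?P)"
    using card_Int_Diff[OF fE, of ?I] card_image[OF injP] bdry by simp
  have 2: "int (card ?I) = int (card (fst ` ?E \<inter> ?I)) + int (card ?Q)"
    using card_Int_Diff[OF fI, of "fst ` ?E"] card_image[OF injQ] inn by (simp add: Int_commute)
  \<comment> \<open>The rays starting on the boundary occur in both counts and cancel.\<close>
  let ?R = "{l \<in> maxl. dirn k l \<and> fst l \<notin> ?I \<and> snd l \<in> ?I}"
  have "?P = {l \<in> cross_cuts M. dirn k l} \<union> ?R" unfolding cross_cuts_maxl by blast
  moreover have "{l \<in> cross_cuts M. dirn k l} \<inter> ?R = {}" unfolding cross_cuts_maxl by blast
  ultimately have 3: "card ?P = card {l \<in> cross_cuts M. dirn k l} + card ?R"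
    using finite_maxl card_Un_disjoint[of "{l \<in> cross_cuts M. dirn k l}" ?R] unfolding cross_cuts_maxl by simp
  have "?Q = {l \<in> T_l_edges M. dirn k l} \<union> ?R" unfolding T_l_edges_maxl by blast
  moreover have "{l \<in> T_l_edges M. dirn k l} \<inter> ?R = {}" unfolding T_l_edges_maxl by blast
  ultimately have 4: "card ?Q = card {l \<in> T_l_edges M. dirn k l} + card ?R"
    using finite_maxl card_Un_disjoint[of "{l \<in> T_l_edges M. dirn k l}" ?R] unfolding T_l_edges_maxl by simp
  show ?thesis using 1 2 3 4 cE by linarith
qed

lemma card_dirn_split:
  assumes "finite A" "\<And>e. e \<in> A \<Longrightarrow> \<exists>k. dirn k e"
  shows "card A = card {e \<in> A. dirn True e} + card {e \<in> A. dirn False e}"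
proof -
  have "A = {e \<in> A. dirn True e} \<union> {e \<in> A. dirn False e}"
  proof -
    have "dirn True e \<or> dirn False e" if "e \<in> A" for e using assms(2)[OF that] by (metis (full_types))
    then show ?thesis by blast
  qed
  moreover have "{e \<in> A. dirn True e} \<inter> {e \<in> A. dirn False e} = {}"
    using dirn_unique[of True _ False] by blast
  ultimately show ?thesis using assms(1) card_Un_disjoint[of "{e \<in> A. dirn True e}" "{e \<in> A. dirn False e}"] by simp
qed

lemma card_interior_edges:
  "int (card (interior_edges M)) = 2 * int (card (interior_vertices M)) + int (card (cross_cuts M)) - int (card (T_l_edges M))"
proof -
  have f: "finite (cross_cuts M)" "finite (T_l_edges M)"
    using finite_maxl unfolding cross_cuts_maxl T_l_edges_maxl by auto
  have "\<exists>k. dirn k e" if "e \<in> cross_cuts M \<or> e \<in> T_l_edges M" for e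
    using that maxl_dirn unfolding cross_cuts_maxl T_l_edges_maxl by blast
  then show ?thesis
    using card_dirn_split[OF f(1)] card_dirn_split[OF f(2)] card_dirn_split[OF finite_interior_edges interior_edge_dirn]
      card_edges_dirn[of True] card_edges_dirn[of False] by simp
qed

end

section \<open>The homological correction term\<close>

lemma sum_fun_apply: "(\<Sum>x\<in>A. f x) z = (\<Sum>x\<in>A. f x z)"
  by (induction A rule: infinite_finite_induct) auto

context spline_mesh
begin

definition boundaries :: "(real \<times> real \<Rightarrow> real poly poly) set" where
  "boundaries = bdry M ` edge_chains M d"

definition vertex_single :: "real \<times> real \<Rightarrow> real poly poly \<Rightarrow> real \<times> real \<Rightarrow> real poly poly" where
  "vertex_single v p w = (if w = v \<and> v \<in> interior_vertices M then p else 0)"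

definition edge_single :: "seg \<Rightarrow> real poly poly \<Rightarrow> seg \<Rightarrow> real poly poly" where
  "edge_single e p e' = (if e' = e then p else 0)"

lemma edge_chains_has_dim: "ch.has_dim (edge_chains M d) (card (interior_edges M) * (d + 1))"
proof -
  have "pp.has_dim (J_edge d e) (d + 1)" if "e \<in> interior_edges M" for e
    using interior_edge_dirn[OF that] J_edge_Jspace Jspace_has_dim by metis
  then have "ch.has_dim {f. (\<forall>e\<in>interior_edges M. f e \<in> J_edge d e) \<and> (\<forall>e. e \<notin> interior_edges M \<longrightarrow> f e = 0)}
      (\<Sum>e\<in>interior_edges M. d + 1)"
    by (rule chains_has_dim[OF finite_interior_edges])
  then show ?thesis unfolding edge_chains_def by simp
qed

lemma vertex_chains_has_dim: "ch.has_dim (vertex_chains M d) (card (interior_vertices M) * (2 * d + 1))"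
proof -
  have "ch.has_dim {g. (\<forall>v\<in>interior_vertices M. g v \<in> J_vertex d v) \<and> (\<forall>v. v \<notin> interior_vertices M \<longrightarrow> g v = 0)}
      (\<Sum>v\<in>interior_vertices M. 2 * d + 1)"
    by (rule chains_has_dim[OF finite_interior_vertices J_vertex_has_dim[OF d1]])
  then show ?thesis unfolding vertex_chains_def by simp
qed

lemma boundaries_vertex_chains: "boundaries \<subseteq> vertex_chains M d"
proof
  fix g assume "g \<in> boundaries"
  then obtain f where f: "f \<in> edge_chains M d" "g = bdry M f" unfolding boundaries_def by blast
  have J: "f e \<in> J_vertex d v" if e: "e \<in> interior_edges M" and v: "fst e = v \<or> snd e = v" for e v
  proof -
    obtain k where k: "dirn k e" using interior_edge_dirn[OF e] by blast
    have "co (\<not> k) (fst e) = co (\<not> k) v" using v k unfolding dirn_def by auto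
    then have "f e \<in> Jspace d k (co (\<not> k) v)"
      using f(1) e J_edge_Jspace[OF k] unfolding edge_chains_def by auto
    then show ?thesis by (rule Jspace_J_vertex)
  qed
  have "bdry M f v \<in> J_vertex d v" if "v \<in> interior_vertices M" for v
    unfolding bdry_def using that J
    by (auto intro!: pp.subspace_diff[OF J_vertex_subspace] pp.subspace_sum[OF J_vertex_subspace])
  then show "g \<in> vertex_chains M d" unfolding vertex_chains_def f(2) by (simp add: bdry_def)
qed

lemma homology_dims:
  obtains r n where "ch.has_dim boundaries r" "ch.has_dim cycles n"
    "card (interior_edges M) * (d + 1) = n + r" "hom_corr M d + r = card (interior_vertices M) * (2 * d + 1)"
proof -
  obtain n r where nr: "ch.has_dim {f \<in> edge_chains M d. bdry M f = 0} n"
    "ch.has_dim (bdry M ` edge_chains M d) r" "card (interior_edges M) * (d + 1) = n + r"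
    by (rule ch_ch.rank_nullity[OF linear_bdry edge_chains_has_dim])
  have "hom_corr M d + r = card (interior_vertices M) * (2 * d + 1)"
    unfolding hom_corr_def
    using ch.quot_dim_has_dim[OF nr(2) vertex_chains_has_dim] boundaries_vertex_chains unfolding boundaries_def by blast
  then show ?thesis using that nr unfolding boundaries_def cycles_def by blast
qed

text \<open>The vertex count enters with coefficient 2 (d + 1) - (2 d + 1) = 1: each vertex accounts
  for two edges and for one space of dimension 2 d + 1.\<close>

lemma dim_splines_formula: "int (dim_splines M d) = B0 M d + int (hom_corr M d)"
proof -
  obtain r n where h: "ch.has_dim boundaries r" "ch.has_dim cycles n"
    "card (interior_edges M) * (d + 1) = n + r" "hom_corr M d + r = card (interior_vertices M) * (2 * d + 1)"
    using homology_dims by metis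
  have 1: "int (card (interior_edges M)) * (int d + 1) = int n + int r"
    using arg_cong[OF h(3), of int] by (simp add: algebra_simps)
  have 2: "int (hom_corr M d) + int r = int (card (interior_vertices M)) * (2 * int d + 1)"
    using arg_cong[OF h(4), of int] by (simp add: algebra_simps)
  have 3: "int (dim_splines M d) = (int d + 1)\<^sup>2 + int n"
    using arg_cong[OF dim_splines_cycles[OF h(2)], of int] by (simp add: power2_eq_square algebra_simps)
  show ?thesis
    using 1 2 3 unfolding B0_def card_interior_edges by (simp add: algebra_simps)
qed

section \<open>Moving vertex chains along l-edges modulo boundaries\<close>

lemma boundaries_subspace: "chain_vs.subspace boundaries"
  using homology_dims ch.has_dim_subspace by metis

lemma bdry_edge_single:
  assumes "e \<in> interior_edges M"
  shows "bdry M (edge_single e p) = vertex_single (snd e) p - vertex_single (fst e) p"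
proof
  fix v
  have s: "(\<Sum>e'\<in>{e \<in> interior_edges M. h e = v}. edge_single e p e') = (if h e = v then p else 0)" for h :: "seg \<Rightarrow> real \<times> real"
  proof -
    have "(\<Sum>e'\<in>{e \<in> interior_edges M. h e = v}. edge_single e p e') = (\<Sum>e'\<in>{e \<in> interior_edges M. h e = v}. if e = e' then p else 0)"
      by (rule sum.cong) (auto simp: edge_single_def)
    also have "\<dots> = (if h e = v then p else 0)" using finite_interior_edges assms by simp
    finally show ?thesis .
  qed
  show "bdry M (edge_single e p) v = (vertex_single (snd e) p - vertex_single (fst e) p) v"
    using s[of fst] s[of snd] by (auto simp: bdry_def vertex_single_def)
qed

lemma vertex_single_edge_boundaries:
  assumes "e \<in> interior_edges M" "p \<in> J_edge d e"
  shows "vertex_single (snd e) p - vertex_single (fst e) p \<in> boundaries"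
proof -
  have "0 \<in> J_edge d e'" for e' using bipolys_0 by (simp add: J_edge_def)
  then have "edge_single e p \<in> edge_chains M d" using assms unfolding edge_chains_def edge_single_def by auto
  then show ?thesis unfolding boundaries_def bdry_edge_single[OF assms(1), symmetric] by blast
qed

lemma sub_J_edge:
  assumes "dirn k l" "dirn k e" "pts e \<subseteq> pts l"
  shows "J_edge d e = J_edge d l"
  using J_edge_Jspace assms pts_subset_iff[OF assms(1,2)] by simp

lemma maxl_composed: "l \<in> maxl \<Longrightarrow> composed l"
  unfolding maxl_def by blast

text \<open>A telescoping sum of edge boundaries along \<open>l\<close>, organised as an extremal
  argument.\<close>

lemma vertex_single_end_boundaries:
  assumes l: "l \<in> maxl" "dirn k l" and p: "p \<in> J_edge d l" and v: "v \<in> vertices M" "v \<in> pts l"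
  shows "vertex_single v p - vertex_single (snd l) p \<in> boundaries"
proof (rule ccontr)
  \<comment> \<open>The counterexample farthest along \<open>l\<close> is followed by an edge whose
    other end is no counterexample.\<close>
  define S where "S = {v \<in> vertices M. v \<in> pts l \<and> vertex_single v p - vertex_single (snd l) p \<notin> boundaries}"
  assume "vertex_single v p - vertex_single (snd l) p \<notin> boundaries"
  then have "v \<in> S" using v unfolding S_def by blast
  moreover have "finite S" using finite_vertices unfolding S_def by simp
  ultimately have S: "finite S" "S \<noteq> {}" by auto
  then have "Max (co k ` S) \<in> co k ` S" by (intro Max_in) auto
  then obtain u where u: "u \<in> S" "co k u = Max (co k ` S)" by (metis imageE)
  have un: "u \<in> vertices M" "u \<in> pts l" "vertex_single u p - vertex_single (snd l) p \<notin> boundaries" using u unfolding S_def by auto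
  have "u \<noteq> snd l" using un(3) chain_vs.subspace_0[OF boundaries_subspace] by auto
  then have "co k u < co k (snd l)"
    using un(2) l(2) prod_eq_co2[of u "snd l" k] unfolding dirn_pts[OF l(2)] dirn_def by auto
  then obtain e where e: "e \<in> interior_edges M" "pts e \<subseteq> pts l" "onq k True u e"
    using composed_onq[OF maxl_composed[OF l(1)] l(2) un(2), of True] by auto
  then have ke: "dirn k e" "fst e = u" using vertex_onq[OF un(1) e(1,3)] unfolding star_def by auto
  have w: "snd e \<in> vertices M" "snd e \<in> pts l" "co k u < co k (snd e)"
    using e ke dirn_ends[OF ke(1)] unfolding interior_edges_def edges_def dirn_def by auto
  have "snd e \<notin> S"
  proof
    assume "snd e \<in> S"
    then have "co k (snd e) \<le> Max (co k ` S)" using S by simp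
    then show False using w(3) u(2) by simp
  qed
  then have "vertex_single (snd e) p - vertex_single (snd l) p \<in> boundaries" using w unfolding S_def by blast
  moreover have "vertex_single (snd e) p - vertex_single u p \<in> boundaries"
    using vertex_single_edge_boundaries[OF e(1)] p sub_J_edge[OF l(2) ke(1) e(2)] ke(2) by blast
  ultimately have "(vertex_single (snd e) p - vertex_single (snd l) p) - (vertex_single (snd e) p - vertex_single u p) \<in> boundaries"
    using chain_vs.subspace_diff[OF boundaries_subspace] by blast
  then show False using un(3) by simp
qed

lemma vertex_single_move:
  assumes l: "l \<in> maxl" "dirn k l" and p: "p \<in> J_edge d l"
    and v: "v \<in> vertices M" "v \<in> pts l" and w: "w \<in> vertices M" "w \<in> pts l"
  shows "vertex_single v p - vertex_single w p \<in> boundaries"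
proof -
  have "(vertex_single v p - vertex_single (snd l) p) - (vertex_single w p - vertex_single (snd l) p) \<in> boundaries"
    using vertex_single_end_boundaries[OF l p v] vertex_single_end_boundaries[OF l p w] chain_vs.subspace_diff[OF boundaries_subspace] by blast
  then show ?thesis by simp
qed

lemma vertex_single_non_T:
  assumes l: "l \<in> maxl" "dirn k l" "l \<notin> T_l_edges M" and p: "p \<in> J_edge d l" and v: "v \<in> vertices M" "v \<in> pts l"
  shows "vertex_single v p \<in> boundaries"
proof -
  obtain w where w: "w = fst l \<or> w = snd l" "w \<notin> interior_vertices M" using l(1,3) unfolding T_l_edges_maxl by blast
  have "w \<in> vertices M" "w \<in> pts l"
    using w(1) composed_end_vertex[OF maxl_composed[OF l(1)] l(2)] dirn_ends[OF l(2)] by auto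
  then have "vertex_single v p - vertex_single w p \<in> boundaries" using vertex_single_move[OF l(1,2) p v] by blast
  moreover have "vertex_single w p = 0" using w(2) by (auto simp: vertex_single_def fun_eq_iff)
  ultimately show ?thesis by simp
qed

lemma T_vertex_interior:
  assumes l: "l \<in> T_l_edges M" and v: "v \<in> vertices M" "v \<in> pts l"
  shows "v \<in> interior_vertices M"
proof -
  have m: "l \<in> maxl" "fst l \<in> interior_vertices M" "snd l \<in> interior_vertices M" using l unfolding T_l_edges_maxl by auto
  obtain k where k: "dirn k l" using maxl_dirn[OF m(1)] by blast
  show ?thesis using inner_vertex[OF maxl_composed[OF m(1)] k v] m by blast
qed

lemma vertex_single_linear: "vertex_single v (p + q) = vertex_single v p + vertex_single v q" "vertex_single v (smult [:c:] p) = (\<lambda>z. smult [:c:] (vertex_single v p z))"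
  "vertex_single v (p - q) = vertex_single v p - vertex_single v q"
  by (auto simp: vertex_single_def fun_eq_iff)

section \<open>Upper bound by generators of the cokernel\<close>

lemma boundaries_span: "x \<in> boundaries \<Longrightarrow> x \<in> chain_vs.span (boundaries \<union> B)"
  by (rule chain_vs.span_base) simp

text \<open>The product of both pure powers at \<open>v\<close> also belongs to the perpendicular
  l-edge through \<open>v\<close>. That l-edge either reaches the boundary, where the chain dies, or
  is a T l-edge already accounted for.\<close>

lemma cross_relation:
  assumes l: "l \<in> T_l_edges M" "dirn k l" and v: "v \<in> vertices M" "v \<in> pts l"
    and prev: "\<And>l' p. l' \<in> T_l_edges M \<Longrightarrow> l' \<noteq> l \<Longrightarrow> v \<in> pts l' \<Longrightarrow> p \<in> J_edge d l' \<Longrightarrow> vertex_single v p \<in> chain_vs.span (boundaries \<union> B)"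
  shows "vertex_single v (emb (\<not> k) (lpow d (co (\<not> k) v)) * emb k (lpow d (co k v))) \<in> chain_vs.span (boundaries \<union> B)"
proof -
  have vi: "v \<in> interior_vertices M" using T_vertex_interior[OF l(1) v] .
  obtain l' where l': "l' \<in> maxl" "dirn (\<not> k) l'" "v \<in> pts l'" using maxl_through[OF vi] by blast
  let ?p = "emb (\<not> k) (lpow d (co (\<not> k) v)) * emb k (lpow d (co k v))"
  have "?p \<in> Jspace d (\<not> k) (co k v)"
    unfolding Jspace_def by (intro CollectI exI[of _ "lpow d (co (\<not> k) v)"]) (simp add: mult.commute)
  moreover have "co k v = co k (fst l')" using l'(3) dirn_pts[OF l'(2)] by simp
  ultimately have p: "?p \<in> J_edge d l'" using J_edge_Jspace[OF l'(2)] by simp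
  show ?thesis
  proof (cases "l' \<in> T_l_edges M")
    case True
    moreover have "l' \<noteq> l" using l(2) l'(2) dirn_unique by blast
    ultimately show ?thesis using prev l'(3) p by blast
  next
    case False
    then show ?thesis using vertex_single_non_T[OF l'(1,2) False p v(1) l'(3)] boundaries_span by blast
  qed
qed

text \<open>Moved to one end of \<open>l\<close>, its chains form a copy of the polynomials of
  degree at most \<open>d\<close>. The vertices in \<open>G\<close> supply pure powers at distinct
  nodes that are already spanned; only the missing nodes cost new generators.\<close>

lemma span_extend:
  assumes l: "l \<in> T_l_edges M" "dirn k l" and B: "finite B"
    and G: "finite G" "\<And>v. v \<in> G \<Longrightarrow> v \<in> vertices M \<and> v \<in> pts l"
    and rel: "\<And>v. v \<in> G \<Longrightarrow> vertex_single v (emb (\<not> k) (lpow d (co (\<not> k) v)) * emb k (lpow d (co k v))) \<in> chain_vs.span (boundaries \<union> B)"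
  obtains B' where "finite B'" "B \<subseteq> B'" "int (card B') \<le> int (card B) + pos_part (int d + 1 - int (card G))"
    "\<And>v p. v \<in> vertices M \<Longrightarrow> v \<in> pts l \<Longrightarrow> p \<in> J_edge d l \<Longrightarrow> vertex_single v p \<in> chain_vs.span (boundaries \<union> B')"
proof -
  define c where "c = co (\<not> k) (fst l)"
  define F where "F q = vertex_single (fst l) (emb (\<not> k) (lpow d c) * emb k q)" for q
  have ml: "l \<in> maxl" using l(1) unfolding T_l_edges_maxl by blast
  have J: "J_edge d l = Jspace d k c" using J_edge_Jspace[OF l(2)] by (simp add: c_def)
  have fl: "fst l \<in> vertices M" "fst l \<in> pts l"
    using composed_end_vertex[OF maxl_composed[OF ml] l(2)] dirn_ends[OF l(2)] by auto
  have relF: "F (lpow d (co k v)) \<in> chain_vs.span (boundaries \<union> B)" if v: "v \<in> G" for v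
  proof -
    have cv: "co (\<not> k) v = c" using G(2)[OF v] dirn_pts[OF l(2)] by (simp add: c_def)
    let ?p = "emb (\<not> k) (lpow d c) * emb k (lpow d (co k v))"
    have "?p \<in> J_edge d l" unfolding J Jspace_def by auto
    then have "vertex_single (fst l) ?p - vertex_single v ?p \<in> boundaries" using vertex_single_move[OF ml l(2)] fl G(2)[OF v] by blast
    then have "(vertex_single (fst l) ?p - vertex_single v ?p) + vertex_single v ?p \<in> chain_vs.span (boundaries \<union> B)"
      using chain_vs.span_add boundaries_span rel[OF v] cv by metis
    then show ?thesis by (simp add: F_def)
  qed
  have inj: "inj_on (co k) G"
  proof (rule inj_onI)
    fix v w assume "v \<in> G" "w \<in> G" "co k v = co k w"
    then show "v = w" using G(2) prod_eq_co2[of v w k] unfolding dirn_pts[OF l(2)] by auto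
  qed
  have cG: "card (co k ` G) = card G" using card_image[OF inj] .
  \<comment> \<open>Exactly \<open>d + 1\<close> nodes are collected: too few vertices are
    supplemented by arbitrary reals \<open>N\<close>, while from too many a subset is taken with
    \<open>N\<close> empty.\<close>
  obtain N S where NS: "finite N" "S \<subseteq> co k ` G" "card (S \<union> N) = Suc d" "finite S" "int (card N) \<le> pos_part (int d + 1 - int (card G))"
  proof (cases "card G \<le> d")
    case True
    have "infinite (UNIV - co k ` G)" using G(1) by (simp add: infinite_UNIV_char_0)
    then obtain N where N: "finite N" "card N = Suc d - card G" "N \<subseteq> UNIV - co k ` G"
      using infinite_arbitrarily_large by blast
    have "co k ` G \<inter> N = {}" using N(3) by blast
    then have "card (co k ` G \<union> N) = Suc d" using G(1) N cG True by (simp add: card_Un_disjoint)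
    then show ?thesis using that[of N "co k ` G"] N G(1) True by (simp add: pos_part_def)
  next
    case False
    then obtain S where "S \<subseteq> co k ` G" "card S = Suc d" using cG obtain_subset_with_card_n[of "Suc d" "co k ` G"] by auto
    then show ?thesis using that[of "{}" S] G(1) finite_subset by (auto simp: pos_part_def)
  qed
  define B' where "B' = B \<union> (\<lambda>g. F (lpow d g)) ` N"
  have fB': "finite B'" using B NS(1) by (simp add: B'_def)
  have "card B' \<le> card B + card N"
    unfolding B'_def using card_Un_le[of B "(\<lambda>g. F (lpow d g)) ` N"] card_image_le[OF NS(1), of "\<lambda>g. F (lpow d g)"] by linarith
  then have cB': "int (card B') \<le> int (card B) + pos_part (int d + 1 - int (card G))" using NS(5) by linarith
  let ?W = "chain_vs.span (boundaries \<union> B')"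
  have mono: "chain_vs.span (boundaries \<union> B) \<subseteq> ?W" by (rule chain_vs.span_mono) (auto simp: B'_def)
  have F: "F (a + b) = F a + F b" "F (smult c a) = (\<lambda>z. smult [:c:] (F a z))" "F 0 = 0" for a b c
    by (simp_all add: F_def emb_add emb_smult vertex_single_linear distrib_left) (simp add: vertex_single_def fun_eq_iff)
  have sub: "rp.subspace {q. F q \<in> ?W}"
    unfolding rp.subspace_def using F chain_vs.span_zero chain_vs.span_add chain_vs.span_scale by auto
  have base: "lpow d ` (S \<union> N) \<subseteq> {q. F q \<in> ?W}"
  proof
    fix q assume "q \<in> lpow d ` (S \<union> N)"
    then consider v where "v \<in> G" "q = lpow d (co k v)" | g where "g \<in> N" "q = lpow d g" using NS(2) by blast
    then show "q \<in> {q. F q \<in> ?W}"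
    proof cases
      case 1
      then show ?thesis using relF mono by blast
    next
      case 2
      then have "F q \<in> boundaries \<union> B'" by (simp add: B'_def)
      then show ?thesis using chain_vs.span_base by blast
    qed
  qed
  have FW: "F q \<in> ?W" if "degree q \<le> d" for q
  proof -
    have "q \<in> rp.span (lpow d ` (S \<union> N))" using lpow_spanning[of "S \<union> N"] NS that by simp
    then show ?thesis using rp.span_minimal[OF base sub] by blast
  qed
  have "vertex_single v p \<in> ?W" if v: "v \<in> vertices M" "v \<in> pts l" and p: "p \<in> J_edge d l" for v p
  proof -
    obtain q where q: "degree q \<le> d" "p = emb (\<not> k) (lpow d c) * emb k q" using p unfolding J Jspace_def by blast
    have "vertex_single v p - vertex_single (fst l) p \<in> boundaries" using vertex_single_move[OF ml l(2) p v fl] .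
    then have "(vertex_single v p - vertex_single (fst l) p) + vertex_single (fst l) p \<in> ?W"
      using chain_vs.span_add boundaries_span FW[OF q(1)] unfolding F_def q(2)[symmetric] by blast
    then show ?thesis by simp
  qed
  then show ?thesis using that[OF fB' _ cB'] by (auto simp: B'_def)
qed

text \<open>\<open>\<omega>\<close> counts the vertices on no later edge. At such a vertex any other
  T l-edge comes earlier, so its chains are already spanned and \<open>cross_relation\<close>
  applies.\<close>

lemma spanning_order:
  assumes i: "distinct \<iota>" "set \<iota> = T_l_edges M" and n: "n \<le> length \<iota>"
  shows "\<exists>B. finite B \<and> int (card B) \<le> (\<Sum>i<n. pos_part (int d + 1 - int (\<omega> M \<iota> i))) \<and>
    (\<forall>i<n. \<forall>v\<in>vertices M \<inter> pts (\<iota> ! i). \<forall>p\<in>J_edge d (\<iota> ! i). vertex_single v p \<in> chain_vs.span (boundaries \<union> B))"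
  using n
proof (induction n)
  case 0
  then show ?case by (intro exI[of _ "{}"]) auto
next
  case (Suc n)
  then obtain B where B: "finite B" "int (card B) \<le> (\<Sum>i<n. pos_part (int d + 1 - int (\<omega> M \<iota> i)))"
    "\<And>i v p. i < n \<Longrightarrow> v \<in> vertices M \<inter> pts (\<iota> ! i) \<Longrightarrow> p \<in> J_edge d (\<iota> ! i) \<Longrightarrow> vertex_single v p \<in> chain_vs.span (boundaries \<union> B)"
    by auto
  let ?l = "\<iota> ! n"
  have lT: "?l \<in> T_l_edges M" using i(2) Suc(2) by (metis Suc_le_lessD nth_mem)
  obtain k where k: "dirn k ?l" using lT maxl_dirn unfolding T_l_edges_maxl by blast
  define G where "G = {v \<in> vertices M. v \<in> pts ?l \<and> \<not> (\<exists>j. n < j \<and> j < length \<iota> \<and> v \<in> pts (\<iota> ! j))}"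
  have fG: "finite G" using finite_vertices by (simp add: G_def)
  have cG: "card G = \<omega> M \<iota> n" by (simp add: G_def \<omega>_def)
  have rel: "vertex_single v (emb (\<not> k) (lpow d (co (\<not> k) v)) * emb k (lpow d (co k v))) \<in> chain_vs.span (boundaries \<union> B)" if v: "v \<in> G" for v
  proof (rule cross_relation[OF lT k])
    show "v \<in> vertices M" "v \<in> pts ?l" using v by (auto simp: G_def)
    fix l' p assume l': "l' \<in> T_l_edges M" "l' \<noteq> ?l" "v \<in> pts l'" "p \<in> J_edge d l'"
    obtain j where j: "j < length \<iota>" "l' = \<iota> ! j" using l'(1) i(2) by (metis in_set_conv_nth)
    have "j < n" using j l'(2,3) v unfolding G_def by (metis (mono_tags, lifting) linorder_neqE_nat mem_Collect_eq)
    then show "vertex_single v p \<in> chain_vs.span (boundaries \<union> B)" using B(3) l' j v by (simp add: G_def)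
  qed
  obtain B' where B': "finite B'" "B \<subseteq> B'" "int (card B') \<le> int (card B) + pos_part (int d + 1 - int (card G))"
    "\<And>v p. v \<in> vertices M \<Longrightarrow> v \<in> pts ?l \<Longrightarrow> p \<in> J_edge d ?l \<Longrightarrow> vertex_single v p \<in> chain_vs.span (boundaries \<union> B')"
    by (rule span_extend[OF lT k B(1) fG _ rel]) (auto simp: G_def)
  have mono: "chain_vs.span (boundaries \<union> B) \<subseteq> chain_vs.span (boundaries \<union> B')" by (rule chain_vs.span_mono) (use B'(2) in auto)
  have "int (card B') \<le> (\<Sum>i<Suc n. pos_part (int d + 1 - int (\<omega> M \<iota> i)))" using B'(3) B(2) cG by simp
  moreover have "\<forall>i<Suc n. \<forall>v\<in>vertices M \<inter> pts (\<iota> ! i). \<forall>p\<in>J_edge d (\<iota> ! i). vertex_single v p \<in> chain_vs.span (boundaries \<union> B')"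
  proof (intro allI impI ballI)
    fix i v p assume a: "i < Suc n" "v \<in> vertices M \<inter> pts (\<iota> ! i)" "p \<in> J_edge d (\<iota> ! i)"
    show "vertex_single v p \<in> chain_vs.span (boundaries \<union> B')"
    proof (cases "i = n")
      case True
      then show ?thesis using a B'(4) by blast
    next
      case False
      then show ?thesis using a B(3)[of i v p] mono by auto
    qed
  qed
  ultimately show ?case using B'(1) by blast
qed

lemma vertex_chain_sum:
  assumes "g \<in> vertex_chains M d"
  shows "g = (\<Sum>v\<in>interior_vertices M. vertex_single v (g v))"
proof
  fix w
  have "(\<Sum>v\<in>interior_vertices M. vertex_single v (g v)) w = (\<Sum>v\<in>interior_vertices M. if v = w then g v else 0)"
    unfolding sum_fun_apply by (rule sum.cong) (auto simp: vertex_single_def)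
  also have "\<dots> = (if w \<in> interior_vertices M then g w else 0)" using finite_interior_vertices by simp
  also have "\<dots> = g w"
  proof -
    have "g w = 0" if "w \<notin> interior_vertices M" using assms that unfolding vertex_chains_def by blast
    then show ?thesis by simp
  qed
  finally show "g w = (\<Sum>v\<in>interior_vertices M. vertex_single v (g v)) w" by simp
qed

text \<open>The value of a chain at an interior vertex splits into contributions of the two l-edges
  through it; each is a boundary or is spanned by the generators collected along the order.\<close>

lemma hom_corr_le_D_M:
  assumes i: "\<iota> \<in> permutations_of_set (T_l_edges M)"
  shows "int (hom_corr M d) \<le> D_M M d \<iota>"
proof -
  have i': "distinct \<iota>" "set \<iota> = T_l_edges M" using i by (auto simp: permutations_of_set_def)
  obtain B where B: "finite B" "int (card B) \<le> (\<Sum>i<length \<iota>. pos_part (int d + 1 - int (\<omega> M \<iota> i)))"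
    "\<forall>i<length \<iota>. \<forall>v\<in>vertices M \<inter> pts (\<iota> ! i). \<forall>p\<in>J_edge d (\<iota> ! i). vertex_single v p \<in> chain_vs.span (boundaries \<union> B)"
    using spanning_order[OF i' order_refl] by blast
  let ?W = "chain_vs.span (boundaries \<union> B)"
  have sp: "vertex_single v p \<in> ?W" if v: "v \<in> interior_vertices M" and p: "p \<in> Jspace d k (co (\<not> k) v)" for v p k
  proof -
    have vv: "v \<in> vertices M" using v by (simp add: interior_vertices_def)
    obtain l where l: "l \<in> maxl" "dirn k l" "v \<in> pts l" using maxl_through[OF v] by blast
    have pJ: "p \<in> J_edge d l" using p J_edge_Jspace[OF l(2)] l(3) dirn_pts[OF l(2)] by simp
    show ?thesis
    proof (cases "l \<in> T_l_edges M")
      case True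
      then obtain j where "j < length \<iota>" "l = \<iota> ! j" using i'(2) by (metis in_set_conv_nth)
      then show ?thesis using B(3) vv l(3) pJ by blast
    next
      case False
      then show ?thesis using vertex_single_non_T[OF l(1,2) False pJ vv l(3)] boundaries_span by blast
    qed
  qed
  have "vertex_chains M d \<subseteq> ?W"
  proof
    fix g assume g: "g \<in> vertex_chains M d"
    have "vertex_single v (g v) \<in> ?W" if v: "v \<in> interior_vertices M" for v
    proof -
      have "g v \<in> J_vertex d v" using g v unfolding vertex_chains_def by blast
      then obtain p q where pq: "g v = p + q" "p \<in> Jspace d False (fst v)" "q \<in> Jspace d True (snd v)"
        unfolding J_vertex_Jspace by blast
      have "vertex_single v p \<in> ?W" "vertex_single v q \<in> ?W" using sp[OF v, of p False] sp[OF v, of q True] pq by (simp_all add: co_def)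
      then show ?thesis unfolding pq(1) vertex_single_linear by (rule chain_vs.span_add)
    qed
    then have "(\<Sum>v\<in>interior_vertices M. vertex_single v (g v)) \<in> ?W" by (rule chain_vs.span_sum)
    then show "g \<in> ?W" unfolding vertex_chain_sum[OF g, symmetric] .
  qed
  moreover obtain r n where "ch.has_dim boundaries r" using homology_dims by metis
  ultimately have "hom_corr M d \<le> card B"
    unfolding hom_corr_def boundaries_def[symmetric]
    by (intro ch.quot_dim_le_card[OF _ vertex_chains_has_dim boundaries_vertex_chains B(1)])
  then show ?thesis using B(2) unfolding D_M_def by linarith
qed

section \<open>Lower bound by projection to a set of T l-edges\<close>

lemma edge_chain_bdry_sum:
  assumes "f \<in> edge_chains M d"
  shows "bdry M f = (\<Sum>e\<in>interior_edges M. vertex_single (snd e) (f e) - vertex_single (fst e) (f e))"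
proof -
  have "f = (\<Sum>e\<in>interior_edges M. edge_single e (f e))"
  proof
    fix e'
    have "(\<Sum>e\<in>interior_edges M. edge_single e (f e)) e' = (\<Sum>e\<in>interior_edges M. if e = e' then f e else 0)"
      unfolding sum_fun_apply by (rule sum.cong) (auto simp: edge_single_def)
    also have "\<dots> = f e'"
    proof -
      have "f e' = 0" if "e' \<notin> interior_edges M" using assms that unfolding edge_chains_def by blast
      then show ?thesis using finite_interior_edges by simp
    qed
    finally show "f e' = (\<Sum>e\<in>interior_edges M. edge_single e (f e)) e'" by simp
  qed
  then have "bdry M f = bdry M (\<Sum>e\<in>interior_edges M. edge_single e (f e))" by simp
  also have "\<dots> = (\<Sum>e\<in>interior_edges M. bdry M (edge_single e (f e)))"
    using ch_ch.linear_sum[OF linear_bdry] by simp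
  finally show ?thesis using bdry_edge_single by simp
qed

context
  fixes K :: "seg set"
  assumes K: "K \<subseteq> T_l_edges M"
begin

definition maxl_at :: "bool \<Rightarrow> real \<times> real \<Rightarrow> seg" where
  "maxl_at k v = (THE l. l \<in> maxl \<and> dirn k l \<and> v \<in> pts l)"

lemma maxl_at_eq: "l \<in> maxl \<Longrightarrow> dirn k l \<Longrightarrow> v \<in> pts l \<Longrightarrow> maxl_at k v = l"
  unfolding maxl_at_def by (rule the_equality) (use maxl_unique in blast)+

text \<open>One copy of the univariate polynomials for each segment of \<open>K\<close>, and zero
  for every other segment. The variable is written as x for both directions, so that the chain
  spaces can be reused.\<close>

definition segment_single :: "seg \<Rightarrow> real poly \<Rightarrow> seg \<Rightarrow> real poly poly" where
  "segment_single l q l' = (if l' = l \<and> l \<in> K then emb True q else 0)"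

definition component :: "bool \<Rightarrow> real \<times> real \<Rightarrow> real poly poly \<Rightarrow> real poly" where
  "component k v p = (if k then lc d k p - smult (coeff (coeff p d) d) (lpow d (co k v)) else lc d k p)"

text \<open>Reads off the components of a vertex chain along the segments of \<open>K\<close>. The two components at a vertex
  are only determined up to a multiple of \<open>vertex_relation v\<close>; \<open>component\<close> resolves the ambiguity in favour of the vertical one.\<close>

definition \<Lambda> :: "(real \<times> real \<Rightarrow> real poly poly) \<Rightarrow> seg \<Rightarrow> real poly poly" where
  "\<Lambda> g = (\<Sum>v\<in>interior_vertices M. segment_single (maxl_at False v) (component False v (g v)) + segment_single (maxl_at True v) (component True v (g v)))"

text \<open>The difference between the two readings of (x - a)^d (y - b)^d at v = (a, b): as (y -
  b)^d on the vertical and as (x - a)^d on the horizontal segment.\<close>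

definition vertex_relation :: "real \<times> real \<Rightarrow> seg \<Rightarrow> real poly poly" where
  "vertex_relation v = segment_single (maxl_at False v) (lpow d (co False v)) - segment_single (maxl_at True v) (lpow d (co True v))"

definition K_vertices :: "(real \<times> real) set" where
  "K_vertices = {v \<in> vertices M. \<exists>l\<in>K. v \<in> pts l}"

lemma segment_single_linear: "segment_single l (p + q) = segment_single l p + segment_single l q" "segment_single l (smult c p) = (\<lambda>z. smult [:c:] (segment_single l p z))"
  "segment_single l (p - q) = segment_single l p - segment_single l q" "segment_single l 0 = 0"
  by (auto simp: segment_single_def fun_eq_iff emb_add emb_smult emb_diff)

lemma component_linear: "component k v (p + q) = component k v p + component k v q" "component k v (smult [:c:] p) = smult c (component k v p)" "component k v 0 = 0"
  by (auto simp: component_def lc_add lc_smult smult_add_left smult_diff_right algebra_simps)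

lemma linear_\<Lambda>: "Vector_Spaces.linear (\<lambda>c f z. smult [:c:] (f z)) (\<lambda>c f z. smult [:c:] (f z)) \<Lambda>"
  by unfold_locales
    (auto simp: \<Lambda>_def component_linear segment_single_linear sum.distrib sum_fun_apply fun_eq_iff smult_sum2 smult_add_right algebra_simps)

lemma \<Lambda>_sv:
  assumes "v \<in> interior_vertices M"
  shows "\<Lambda> (vertex_single v p) = segment_single (maxl_at False v) (component False v p) + segment_single (maxl_at True v) (component True v p)"
proof -
  have "\<Lambda> (vertex_single v p) = (\<Sum>w\<in>interior_vertices M. if w = v then segment_single (maxl_at False v) (component False v p) + segment_single (maxl_at True v) (component True v p) else 0)"
    unfolding \<Lambda>_def by (rule sum.cong) (auto simp: vertex_single_def assms component_linear segment_single_linear)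
  then show ?thesis using assms finite_interior_vertices by simp
qed

lemma vertex_relation_span: "v \<in> interior_vertices M \<Longrightarrow> vertex_relation v \<in> chain_vs.span (vertex_relation ` K_vertices)"
proof -
  assume v: "v \<in> interior_vertices M"
  have vv: "v \<in> vertices M" using v by (simp add: interior_vertices_def)
  show ?thesis
  proof (cases "v \<in> K_vertices")
    case True
    then show ?thesis by (intro chain_vs.span_base imageI)
  next
    case False
    have "maxl_at k v \<notin> K" for k
    proof -
      obtain l where l: "l \<in> maxl" "dirn k l" "v \<in> pts l" using maxl_through[OF v] by blast
      then show ?thesis using maxl_at_eq[OF l] False vv unfolding K_vertices_def by auto
    qed
    then have "vertex_relation v = 0" unfolding vertex_relation_def by (auto simp: segment_single_def fun_eq_iff)
    then show ?thesis using chain_vs.span_zero by simp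
  qed
qed

text \<open>For a vertical \<open>l\<close> the reading is exact. For a horizontal one the leading
  coefficient is booked on the vertical segment, an error that is a multiple of
  \<open>vertex_relation v\<close>.\<close>

lemma \<Lambda>_sv_mod:
  assumes v: "v \<in> vertices M" "v \<in> pts l" and l: "l \<in> maxl" "dirn k l" and p: "p \<in> Jspace d k (co (\<not> k) v)"
  shows "\<Lambda> (vertex_single v p) - segment_single l (lc d k p) \<in> chain_vs.span (vertex_relation ` K_vertices)"
proof (cases "v \<in> interior_vertices M")
  case True
  have maxl_at: "maxl_at k v = l" using maxl_at_eq[OF l v(2)] .
  obtain q where q: "p = emb (\<not> k) (lpow d (co (\<not> k) v)) * emb k q" using p unfolding Jspace_def by blast
  have 1: "lc d k p = q" unfolding q lc_emb_mult by simp
  have 2: "lc d (\<not> k) p = smult (coeff q d) (lpow d (co (\<not> k) v))"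
    unfolding q using lc_emb_mult'[of d "\<not> k"] by simp
  have 3: "coeff (coeff p d) d = coeff q d"
    using arg_cong[OF 1, of "\<lambda>q. coeff q d"] by (simp add: coeff_lc split: if_splits)
  show ?thesis
  proof (cases k)
    case False
    have "component True v p = 0" "component False v p = q" using 1 2 3 False by (auto simp: component_def)
    then have "\<Lambda> (vertex_single v p) - segment_single l (lc d k p) = 0" using \<Lambda>_sv[OF True] maxl_at False 1 by (simp add: segment_single_linear)
    then show ?thesis using chain_vs.span_zero by simp
  next
    case kT: True
    have component: "component True v p = q - smult (coeff q d) (lpow d (co True v))" "component False v p = smult (coeff q d) (lpow d (co False v))"
      using 1 2 3 kT by (auto simp: component_def)
    have "\<Lambda> (vertex_single v p) - segment_single l (lc d k p) = (\<lambda>z. smult [:coeff q d:] (vertex_relation v z))"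
      unfolding \<Lambda>_sv[OF True] component segment_single_linear vertex_relation_def 1 using maxl_at kT by (auto simp: fun_eq_iff smult_diff_right)
    then show ?thesis using chain_vs.span_scale[OF vertex_relation_span[OF True]] by simp
  qed
next
  case False
  have "vertex_single v p = 0" using False by (auto simp: vertex_single_def fun_eq_iff)
  then have "\<Lambda> (vertex_single v p) = 0" by (simp add: \<Lambda>_def component_linear segment_single_linear)
  \<comment> \<open>All vertices on a T l-edge are interior, so a segment through \<open>v\<close>
    is outside \<open>K\<close> and both terms are zero.\<close>
  moreover have "l \<notin> K" using T_vertex_interior v False K by blast
  then have "segment_single l (lc d k p) = 0" by (auto simp: segment_single_def fun_eq_iff)
  ultimately show ?thesis using chain_vs.span_zero by simp
qed

text \<open>Modulo the relations, both ends of an edge give the same univariate factor on the same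
  maximal segment, so the two contributions cancel.\<close>

lemma \<Lambda>_bnd: "x \<in> boundaries \<Longrightarrow> \<Lambda> x \<in> chain_vs.span (vertex_relation ` K_vertices)"
proof -
  assume "x \<in> boundaries"
  then obtain f where f: "f \<in> edge_chains M d" "x = bdry M f" unfolding boundaries_def by blast
  have "\<Lambda> (vertex_single (snd e) (f e) - vertex_single (fst e) (f e)) \<in> chain_vs.span (vertex_relation ` K_vertices)" if e: "e \<in> interior_edges M" for e
  proof -
    obtain k where k: "dirn k e" using interior_edge_dirn[OF e] by blast
    obtain l where l: "l \<in> maxl" "dirn k l" "pts e \<subseteq> pts l" using maxl_exists[OF composed_edge[OF e] k] by blast
    have v: "fst e \<in> vertices M" "snd e \<in> vertices M" using e unfolding interior_edges_def edges_def by auto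
    have w: "fst e \<in> pts l" "snd e \<in> pts l" using dirn_ends[OF k] l(3) by auto
    have c: "co (\<not> k) (fst e) = co (\<not> k) (snd e)" using k by (simp add: dirn_def)
    have fe: "f e \<in> Jspace d k (co (\<not> k) (fst e))" using f(1) e J_edge_Jspace[OF k] unfolding edge_chains_def by auto
    have 1: "\<Lambda> (vertex_single (fst e) (f e)) - segment_single l (lc d k (f e)) \<in> chain_vs.span (vertex_relation ` K_vertices)"
      using \<Lambda>_sv_mod[OF v(1) w(1) l(1,2) fe] .
    have 2: "\<Lambda> (vertex_single (snd e) (f e)) - segment_single l (lc d k (f e)) \<in> chain_vs.span (vertex_relation ` K_vertices)"
      using \<Lambda>_sv_mod[OF v(2) w(2) l(1,2)] fe c by simp
    have "\<Lambda> (vertex_single (snd e) (f e) - vertex_single (fst e) (f e)) = \<Lambda> (vertex_single (snd e) (f e)) - \<Lambda> (vertex_single (fst e) (f e))"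
      by (rule ch_ch.linear_diff[OF linear_\<Lambda>])
    then show ?thesis using chain_vs.span_diff[OF 2 1] by simp
  qed
  then show ?thesis
    unfolding f(2) edge_chain_bdry_sum[OF f(1)] ch_ch.linear_sum[OF linear_\<Lambda>]
    by (rule chain_vs.span_sum)
qed

text \<open>The space with a polynomial of degree at most \<open>d\<close> on each segment of
  \<open>K\<close> lies in the span of the vertex relations and the images under
  \<open>\<Lambda>\<close> of representatives of a basis of the cokernel. Comparing dimensions gives
  the bound.\<close>

lemma hom_corr_lower: "card K * (d + 1) \<le> hom_corr M d + card K_vertices"
proof -
  obtain r where r: "ch.has_dim boundaries r" using homology_dims by metis
  obtain H where H: "finite H" "H \<subseteq> vertex_chains M d" "card H = hom_corr M d" "vertex_chains M d = chain_vs.span (boundaries \<union> H)"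
    using ch.quot_dim_complement[OF r vertex_chains_has_dim boundaries_vertex_chains] unfolding hom_corr_def boundaries_def by metis
  have fK: "finite K" using K finite_maxl finite_subset unfolding T_l_edges_maxl by (metis (no_types, lifting) mem_Collect_eq subsetI)
  have fKV: "finite K_vertices" using finite_vertices by (simp add: K_vertices_def)
  let ?W = "chain_vs.span (vertex_relation ` K_vertices \<union> \<Lambda> ` H)"
  have mono: "chain_vs.span (vertex_relation ` K_vertices) \<subseteq> ?W" by (rule chain_vs.span_mono) auto
  have VW: "\<Lambda> g \<in> ?W" if "g \<in> vertex_chains M d" for g
  proof -
    have "\<Lambda> g \<in> \<Lambda> ` chain_vs.span (boundaries \<union> H)" using that H(4) by blast
    also have "\<Lambda> ` chain_vs.span (boundaries \<union> H) = chain_vs.span (\<Lambda> ` (boundaries \<union> H))"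
      by (rule ch_ch.linear_span_image[OF linear_\<Lambda>, symmetric])
    also have "\<dots> \<subseteq> ?W"
    proof (rule chain_vs.span_minimal)
      show "\<Lambda> ` (boundaries \<union> H) \<subseteq> ?W"
      proof (rule image_subsetI)
        fix x assume "x \<in> boundaries \<union> H"
        then show "\<Lambda> x \<in> ?W"
        proof
          assume "x \<in> boundaries"
          then show ?thesis by (rule subsetD[OF mono \<Lambda>_bnd])
        next
          assume "x \<in> H"
          then show ?thesis by (intro chain_vs.span_base UnI2 imageI)
        qed
      qed
    qed (rule chain_vs.subspace_span)
    finally show ?thesis .
  qed
  have plW: "segment_single l q \<in> ?W" if l: "l \<in> K" and q: "degree q \<le> d" for l q
  proof -
    have m: "l \<in> maxl" "fst l \<in> interior_vertices M" using l K unfolding T_l_edges_maxl by auto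
    obtain k where k: "dirn k l" using maxl_dirn[OF m(1)] by blast
    define p where "p = emb (\<not> k) (lpow d (co (\<not> k) (fst l))) * emb k q"
    have p: "p \<in> Jspace d k (co (\<not> k) (fst l))" unfolding p_def Jspace_def using q by blast
    have "vertex_single (fst l) p \<in> vertex_chains M d"
      using Jspace_J_vertex[OF p] pp.subspace_0[OF J_vertex_subspace] by (auto simp: vertex_chains_def vertex_single_def)
    then have 1: "\<Lambda> (vertex_single (fst l) p) \<in> ?W" by (rule VW)
    have "\<Lambda> (vertex_single (fst l) p) - segment_single l (lc d k p) \<in> ?W"
      using \<Lambda>_sv_mod[OF _ _ m(1) k p] dirn_ends[OF k] m(2) mono by (auto simp: interior_vertices_def)
    then have "\<Lambda> (vertex_single (fst l) p) - (\<Lambda> (vertex_single (fst l) p) - segment_single l (lc d k p)) \<in> ?W" using chain_vs.span_diff[OF 1] by blast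
    then show ?thesis by (simp add: p_def lc_emb_mult)
  qed
  let ?Q = "(\<lambda>q. emb True 1 * emb True q) ` {p. degree p \<le> d}"
  let ?V = "{f. (\<forall>l\<in>K. f l \<in> ?Q) \<and> (\<forall>l. l \<notin> K \<longrightarrow> f l = 0)}"
  have Q: "pp.has_dim ?Q (d + 1)"
    by (rule rp_pp.has_dim_inj_image[OF linear_emb_mult rp_has_dim_degree]) (auto simp: emb_def)
  have V: "ch.has_dim ?V (\<Sum>l\<in>K. d + 1)" by (rule chains_has_dim[OF fK Q])
  have "?V \<subseteq> ?W"
  proof
    fix f assume f: "f \<in> ?V"
    then have "\<forall>l\<in>K. \<exists>q. degree q \<le> d \<and> f l = emb True q" by auto
    then obtain q where q: "\<And>l. l \<in> K \<Longrightarrow> degree (q l) \<le> d \<and> f l = emb True (q l)" by metis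
    have "f = (\<Sum>l\<in>K. segment_single l (q l))"
    proof
      fix l'
      have "(\<Sum>l\<in>K. segment_single l (q l)) l' = (\<Sum>l\<in>K. if l = l' then f l else 0)"
        unfolding sum_fun_apply by (rule sum.cong) (auto simp: segment_single_def q)
      moreover have "f l' = 0" if "l' \<notin> K" using f that by blast
      ultimately show "f l' = (\<Sum>l\<in>K. segment_single l (q l)) l'" using fK by simp
    qed
    moreover have "(\<Sum>l\<in>K. segment_single l (q l)) \<in> ?W" using plW q by (intro chain_vs.span_sum) blast
    ultimately show "f \<in> ?W" by simp
  qed
  moreover obtain A where A: "finite A" "chain_vs.independent A" "chain_vs.span A = ?V" "card A = (\<Sum>l\<in>K. d + 1)"
    using V by (rule ch.has_dimE)
  ultimately have "A \<subseteq> ?W" using chain_vs.span_superset[of A] by simp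
  moreover have "finite (vertex_relation ` K_vertices \<union> \<Lambda> ` H)" using fKV H(1) by simp
  ultimately have "card A \<le> card (vertex_relation ` K_vertices \<union> \<Lambda> ` H)"
    by (rule ch.has_dim_card_independent_le[OF A(2)])
  also have "\<dots> \<le> card K_vertices + card H"
    using card_Un_le[of "vertex_relation ` K_vertices" "\<Lambda> ` H"] card_image_le[OF fKV, of vertex_relation] card_image_le[OF H(1), of \<Lambda>] by linarith
  finally show ?thesis using A(4) H(3) by simp
qed

end

lemma hom_corr_CNDC: "K \<subseteq> T_l_edges M \<Longrightarrow> card K * (d + 1) \<le> hom_corr M d + n_CNDC M K"
  using hom_corr_lower[of K] K_vertices_def[of K] unfolding n_CNDC_def by simp

end

section \<open>Orderings\<close>

lemma pos_part_nonneg: "0 \<le> pos_part z"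
  by (simp add: pos_part_def)

lemma pos_part_mono: "x \<le> y \<Longrightarrow> pos_part x \<le> pos_part y"
  by (auto simp: pos_part_def)

context spline_mesh
begin

text \<open>A recursive form of \<open>D_M\<close>, suited to dropping edges from an order and to
  prepending further ones.\<close>

fun deficit :: "seg list \<Rightarrow> int" where
  "deficit [] = 0"
| "deficit (l # ls) = pos_part (int d + 1 - int (card {v \<in> vertices M. v \<in> pts l \<and> (\<forall>l'\<in>set ls. v \<notin> pts l')})) + deficit ls"

lemma D_M_deficit: "D_M M d ls = deficit ls"
proof (induction ls)
  case Nil
  then show ?case by (simp add: D_M_def)
next
  case (Cons l ls)
  have "\<omega> M (l # ls) 0 = card {v \<in> vertices M. v \<in> pts l \<and> (\<forall>l'\<in>set ls. v \<notin> pts l')}"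
  proof -
    have "(\<exists>j. 0 < j \<and> j < length (l # ls) \<and> v \<in> pts ((l # ls) ! j)) \<longleftrightarrow> (\<exists>l'\<in>set ls. v \<in> pts l')" for v
    proof
      assume "\<exists>j. 0 < j \<and> j < length (l # ls) \<and> v \<in> pts ((l # ls) ! j)"
      then obtain j where "0 < j" "j < length (l # ls)" "v \<in> pts ((l # ls) ! j)" by blast
      then show "\<exists>l'\<in>set ls. v \<in> pts l'" by (cases j) auto
    next
      assume "\<exists>l'\<in>set ls. v \<in> pts l'"
      then obtain j where "j < length ls" "v \<in> pts (ls ! j)" by (metis in_set_conv_nth)
      then show "\<exists>j. 0 < j \<and> j < length (l # ls) \<and> v \<in> pts ((l # ls) ! j)" by (intro exI[of _ "Suc j"]) auto
    qed
    then show ?thesis unfolding \<omega>_def by simp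
  qed
  moreover have "\<omega> M (l # ls) (Suc i) = \<omega> M ls i" for i
  proof -
    have "(\<exists>j. Suc i < j \<and> j < length (l # ls) \<and> v \<in> pts ((l # ls) ! j)) \<longleftrightarrow> (\<exists>j. i < j \<and> j < length ls \<and> v \<in> pts (ls ! j))" for v
    proof
      assume "\<exists>j. Suc i < j \<and> j < length (l # ls) \<and> v \<in> pts ((l # ls) ! j)"
      then obtain j where j: "Suc i < j" "j < length (l # ls)" "v \<in> pts ((l # ls) ! j)" by blast
      then show "\<exists>j. i < j \<and> j < length ls \<and> v \<in> pts (ls ! j)" by (cases j) auto
    next
      assume "\<exists>j. i < j \<and> j < length ls \<and> v \<in> pts (ls ! j)"
      then obtain j where "i < j" "j < length ls" "v \<in> pts (ls ! j)" by blast
      then show "\<exists>j. Suc i < j \<and> j < length (l # ls) \<and> v \<in> pts ((l # ls) ! j)" by (intro exI[of _ "Suc j"]) simp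
    qed
    then show ?thesis unfolding \<omega>_def by simp
  qed
  ultimately show ?case using Cons unfolding D_M_def by (simp add: sum.lessThan_Suc_shift del: sum.lessThan_Suc)
qed

text \<open>Dropping an edge removes a nonnegative term and leaves the edges before it at least as
  many free vertices.\<close>

lemma deficit_filter: "deficit (filter P ls) \<le> deficit ls"
proof (induction ls)
  case (Cons l ls)
  show ?case
  proof (cases "P l")
    case True
    have "card {v \<in> vertices M. v \<in> pts l \<and> (\<forall>l'\<in>set ls. v \<notin> pts l')}
      \<le> card {v \<in> vertices M. v \<in> pts l \<and> (\<forall>l'\<in>set (filter P ls). v \<notin> pts l')}"
      using finite_vertices by (intro card_mono) auto
    then have "pos_part (int d + 1 - int (card {v \<in> vertices M. v \<in> pts l \<and> (\<forall>l'\<in>set (filter P ls). v \<notin> pts l')}))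
      \<le> pos_part (int d + 1 - int (card {v \<in> vertices M. v \<in> pts l \<and> (\<forall>l'\<in>set ls. v \<notin> pts l')}))"
      by (intro pos_part_mono) simp
    then show ?thesis using Cons True by simp
  next
    case False
    then show ?thesis using Cons pos_part_nonneg by (simp add: add_increasing)
  qed
qed simp

lemma reasonable_order_snoc:
  assumes "reasonable_order d W (r @ [l])"
  shows "reasonable_order d W r" "d + 1 \<le> card {v \<in> W. v \<in> pts l \<and> (\<forall>l'\<in>set r. v \<notin> pts l')}"
proof -
  have *: "d + 1 \<le> card {v \<in> W. v \<in> pts ((r @ [l]) ! i) \<and> (\<forall>j<i. v \<notin> pts ((r @ [l]) ! j))}" if "i \<le> length r" for i
    using assms that unfolding reasonable_order_def by simp
  show "reasonable_order d W r"
    unfolding reasonable_order_def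
  proof (intro allI impI)
    fix i assume i: "i < length r"
    then have "{v \<in> W. v \<in> pts (r ! i) \<and> (\<forall>j<i. v \<notin> pts (r ! j))} =
      {v \<in> W. v \<in> pts ((r @ [l]) ! i) \<and> (\<forall>j<i. v \<notin> pts ((r @ [l]) ! j))}" by (auto simp: nth_append)
    then show "d + 1 \<le> card {v \<in> W. v \<in> pts (r ! i) \<and> (\<forall>j<i. v \<notin> pts (r ! j))}" using *[of i] i by simp
  qed
  have "{v \<in> W. v \<in> pts ((r @ [l]) ! length r) \<and> (\<forall>j<length r. v \<notin> pts ((r @ [l]) ! j))} =
    {v \<in> W. v \<in> pts l \<and> (\<forall>l'\<in>set r. v \<notin> pts l')}"
    by (simp add: nth_append all_set_conv_all_nth)
  then show "d + 1 \<le> card {v \<in> W. v \<in> pts l \<and> (\<forall>l'\<in>set r. v \<notin> pts l')}" using *[of "length r"] by simp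
qed

text \<open>A reasonable order deletes the vertices on preceding edges, the deficit those on
  following ones, whence the reversal. Since the vertices on \<open>\<pi>\<close> are removed
  beforehand, each prepended edge keeps \<open>d + 1\<close> vertices and costs nothing.\<close>

lemma deficit_rev_append:
  assumes "reasonable_order d (vertices M - (\<Union>l\<in>set \<pi>. pts l)) r"
  shows "deficit (rev r @ \<pi>) = deficit \<pi>"
  using assms
proof (induction r rule: rev_induct)
  case (snoc l r)
  have "{v \<in> vertices M - (\<Union>l\<in>set \<pi>. pts l). v \<in> pts l \<and> (\<forall>l'\<in>set r. v \<notin> pts l')} =
    {v \<in> vertices M. v \<in> pts l \<and> (\<forall>l'\<in>set (rev r @ \<pi>). v \<notin> pts l')}" by auto
  then have "d + 1 \<le> card {v \<in> vertices M. v \<in> pts l \<and> (\<forall>l'\<in>set (rev r @ \<pi>). v \<notin> pts l')}"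
    using reasonable_order_snoc(2)[OF snoc(2)] by simp
  then have "pos_part (int d + 1 - int (card {v \<in> vertices M. v \<in> pts l \<and> (\<forall>l'\<in>set (rev r @ \<pi>). v \<notin> pts l')})) = 0"
    by (simp add: pos_part_def)
  then show ?case using snoc(1)[OF reasonable_order_snoc(1)[OF snoc(2)]] by simp
qed simp

lemma at_most_two:
  assumes "l1 \<in> T_l_edges M" "l2 \<in> T_l_edges M" "l3 \<in> T_l_edges M" "v \<in> pts l1" "v \<in> pts l2" "v \<in> pts l3"
  shows "l1 = l2 \<or> l1 = l3 \<or> l2 = l3"
proof -
  have m: "l1 \<in> maxl" "l2 \<in> maxl" "l3 \<in> maxl" using assms unfolding T_l_edges_maxl by auto
  obtain k1 k2 k3 where k: "dirn k1 l1" "dirn k2 l2" "dirn k3 l3" using m maxl_dirn by metis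
  consider "k1 = k2" | "k1 = k3" | "k2 = k3" by auto
  then show ?thesis
  proof cases
    case 1
    then show ?thesis using maxl_unique[OF m(1,2) k(1)] k(2) assms(4,5) by simp
  next
    case 2
    then show ?thesis using maxl_unique[OF m(1,3) k(1)] k(3) assms(4,6) by simp
  next
    case 3
    then show ?thesis using maxl_unique[OF m(2,3) k(2)] k(3) assms(5,6) by simp
  qed
qed

text \<open>Every vertex lies on at most two T l-edges, so a multi-vertex on an edge is shared either with an
  earlier or with a later edge, but not with both.\<close>

lemma \<omega>_multi_vertices:
  assumes K: "K \<subseteq> T_l_edges M" and p: "distinct \<pi>" "set \<pi> = K" and i: "i < length \<pi>"
  shows "\<omega> M \<pi> i + m_on M K (\<pi> ! i) = n_on M (\<pi> ! i) + u_minus M K \<pi> i"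
proof -
  let ?V = "vertices M \<inter> pts (\<pi> ! i)"
  let ?L = "{v \<in> ?V. \<exists>j. i < j \<and> j < length \<pi> \<and> v \<in> pts (\<pi> ! j)}"
  let ?U = "{v \<in> multi_vertices M K. v \<in> pts (\<pi> ! i) \<and> (\<exists>j<i. v \<in> pts (\<pi> ! j))}"
  let ?O = "{v \<in> vertices M. v \<in> pts (\<pi> ! i) \<and> \<not> (\<exists>j. i < j \<and> j < length \<pi> \<and> v \<in> pts (\<pi> ! j))}"
  have T: "\<pi> ! j \<in> T_l_edges M" "\<pi> ! j \<in> K" if "j < length \<pi>" for j using K p that nth_mem by blast+
  have ne: "\<pi> ! j \<noteq> \<pi> ! j'" if "j < length \<pi>" "j' < length \<pi>" "j \<noteq> j'" for j j'
    using p(1) that nth_eq_iff_index_eq by blast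
  have multi: "v \<in> multi_vertices M K \<longleftrightarrow> (\<exists>j<length \<pi>. j \<noteq> i \<and> v \<in> pts (\<pi> ! j))" if v: "v \<in> ?V" for v
  proof
    assume "v \<in> multi_vertices M K"
    then obtain l l' where "l \<in> K" "l' \<in> K" "l \<noteq> l'" "v \<in> pts l" "v \<in> pts l'" unfolding multi_vertices_def by blast
    then obtain l'' where "l'' \<in> K" "l'' \<noteq> \<pi> ! i" "v \<in> pts l''" by metis
    then show "\<exists>j<length \<pi>. j \<noteq> i \<and> v \<in> pts (\<pi> ! j)" using p(2) by (metis in_set_conv_nth)
  next
    assume "\<exists>j<length \<pi>. j \<noteq> i \<and> v \<in> pts (\<pi> ! j)"
    then show "v \<in> multi_vertices M K" using v T(2) i ne unfolding multi_vertices_def by blast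
  qed
  have "multi_vertices M K \<inter> pts (\<pi> ! i) = ?U \<union> ?L"
  proof (intro equalityI subsetI)
    fix v assume v: "v \<in> multi_vertices M K \<inter> pts (\<pi> ! i)"
    then have vV: "v \<in> ?V" unfolding multi_vertices_def by blast
    then obtain j where "j < length \<pi>" "j \<noteq> i" "v \<in> pts (\<pi> ! j)" using multi v by blast
    then show "v \<in> ?U \<union> ?L" using v vV by (cases "j < i") auto
  next
    fix v assume "v \<in> ?U \<union> ?L"
    then show "v \<in> multi_vertices M K \<inter> pts (\<pi> ! i)"
    proof
      assume "v \<in> ?L"
      then obtain j where "v \<in> ?V" "i < j" "j < length \<pi>" "v \<in> pts (\<pi> ! j)" by blast
      then show ?thesis using multi[of v] by blast
    qed blast
  qed
  moreover have "?U \<inter> ?L = {}"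
  proof (rule ccontr)
    assume "?U \<inter> ?L \<noteq> {}"
    then obtain v j j' where v: "v \<in> pts (\<pi> ! i)" "j < i" "v \<in> pts (\<pi> ! j)" "i < j'" "j' < length \<pi>" "v \<in> pts (\<pi> ! j')"
      by blast
    then have "\<pi> ! i = \<pi> ! j \<or> \<pi> ! i = \<pi> ! j' \<or> \<pi> ! j = \<pi> ! j'"
      using at_most_two[OF T(1)[OF i] T(1)[of j] T(1)[of j'] v(1,3,6)] i by simp
    then show False using ne[of i j] ne[of i j'] ne[of j j'] v(2,4,5) i by auto
  qed
  moreover have fU: "finite ?U" "finite ?L" "finite ?O"
    using finite_vertices by (auto simp: multi_vertices_def)
  ultimately have 1: "m_on M K (\<pi> ! i) = card ?U + card ?L" unfolding m_on_def by (simp add: card_Un_disjoint)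
  have "card ?V = card (?O \<union> ?L)" by (rule arg_cong[of _ _ card]) blast
  also have "\<dots> = card ?O + card ?L" by (rule card_Un_disjoint[OF fU(3,2)]) blast
  finally have 2: "n_on M (\<pi> ! i) = card ?O + card ?L" unfolding n_on_def .
  show ?thesis using 1 2 unfolding \<omega>_def u_minus_def by simp
qed

text \<open>The correction of the CNDC is the ordinary one for a list of its edges alone: termwise
  both count the vertices not shared with later edges of the list.\<close>

lemma D_CNDC_D_M:
  assumes K: "K \<subseteq> T_l_edges M" and p: "\<pi> \<in> permutations_of_set K"
  shows "D_CNDC M d K \<pi> = D_M M d \<pi>"
proof -
  have p': "distinct \<pi>" "set \<pi> = K" using p by (auto simp: permutations_of_set_def)
  show ?thesis unfolding D_CNDC_def D_M_def
  proof (rule sum.cong)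
    fix i assume "i \<in> {..<length \<pi>}"
    then have "int (\<omega> M \<pi> i) + int (m_on M K (\<pi> ! i)) = int (n_on M (\<pi> ! i)) + int (u_minus M K \<pi> i)"
      using \<omega>_multi_vertices[OF K p', of i] unfolding of_nat_add[symmetric] by simp
    then have eq: "int (m_on M K (\<pi> ! i)) - int (n_on M (\<pi> ! i)) + int d + 1 - int (u_minus M K \<pi> i) = int d + 1 - int (\<omega> M \<pi> i)"
      by linarith
    show "pos_part (int (m_on M K (\<pi> ! i)) - int (n_on M (\<pi> ! i)) + int d + 1 - int (u_minus M K \<pi> i)) =
      pos_part (int d + 1 - int (\<omega> M \<pi> i))" by (simp only: eq)
  qed simp
qed

text \<open>Common form of both cases of \<open>is_CNDC\<close>: for a diagonalizable mesh
  \<open>K\<close> is empty and the order is that of all T l-edges.\<close>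

lemma CNDC_order:
  assumes "is_CNDC M d K"
  shows "K \<subseteq> T_l_edges M"
    "\<exists>r\<in>permutations_of_set (T_l_edges M - K). reasonable_order d (vertices M - (\<Union>l\<in>K. pts l)) r"
  using assms unfolding is_CNDC_def diagonalizable_def complete_partition_def regular_partition_def has_reasonable_order_def
  by (auto split: if_splits)

lemma finite_T: "finite (T_l_edges M)"
  using finite_maxl unfolding T_l_edges_maxl by simp

lemma min_D_CNDC:
  assumes "is_CNDC M d K"
  shows "(MIN \<pi>\<in>permutations_of_set K. D_CNDC M d K \<pi>) = (MIN \<iota>\<in>permutations_of_set (T_l_edges M). D_M M d \<iota>)"
proof -
  have K: "K \<subseteq> T_l_edges M" using CNDC_order(1)[OF assms] .
  obtain r where r: "r \<in> permutations_of_set (T_l_edges M - K)" "reasonable_order d (vertices M - (\<Union>l\<in>K. pts l)) r"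
    using CNDC_order(2)[OF assms] by blast
  have fK: "finite K" using K finite_T finite_subset by blast
  have fin: "finite (permutations_of_set A)" "permutations_of_set A \<noteq> {}" if "finite A" for A :: "seg set"
    using that by auto
  have "(MIN \<pi>\<in>permutations_of_set K. D_CNDC M d K \<pi>) = (MIN \<pi>\<in>permutations_of_set K. deficit \<pi>)"
    using D_CNDC_D_M[OF K] by (intro arg_cong[of _ _ Min] image_cong) (auto simp: D_M_deficit)
  also have "\<dots> = (MIN \<iota>\<in>permutations_of_set (T_l_edges M). deficit \<iota>)"
  proof (rule antisym)
    show "(MIN \<pi>\<in>permutations_of_set K. deficit \<pi>) \<le> (MIN \<iota>\<in>permutations_of_set (T_l_edges M). deficit \<iota>)"
    proof (rule Min.boundedI)
      fix x assume "x \<in> deficit ` permutations_of_set (T_l_edges M)"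
      then obtain \<iota> where i: "\<iota> \<in> permutations_of_set (T_l_edges M)" "x = deficit \<iota>" by blast
      \<comment> \<open>The converse comparison: restricting an ordering of all T l-edges to
        \<open>K\<close> does not increase the correction.\<close>
      have "filter (\<lambda>l. l \<in> K) \<iota> \<in> permutations_of_set K"
        using i(1) K by (auto simp: permutations_of_set_def)
      then have "(MIN \<pi>\<in>permutations_of_set K. deficit \<pi>) \<le> deficit (filter (\<lambda>l. l \<in> K) \<iota>)"
        using fin[OF fK] by (intro Min_le) auto
      then show "(MIN \<pi>\<in>permutations_of_set K. deficit \<pi>) \<le> x" using deficit_filter[of "\<lambda>l. l \<in> K" \<iota>] i(2) by linarith
    qed (use fin[OF finite_T] in auto)
    show "(MIN \<iota>\<in>permutations_of_set (T_l_edges M). deficit \<iota>) \<le> (MIN \<pi>\<in>permutations_of_set K. deficit \<pi>)"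
    proof (rule Min.boundedI)
      fix x assume "x \<in> deficit ` permutations_of_set K"
      then obtain \<pi> where p: "\<pi> \<in> permutations_of_set K" "x = deficit \<pi>" by blast
      have sp: "set \<pi> = K" "distinct \<pi>" using p(1) by (auto simp: permutations_of_set_def)
      have "rev r @ \<pi> \<in> permutations_of_set (T_l_edges M)"
        using r(1) sp K by (auto simp: permutations_of_set_def)
      then have "(MIN \<iota>\<in>permutations_of_set (T_l_edges M). deficit \<iota>) \<le> deficit (rev r @ \<pi>)"
        using fin[OF finite_T] by (intro Min_le) auto
      then show "(MIN \<iota>\<in>permutations_of_set (T_l_edges M). deficit \<iota>) \<le> x"
        using deficit_rev_append[of \<pi> r] r(2) sp(1) p(2) by simp
    qed (use fin[OF fK] in auto)
  qed
  finally show ?thesis by (simp add: D_M_deficit)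
qed

lemma U_K_D_CNDC:
  "U_K M d K = B0 M d + (MIN \<pi>\<in>permutations_of_set K. D_CNDC M d K \<pi>)"
proof -
  have "length \<pi> = card K" if "\<pi> \<in> permutations_of_set K" for \<pi>
    using that distinct_card[of \<pi>] by (simp add: permutations_of_set_def)
  then have "(\<lambda>\<pi>. \<Sum>i<card K. pos_part (int (m_on M K (\<pi> ! i)) - int (n_on M (\<pi> ! i)) + int d + 1 - int (u_minus M K \<pi> i)))
      ` permutations_of_set K = D_CNDC M d K ` permutations_of_set K"
    by (intro image_cong) (auto simp: D_CNDC_def)
  then show ?thesis unfolding U_K_def B0_def by simp
qed

end

theorem theorem4p4:
  fixes M :: "(real \<times> real) set set" and d :: nat and K :: "seg set"
  assumes "d \<ge> 1"
    and "T_mesh M"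
    and "connected (\<Union>l\<in>T_l_edges M. pts l)"
    and "\<forall>l\<in>T_l_edges M. n_on M l \<ge> d + 2"
    and "is_CNDC M d K"
  shows
    "(B0 M d \<le> int (dim_splines M d) \<and>
      int (dim_splines M d) = B0 M d + int (hom_corr M d) \<and>
      B0 M d + int (hom_corr M d) \<le> B0 M d + (MIN \<iota>\<in>permutations_of_set (T_l_edges M). D_M M d \<iota>)) \<and>
     (U_K M d K = B0 M d + (MIN \<pi>\<in>permutations_of_set K. D_CNDC M d K \<pi>) \<and>
      B0 M d + (MIN \<pi>\<in>permutations_of_set K. D_CNDC M d K \<pi>)
        = B0 M d + (MIN \<iota>\<in>permutations_of_set (T_l_edges M). D_M M d \<iota>)) \<and>
     (B0 M d \<le> L_K M d K \<and> L_K M d K \<le> int (dim_splines M d) \<and>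
      L_K M d K = B0 M d + pos_part (int (card K) * (int d + 1) - int (n_CNDC M K)))"
proof -
  interpret spline_mesh M d by unfold_locales (use assms(1,2) in auto)
  have dim: "int (dim_splines M d) = B0 M d + int (hom_corr M d)" by (rule dim_splines_formula)
  have upper: "int (hom_corr M d) \<le> (MIN \<iota>\<in>permutations_of_set (T_l_edges M). D_M M d \<iota>)"
    using hom_corr_le_D_M finite_T by (intro Min.boundedI) auto
  have L: "L_K M d K = B0 M d + pos_part (int (card K) * (int d + 1) - int (n_CNDC M K))"
    by (simp add: L_K_def B0_def)
  have "int (card K * (d + 1)) \<le> int (hom_corr M d + n_CNDC M K)"
    using hom_corr_CNDC[OF CNDC_order(1)[OF assms(5)]] by (rule of_nat_mono)
  then have "int (card K) * (int d + 1) \<le> int (hom_corr M d) + int (n_CNDC M K)" by (simp add: algebra_simps)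
  then have lower: "pos_part (int (card K) * (int d + 1) - int (n_CNDC M K)) \<le> int (hom_corr M d)"
    by (simp add: pos_part_def)
  show ?thesis
    using dim upper L lower pos_part_nonneg min_D_CNDC[OF assms(5)] U_K_D_CNDC by simp
qed

end
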